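(* Let $N\ge 2$ be an integer and let $f:[0,+\infty)\to\mathbb{R}$ be locally Lipschitz-continuous and such that: (i) there is $\mu>0$ with $f>0$ on $(0,\mu)$ and $f\le 0$ on $[\mu,+\infty)$; (ii) there is $\mu'\in(0,\mu)$ such that $f$ is nonincreasing on $[\mu',\mu]$; (iii) either $f(0)>0$, or [$f(0)=0$ and $\liminf_{s\to 0^+} f(s)/s>0$]; (iv) $\displaystyle\liminf_{s\to z^-}\frac{f(s)}{s-z}>0$ for all $z>\mu$ such that $f(z)=0$. Let $E=\{z\in[0,+\infty): f(z)=0\}$ and $\Omega'=(0,+\infty)\times\mathbb{R}^{N-1}$. Let $K^+$ be the set of all bounded nonnegative solutions $u$ of $\Delta u+f(u)=0$ in $\Omega'$ (with arbitrary continuous bounded nonnegative values $u_0$ at $x_1=0$) and, for $M\ge 0$, let $K^+_M=K^+\cap\{0\le u\le M\}$. Then, for every $M\ge\mu$, the trajectory dynamical system $(T_h,K^+_M)$ possesses a global attractor $A_{tr}$, which is bounded in $C^{2,\beta}_b(\overline{\Omega'})$ and then compact in $C^{2,\beta}_{loc}(\overline{\Omega'})$ for all $\beta\in[0,1)$, and satisfies $$A_{tr}=\Pi_{\overline{\Omega'}}K^+_M(\mathbb{R}^N),$$ where $K^+_M(\mathbb{R}^N)$ is the set of all bounded nonnegative solutions $u$ of $\Delta u+f(u)=0$ in $\mathbb{R}^N$ such that $0\le u\le M$, and $\Pi_{\overline{\Omega'}}$ denotes the restriction to $\overline{\Omega'}$. Hence $$A_{tr}=\{z\in[0,M]\ |\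 f(z)=0\}=E\cap[0,M]$$ (real numbers being identified with constant functions). Lastly, for any $u\in K^+$ such that $0\le u\le M$, the functions $T_hu$ converge as $h\to+\infty$ in $C^{2,\beta}_{loc}(\overline{\Omega'})$ for all $\beta\in[0,1)$ to some $z\in E\cap[0,M]$ which is uniquely defined by $u$.
   Context: Elements $u$ of $K^+$ are bounded, nonnegative, of class $C^2(\Omega')$ and continuous on $\overline{\Omega'}$; solutions in $\mathbb{R}^N$ are classical. $K^+$ and $K^+_M$ are endowed with the local topology induced by the embedding in $C^{2,\beta}_{loc}(\overline{\Omega'}\setminus\{x_1=0\})$ for all $\beta\in[0,1)$. The semi-flow is $(T_hu)(x_1,x_2,\ldots,x_N)=u(x_1+h,x_2,\ldots,x_N)$, $h\ge 0$; it maps $K^+_M$ into itself. For a closed set $F\subset\mathbb{R}^N$ and $\beta\in[0,1)$, $C^{2,\beta}_b(F)$ is the space of functions $w:F\to\mathbb{R}$ with $\|w\|_{C^{2,\beta}_b(F)}=\sup_{x\in F}\|w\|_{C^{2,\beta}(\overline{B(x,1)}\cap F)}<\infty$, where $B(x,1)$ is the open Euclidean ball of radius $1$ centered at $x$; $C^{2,\beta}_{loc}(F)$ carries the topology of $C^{2,\beta}$-convergence on compact subsets of $F$. A global attractor of $(T_h,K^+_M)$ is a set $A_{tr}\subset K^+_M$ such that: $A_{tr}$ is compact in $C^{2,\beta}_{loc}(\overline{\Omega'})$ for all $\beta\in[0,1)$; $T_hA_{tr}=A_{tr}$ for all $h\ge 0$; and $A_{tr}$ attracts bounded sets, i.e.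 for every $B\subset K^+_M$ (all such $B$ are bounded in $L^\infty(\Omega')$), every $\beta\in[0,1)$ and every neighbourhood $\mathcal{O}$ of $A_{tr}$ in $C^{2,\beta}_{loc}(\overline{\Omega'})$, there is $h_0>0$ such that $T_hB\subset\mathcal{O}$ for all $h\ge h_0$. *)

theory Defs
  imports "HOL-Analysis.Analysis"
begin

text \<open>
  Functions on a set \<open>F\<close> are represented by functions on the whole type that belong to
  \<open>extensional F\<close>, so that equality of functions is equality on \<open>F\<close>.

  Derivatives are taken within the domain \<open>F\<close>. On an open set these are the ordinary ones; on a
  closed half-space they are still unique and give the derivatives up to the boundary.
\<close>

definition pderiv_in :: "(real^'n) set \<Rightarrow> 'n \<Rightarrow> (real^'n \<Rightarrow> real) \<Rightarrow> real^'n \<Rightarrow> real" where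
  "pderiv_in F i w x = frechet_derivative w (at x within F) (axis i 1)"

definition pderiv2_in :: "(real^'n) set \<Rightarrow> 'n \<Rightarrow> 'n \<Rightarrow> (real^'n \<Rightarrow> real) \<Rightarrow> real^'n \<Rightarrow> real" where
  "pderiv2_in F i j w = pderiv_in F j (pderiv_in F i w)"

definition laplacian_in :: "(real^'n) set \<Rightarrow> (real^'n \<Rightarrow> real) \<Rightarrow> real^'n \<Rightarrow> real" where
  "laplacian_in F w x = (\<Sum>i\<in>UNIV. pderiv2_in F i i w x)"

definition C2_on :: "(real^'n) set \<Rightarrow> (real^'n \<Rightarrow> real) \<Rightarrow> bool" where
  "C2_on F w \<longleftrightarrow>
     w differentiable_on F \<and>
     (\<forall>i. pderiv_in F i w differentiable_on F) \<and>
     (\<forall>i j. continuous_on F (pderiv2_in F i j w))"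


text \<open>
  The \<open>C\<^sup>2\<^sup>,\<^sup>\<beta>\<close> norm over \<open>K \<subseteq> F\<close> of a function on \<open>F\<close>; the value may be \<open>\<infinity>\<close>. For \<open>\<beta> = 0\<close> the last
  sum is the oscillation of the second derivatives, at most twice their supremum, so that the
  norm is then equivalent to the usual \<open>C\<^sup>2\<close> norm.
\<close>

definition C2h_norm ::
    "(real^'n) set \<Rightarrow> real \<Rightarrow> (real^'n) set \<Rightarrow> (real^'n \<Rightarrow> real) \<Rightarrow> ennreal" where
  "C2h_norm F \<beta> K w =
     (SUP x\<in>K. ennreal \<bar>w x\<bar>)
     + (\<Sum>i\<in>UNIV. SUP x\<in>K. ennreal \<bar>pderiv_in F i w x\<bar>)
     + (\<Sum>i\<in>UNIV. \<Sum>j\<in>UNIV. SUP x\<in>K. ennreal \<bar>pderiv2_in F i j w x\<bar>)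
     + (\<Sum>i\<in>UNIV. \<Sum>j\<in>UNIV. SUP (x, y)\<in>{(x, y). x \<in> K \<and> y \<in> K \<and> x \<noteq> y}.
          ennreal (\<bar>pderiv2_in F i j w x - pderiv2_in F i j w y\<bar> / dist x y powr \<beta>))"

definition C2h_b_norm :: "(real^'n) set \<Rightarrow> real \<Rightarrow> (real^'n \<Rightarrow> real) \<Rightarrow> ennreal" where
  "C2h_b_norm F \<beta> w = (SUP x\<in>F. C2h_norm F \<beta> (cball x 1 \<inter> F) w)"

definition C2h_b :: "(real^'n) set \<Rightarrow> real \<Rightarrow> (real^'n \<Rightarrow> real) set" where
  "C2h_b F \<beta> = {w \<in> extensional F. C2_on F w \<and> C2h_b_norm F \<beta> w < \<infinity>}"

definition bounded_in_C2h_b :: "(real^'n) set \<Rightarrow> real \<Rightarrow> (real^'n \<Rightarrow> real) set \<Rightarrow> bool" where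
  "bounded_in_C2h_b F \<beta> A \<longleftrightarrow>
     A \<subseteq> C2h_b F \<beta> \<and> (\<exists>C::real. \<forall>w\<in>A. C2h_b_norm F \<beta> w \<le> ennreal C)"

definition C2h_loc :: "(real^'n) set \<Rightarrow> real \<Rightarrow> (real^'n \<Rightarrow> real) set" where
  "C2h_loc F \<beta> =
     {w \<in> extensional F. C2_on F w \<and> (\<forall>K. compact K \<and> K \<subseteq> F \<longrightarrow> C2h_norm F \<beta> K w < \<infinity>)}"

definition C2h_loc_open :: "(real^'n) set \<Rightarrow> real \<Rightarrow> (real^'n \<Rightarrow> real) set \<Rightarrow> bool" where
  "C2h_loc_open F \<beta> U \<longleftrightarrow>
     U \<subseteq> C2h_loc F \<beta> \<and>
     (\<forall>u\<in>U. \<exists>K \<epsilon>. compact K \<and> K \<subseteq> F \<and> (\<epsilon>::real) > 0 \<and>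
        (\<forall>v\<in>C2h_loc F \<beta>. C2h_norm F \<beta> K (\<lambda>x. v x - u x) < ennreal \<epsilon> \<longrightarrow> v \<in> U))"

definition C2h_loc_topology :: "(real^'n) set \<Rightarrow> real \<Rightarrow> (real^'n \<Rightarrow> real) topology" where
  "C2h_loc_topology F \<beta> = topology (C2h_loc_open F \<beta>)"

lemma C2h_norm_mono:
  assumes "K \<subseteq> L"
  shows "C2h_norm F \<beta> K w \<le> C2h_norm F \<beta> L w"
  unfolding C2h_norm_def
  by (intro add_mono sum_mono SUP_subset_mono) (use assms in auto)

lemma istopology_C2h_loc_open: "istopology (C2h_loc_open F \<beta>)"
  unfolding istopology_def
proof (intro conjI allI impI)
  fix S T assume S: "C2h_loc_open F \<beta> S" and T: "C2h_loc_open F \<beta> T"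
  show "C2h_loc_open F \<beta> (S \<inter> T)"
    unfolding C2h_loc_open_def
  proof (intro conjI ballI)
    show "S \<inter> T \<subseteq> C2h_loc F \<beta>" using S unfolding C2h_loc_open_def by blast
    fix u assume u: "u \<in> S \<inter> T"
    obtain K1 e1 where 1: "compact K1" "K1 \<subseteq> F" "(e1::real) > 0"
      "\<And>v. v \<in> C2h_loc F \<beta> \<Longrightarrow> C2h_norm F \<beta> K1 (\<lambda>x. v x - u x) < ennreal e1 \<Longrightarrow> v \<in> S"
      using S u unfolding C2h_loc_open_def by blast
    obtain K2 e2 where 2: "compact K2" "K2 \<subseteq> F" "(e2::real) > 0"
      "\<And>v. v \<in> C2h_loc F \<beta> \<Longrightarrow> C2h_norm F \<beta> K2 (\<lambda>x. v x - u x) < ennreal e2 \<Longrightarrow> v \<in> T"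
      using T u unfolding C2h_loc_open_def by blast
    have "v \<in> S \<inter> T" if v: "v \<in> C2h_loc F \<beta>"
      and n: "C2h_norm F \<beta> (K1 \<union> K2) (\<lambda>x. v x - u x) < ennreal (min e1 e2)" for v
    proof
      have "C2h_norm F \<beta> K1 (\<lambda>x. v x - u x) < ennreal (min e1 e2)"
        using C2h_norm_mono[of K1 "K1 \<union> K2"] n by (meson Un_upper1 order.strict_trans1)
      also have "\<dots> \<le> ennreal e1" by (rule ennreal_leI) simp
      finally show "v \<in> S" using 1 v by blast
      have "C2h_norm F \<beta> K2 (\<lambda>x. v x - u x) < ennreal (min e1 e2)"
        using C2h_norm_mono[of K2 "K1 \<union> K2"] n by (meson Un_upper2 order.strict_trans1)
      also have "\<dots> \<le> ennreal e2" by (rule ennreal_leI) simp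
      finally show "v \<in> T" using 2 v by blast
    qed
    then show "\<exists>K \<epsilon>. compact K \<and> K \<subseteq> F \<and> (\<epsilon>::real) > 0 \<and>
        (\<forall>v\<in>C2h_loc F \<beta>. C2h_norm F \<beta> K (\<lambda>x. v x - u x) < ennreal \<epsilon> \<longrightarrow> v \<in> S \<inter> T)"
      using 1 2 by (intro exI[of _ "K1 \<union> K2"] exI[of _ "min e1 e2"]) auto
  qed
next
  fix \<K> assume *: "\<forall>S\<in>\<K>. C2h_loc_open F \<beta> S"
  show "C2h_loc_open F \<beta> (\<Union>\<K>)"
    unfolding C2h_loc_open_def
  proof (intro conjI ballI)
    show "\<Union>\<K> \<subseteq> C2h_loc F \<beta>" using * unfolding C2h_loc_open_def by blast
    fix u assume "u \<in> \<Union>\<K>"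
    then obtain S where S: "S \<in> \<K>" "u \<in> S" by (elim UnionE)
    with * have "C2h_loc_open F \<beta> S" by simp
    with S(2) obtain K e where K: "compact K" "K \<subseteq> F" "(e::real) > 0"
      "\<forall>v\<in>C2h_loc F \<beta>. C2h_norm F \<beta> K (\<lambda>x. v x - u x) < ennreal e \<longrightarrow> v \<in> S"
      unfolding C2h_loc_open_def by meson
    show "\<exists>K \<epsilon>. compact K \<and> K \<subseteq> F \<and> (\<epsilon>::real) > 0 \<and>
        (\<forall>v\<in>C2h_loc F \<beta>. C2h_norm F \<beta> K (\<lambda>x. v x - u x) < ennreal \<epsilon> \<longrightarrow> v \<in> \<Union>\<K>)"
      using K S(1) by (intro exI[of _ K] exI[of _ e] conjI ballI impI) (simp_all, meson)
  qed
qed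

lemma openin_C2h_loc_topology: "openin (C2h_loc_topology F \<beta>) U \<longleftrightarrow> C2h_loc_open F \<beta> U"
  by (simp add: C2h_loc_topology_def istopology_C2h_loc_open)

lemma topspace_C2h_loc_topology: "topspace (C2h_loc_topology F \<beta>) = C2h_loc F \<beta>"
proof
  show "topspace (C2h_loc_topology F \<beta>) \<subseteq> C2h_loc F \<beta>"
    using openin_topspace[of "C2h_loc_topology F \<beta>"]
    unfolding openin_C2h_loc_topology C2h_loc_open_def by blast
  have "C2h_loc_open F \<beta> (C2h_loc F \<beta>)"
    unfolding C2h_loc_open_def by (auto intro!: exI[of _ "{}"] exI[of _ "1::real"])
  then show "C2h_loc F \<beta> \<subseteq> topspace (C2h_loc_topology F \<beta>)"
    by (simp add: openin_C2h_loc_topology openin_subset)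
qed


text \<open>The bounded nonnegative solutions of \<open>\<Delta>u + f(u) = 0\<close> in the open set \<open>\<Omega>\<close>, continuous up to
  the boundary. Only the values of \<open>f\<close> on \<open>[0, \<infinity>)\<close> matter.\<close>

definition Kplus :: "(real \<Rightarrow> real) \<Rightarrow> (real^'n) set \<Rightarrow> (real^'n \<Rightarrow> real) set" where
  "Kplus f \<Omega> = {u \<in> extensional (closure \<Omega>).
     continuous_on (closure \<Omega>) u \<and> C2_on \<Omega> u \<and>
     bounded (u ` closure \<Omega>) \<and> (\<forall>x\<in>closure \<Omega>. 0 \<le> u x) \<and>
     (\<forall>x\<in>\<Omega>. laplacian_in \<Omega> u x + f (u x) = 0)}"

definition KplusM :: "(real \<Rightarrow> real) \<Rightarrow> (real^'n) set \<Rightarrow> real \<Rightarrow> (real^'n \<Rightarrow> real) set" where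
  "KplusM f \<Omega> M = {u \<in> Kplus f \<Omega>. \<forall>x\<in>closure \<Omega>. 0 \<le> u x \<and> u x \<le> M}"

text \<open>The index \<open>k\<close> plays the role of the first coordinate.\<close>

definition half_space :: "'n \<Rightarrow> (real^'n) set" where
  "half_space k = {x. 0 < x $ k}"

definition shift :: "'n \<Rightarrow> real \<Rightarrow> (real^'n \<Rightarrow> real) \<Rightarrow> real^'n \<Rightarrow> real" where
  "shift k h u = restrict (\<lambda>x. u (x + axis k h)) (closure (half_space k))"

definition const_fun :: "'n \<Rightarrow> real \<Rightarrow> real^'n \<Rightarrow> real" where
  "const_fun k z = restrict (\<lambda>x. z) (closure (half_space k))"

definition global_attractor :: "'n \<Rightarrow> (real^'n \<Rightarrow> real) set \<Rightarrow> (real^'n \<Rightarrow> real) set \<Rightarrow> bool" where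
  "global_attractor k X A \<longleftrightarrow>
     A \<subseteq> X \<and>
     (\<forall>\<beta>\<in>{0..<1}. compactin (C2h_loc_topology (closure (half_space k)) \<beta>) A) \<and>
     (\<forall>h\<ge>0. shift k h ` A = A) \<and>
     (\<forall>B \<beta> V. B \<subseteq> X \<and> \<beta> \<in> {0..<1} \<and>
        (\<exists>U. openin (C2h_loc_topology (closure (half_space k)) \<beta>) U \<and> A \<subseteq> U \<and> U \<subseteq> V) \<longrightarrow>
        (\<exists>h0>0. \<forall>h\<ge>h0. shift k h ` B \<subseteq> V))"

end

(* The attractor is found by a Liouville theorem: a local uniform limit U of solutions on growing
   balls is a constant zero of f. If m is the infimum or supremum of U, the maximum principle gives
   the sign of f m, hence f m = 0 and, unless U is the constant mu, either m = 0 is the infimum or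
   m > mu is the supremum. Where U is close to m a quantitative strong maximum principle makes it
   close to m on a large ball, and there conditions (iii), (iv) make |U - m| a positive
   supersolution of Laplace w + c w = 0, which is impossible on a ball of large radius.
   By compactness the translates T_h u are uniformly close to zeros of f on compact sets as h grows.
   Interior estimates, proved by comparison with barriers for first and mixed second differences,
   turn this into closeness in C^(2,beta). The limit along one trajectory is unique because the set
   of limit values is connected and f vanishes on no interval. *)

theory Submission
  imports Defs "HOL-Complex_Analysis.Great_Picard"
begin

section \<open>Second derivatives along lines\<close>

text \<open>The compactness argument yields only uniform closeness to a zero \<open>z\<close> of
  \<open>f\<close> on balls, while attraction is measured with second derivatives up to the boundary
  of the half-space. Two observations bridge the gap. A translate by \<open>h > 12\<close> sees the
  closed half-space at distance more than 12 from the original boundary, so that boundary regularity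
  of \<open>u\<close> never matters and interior estimates suffice; 12 is an allowance of radius, a
  little of which is spent by each successive comparison. Moreover, \<open>f z = 0\<close> and the
  Lipschitz bound give |Laplace (u - z)| \<le> L |u - z|, so the estimates are linear in the sup of
  |u - z| and uniform smallness becomes smallness in every Hoelder class. Only local maxima of
  functions of one variable are ever analysed: a barrier in auxiliary step variables is compared
  with a difference of values, and at an interior maximum the second derivatives along all
  coordinate lines and in the steps are nonpositive. Since all limits are constants, compactness of
  the attractor reduces to compactness of a set of real numbers.\<close>

definition second_deriv :: "(real \<Rightarrow> real) \<Rightarrow> real \<Rightarrow> bool" where
  "second_deriv p d \<longleftrightarrow>
     (\<exists>q. (\<forall>\<^sub>F s in nhds 0. (p has_real_derivative q s) (at s)) \<and> (q has_real_derivative d) (at 0))"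

lemma second_derivI:
  assumes "\<forall>\<^sub>F s in nhds 0. (p has_real_derivative q s) (at s)" "(q has_real_derivative d) (at 0)"
  shows "second_deriv p d"
  using assms unfolding second_deriv_def by blast

lemma second_deriv_add:
  assumes "second_deriv p d" "second_deriv p' d'"
  shows "second_deriv (\<lambda>s. p s + p' s) (d + d')"
proof -
  obtain q where q: "\<forall>\<^sub>F s in nhds 0. (p has_real_derivative q s) (at s)" "(q has_real_derivative d) (at 0)"
    using assms(1) unfolding second_deriv_def by blast
  obtain q' where q': "\<forall>\<^sub>F s in nhds 0. (p' has_real_derivative q' s) (at s)" "(q' has_real_derivative d') (at 0)"
    using assms(2) unfolding second_deriv_def by blast
  show ?thesis
  proof (rule second_derivI)
    show "\<forall>\<^sub>F s in nhds 0. ((\<lambda>s. p s + p' s) has_real_derivative q s + q' s) (at s)"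
      using q(1) q'(1) by eventually_elim (rule DERIV_add)
  qed (rule DERIV_add[OF q(2) q'(2)])
qed

lemma second_deriv_cmult:
  assumes "second_deriv p d"
  shows "second_deriv (\<lambda>s. c * p s) (c * d)"
proof -
  obtain q where q: "\<forall>\<^sub>F s in nhds 0. (p has_real_derivative q s) (at s)" "(q has_real_derivative d) (at 0)"
    using assms(1) unfolding second_deriv_def by blast
  show ?thesis
  proof (rule second_derivI)
    show "\<forall>\<^sub>F s in nhds 0. ((\<lambda>s. c * p s) has_real_derivative c * q s) (at s)"
      using q(1) by eventually_elim (rule DERIV_cmult)
  qed (rule DERIV_cmult[OF q(2)])
qed

lemma second_deriv_minus: "second_deriv p d \<Longrightarrow> second_deriv (\<lambda>s. - p s) (- d)"
  using second_deriv_cmult[of p d "-1"] by simp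

lemma second_deriv_diff:
  "second_deriv p d \<Longrightarrow> second_deriv p' d' \<Longrightarrow> second_deriv (\<lambda>s. p s - p' s) (d - d')"
  using second_deriv_add[OF _ second_deriv_minus, of p d p' d'] by simp

lemma second_deriv_const: "second_deriv (\<lambda>s. c) 0"
  by (rule second_derivI[where q="\<lambda>_. 0"]) auto

lemma second_deriv_reflect:
  assumes "second_deriv p d"
  shows "second_deriv (\<lambda>s. p (- s)) d"
proof -
  obtain q where q: "\<forall>\<^sub>F s in nhds 0. (p has_real_derivative q s) (at s)" "(q has_real_derivative d) (at 0)"
    using assms(1) unfolding second_deriv_def by blast
  have "filterlim uminus (nhds 0) (nhds (0::real))"
    using tendsto_minus[OF filterlim_ident, of "0::real"] by simp
  then have "\<forall>\<^sub>F s in nhds 0. (p has_real_derivative q (- s)) (at (- s))"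
    using q(1) filterlim_iff by fast
  show ?thesis
  proof (rule second_derivI)
    show "\<forall>\<^sub>F s in nhds 0. ((\<lambda>s. p (- s)) has_real_derivative - q (- s)) (at s)"
      using \<open>\<forall>\<^sub>F s in nhds 0. (p has_real_derivative q (- s)) (at (- s))\<close>
    proof eventually_elim
      case (elim s)
      have "((\<lambda>s. p (- s)) has_real_derivative q (- s) * -1) (at s)"
        by (rule DERIV_chain2[of p _ uminus, OF elim]) (auto intro!: derivative_eq_intros)
      then show ?case by simp
    qed
    have "((\<lambda>s. q (- s)) has_real_derivative d * -1) (at 0)"
      by (rule DERIV_chain2[of q _ uminus]) (use q(2) in \<open>auto intro!: derivative_eq_intros\<close>)
    then show "((\<lambda>s. - q (- s)) has_real_derivative d) (at 0)"
      by (auto intro!: derivative_eq_intros)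
  qed
qed

text \<open>The first derivative vanishes at 0; if \<open>d > 0\<close> it is positive immediately
  to the right, so \<open>p\<close> increases strictly there and exceeds \<open>p 0\<close>.\<close>

lemma second_deriv_local_max:
  assumes "second_deriv p d" and max: "\<forall>\<^sub>F s in nhds 0. p s \<le> p 0"
  shows "d \<le> 0"
proof (rule ccontr)
  assume "\<not> d \<le> 0"
  obtain q where q: "\<forall>\<^sub>F s in nhds 0. (p has_real_derivative q s) (at s)" "(q has_real_derivative d) (at 0)"
    using assms(1) unfolding second_deriv_def by blast
  have "\<forall>\<^sub>F s in nhds 0. p s \<le> p 0 \<and> (p has_real_derivative q s) (at s)"
    using max q(1) by (rule eventually_conj)
  then obtain r where r: "r > 0" "\<And>s. \<bar>s\<bar> < r \<Longrightarrow> p s \<le> p 0 \<and> (p has_real_derivative q s) (at s)"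
    unfolding eventually_nhds_metric by (auto simp: dist_real_def)
  have "q 0 = 0"
    by (rule DERIV_local_max[of p _ 0 r]) (use r in auto)
  obtain r' where r': "r' > 0" "\<And>s. 0 < s \<Longrightarrow> s < r' \<Longrightarrow> 0 < q s"
    using DERIV_pos_inc_right[OF q(2)] \<open>\<not> d \<le> 0\<close> \<open>q 0 = 0\<close> by auto
  define b where "b = min r r' / 2"
  have b: "0 < b" "b < r" "b < r'" using r(1) r'(1) by (auto simp: b_def)
  have "p 0 < p b"
  proof (rule DERIV_pos_imp_increasing_open[OF b(1)])
    show "continuous_on {0..b} p"
      by (rule DERIV_continuous_on[of _ p q], rule has_field_derivative_at_within) (use r(2) b in auto)
  qed (use r(2) r'(2) b in fastforce)
  with r(2)[of b] b show False by auto
qed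

abbreviation line :: "real^'n \<Rightarrow> 'n \<Rightarrow> real \<Rightarrow> real^'n" where
  "line y l s \<equiv> y + s *\<^sub>R axis l 1"

lemma norm_line_sq:
  "(norm (line y l s - x))\<^sup>2 = (norm (y - x))\<^sup>2 + 2 * s * ((y - x) $ l) + s\<^sup>2"
proof -
  have "(norm ((y - x) + s *\<^sub>R axis l 1))\<^sup>2
      = (norm (y - x))\<^sup>2 + 2 * s * ((y - x) $ l) + s\<^sup>2"
    unfolding power2_norm_eq_inner inner_add_left inner_add_right inner_scaleR_left inner_scaleR_right
    by (simp add: inner_axis inner_axis' power2_eq_square algebra_simps)
  then show ?thesis by (simp add: algebra_simps)
qed

lemma second_deriv_norm_sq: "second_deriv (\<lambda>s. (norm (line y l s - x))\<^sup>2) 2"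
  unfolding norm_line_sq
  by (rule second_derivI[where q="\<lambda>s. 2 * ((y - x) $ l) + 2 * s"])
     (auto intro!: derivative_eq_intros always_eventually)

text \<open>The numbers \<open>H l x\<close> are the unmixed second derivatives at \<open>x\<close>. Working along coordinate
  lines avoids all regularity bookkeeping for difference quotients and reflections.\<close>

definition line2 :: "(real^'n \<Rightarrow> real) \<Rightarrow> ('n \<Rightarrow> real^'n \<Rightarrow> real) \<Rightarrow> real^'n \<Rightarrow> bool" where
  "line2 w H x \<longleftrightarrow> (\<forall>l. second_deriv (\<lambda>s. w (line x l s)) (H l x))"

lemma line2D: "line2 w H x \<Longrightarrow> second_deriv (\<lambda>s. w (line x l s)) (H l x)"
  by (simp add: line2_def)

lemma line2_minus: "line2 w H x \<Longrightarrow> line2 (\<lambda>y. - w y) (\<lambda>l y. - H l y) x"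
  unfolding line2_def using second_deriv_minus by fast

lemma eventually_line_in_open:
  assumes "open S" "y \<in> S"
  shows "\<forall>\<^sub>F s in nhds 0. line y l s \<in> S"
proof -
  have "((\<lambda>s. line y l s) \<longlongrightarrow> line y l 0) (nhds 0)"
    by (intro tendsto_intros filterlim_ident)
  then show ?thesis using assms unfolding tendsto_def by simp
qed

lemma dist_line [simp]: "dist y (line y l s) = \<bar>s\<bar>"
  by (simp add: dist_norm)

lemma line_in_cball: "dist x y \<le> r \<Longrightarrow> r + \<bar>s\<bar> \<le> r' \<Longrightarrow> line y l s \<in> cball x r'"
  using dist_triangle[of x "line y l s" y] by simp

section \<open>Interior estimates by comparison\<close>

text \<open>The function \<open>\<Phi>(y, s) = w(y + s e\<^sub>i) - w(y - s e\<^sub>i)\<close> is compared with a barrier for the operator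
  obtained from the Laplacian in \<open>y\<close> by replacing \<open>\<partial>\<^sub>i\<^sup>2\<close> with \<open>\<partial>\<^sub>s\<^sup>2\<close>, which does not change its value
  on \<open>\<Phi>\<close>.\<close>

lemma central_difference_upper:
  fixes w :: "real^'n \<Rightarrow> real" and H :: "'n \<Rightarrow> real^'n \<Rightarrow> real" and W G s :: real
  assumes W: "W > 0" and cont: "continuous_on (cball x 2) w"
    and H: "\<And>y. y \<in> cball x 2 \<Longrightarrow> line2 w H y"
    and bd: "\<And>y. y \<in> cball x 2 \<Longrightarrow> \<bar>w y\<bar> \<le> W"
    and lap: "\<And>y. y \<in> cball x 2 \<Longrightarrow> \<bar>\<Sum>l\<in>UNIV. H l y\<bar> \<le> G"
    and s: "0 < s" "s \<le> 1"
  shows "w (line x i s) - w (line x i (- s)) \<le> ((2 * CARD('n) + 3) * W + G) * s"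
proof -
  define N where "N = real CARD('n)"
  have N: "N \<ge> 1" unfolding N_def by (simp add: Suc_leI)
  have G: "G \<ge> 0" using lap[of x] by (auto intro: order_trans[OF abs_ge_zero])
  \<comment> \<open>At an interior positive maximum of \<open>P\<close> the second derivatives of
    \<Phi> add up to at most \<open>- 2 * D + 4 * N * W = - 2 * W - 2 * G\<close>, whereas two
    Laplacians bounded by \<open>G\<close> allow no less than \<open>- 2 * G\<close>. The excess
    \<open>2 * W\<close> of \<open>C\<close> over \<open>D\<close> makes the barrier reach
    \<open>2 * W\<close>, the trivial bound of \<Phi>, on the face \<open>s = 1\<close>.\<close>
  define D where "D = (2 * N + 1) * W + G"
  define C where "C = 2 * W + D"
  have D: "D \<ge> 0" using N W G by (simp add: D_def)
  define \<Phi> where "\<Phi> = (\<lambda>y s. w (line y i s) - w (line y i (- s)))"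
  define \<Psi> where "\<Psi> = (\<lambda>y s. 2 * W * (norm (y - x))\<^sup>2 + C * s - D * s\<^sup>2)"
  define K where "K = cball x 1 \<times> {0..1::real}"
  define P where "P = (\<lambda>z. \<Phi> (fst z) (snd z) - \<Psi> (fst z) (snd z))"
  have in2: "line y i \<sigma> \<in> cball x 2" if "y \<in> cball x 1" "\<bar>\<sigma>\<bar> \<le> 1" for y \<sigma>
    by (rule line_in_cball[of _ _ 1]) (use that in auto)
  have "continuous_on K P"
    unfolding P_def \<Phi>_def \<Psi>_def K_def
    by (intro continuous_intros continuous_on_compose2[OF cont])
       (auto simp del: mem_cball scaleR_minus_left intro!: in2)
  moreover have "compact K" "K \<noteq> {}" unfolding K_def by (auto simp: compact_Times)
  ultimately obtain z where z: "z \<in> K" "\<And>z'. z' \<in> K \<Longrightarrow> P z' \<le> P z"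
    using continuous_attains_sup[of K P] by meson
  obtain y t where yt: "z = (y, t)" by force
  with z(1) have y: "y \<in> cball x 1" and t: "0 \<le> t" "t \<le> 1" by (auto simp: K_def)
  have lin: "C * t - D * t\<^sup>2 = t * (C - D * t)" by (simp add: algebra_simps power2_eq_square)
  have Dt: "D * t \<le> D" using D t by (simp add: mult_left_le)
  have pos: "0 \<le> t * (C - D * t)" using Dt t W by (intro mult_nonneg_nonneg) (auto simp: C_def)
  have \<Phi>bd: "\<Phi> y t \<le> 2 * W"
    unfolding \<Phi>_def using bd[OF in2[OF y, of t]] bd[OF in2[OF y, of "-t"]] t by auto
  have "P z \<le> 0"
  proof (rule ccontr)
    assume "\<not> P z \<le> 0"
    then have gt: "\<Phi> y t > \<Psi> y t" by (simp add: P_def yt)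
    have t0: "t \<noteq> 0"
    proof
      assume "t = 0"
      then have "\<Psi> y t \<ge> 0" "\<Phi> y t = 0" using W by (auto simp: \<Phi>_def \<Psi>_def)
      with gt show False by simp
    qed
    have t1: "t \<noteq> 1"
    proof
      assume "t = 1"
      then have "\<Psi> y t \<ge> 2 * W" using W by (simp add: \<Psi>_def C_def)
      with gt \<Phi>bd show False by simp
    qed
    have y1: "y \<in> ball x 1"
    proof (rule ccontr)
      assume "y \<notin> ball x 1"
      with y have "norm (y - x) = 1" by (simp add: dist_norm norm_minus_commute)
      then have "\<Psi> y t \<ge> 2 * W" using pos lin by (simp add: \<Psi>_def)
      with gt \<Phi>bd show False by simp
    qed
    have tt: "t \<in> {0<..<1}" using t t0 t1 by auto
    have H1: "line2 w H (line y i t)" "line2 w H (line y i (-t))"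
      by (rule H[OF in2[OF y]]; use t in simp)+
    let ?a = "\<lambda>l. H l (line y i t) - H l (line y i (-t))"
    have a: "?a l \<le> 4 * W" for l
    proof -
      have "second_deriv (\<lambda>\<sigma>. w (line (line y i t) l \<sigma>) - w (line (line y i (-t)) l \<sigma>)
          - (2 * W * (norm (line y l \<sigma> - x))\<^sup>2 + (C * t - D * t\<^sup>2))) (?a l - (2 * W * 2 + 0))"
        by (intro second_deriv_diff second_deriv_add second_deriv_cmult second_deriv_const
            second_deriv_norm_sq line2D H1)
      also have "(\<lambda>\<sigma>. w (line (line y i t) l \<sigma>) - w (line (line y i (-t)) l \<sigma>)
          - (2 * W * (norm (line y l \<sigma> - x))\<^sup>2 + (C * t - D * t\<^sup>2))) = (\<lambda>\<sigma>. P (line y l \<sigma>, t))"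
        by (simp add: P_def \<Phi>_def \<Psi>_def algebra_simps)
      finally have "second_deriv (\<lambda>\<sigma>. P (line y l \<sigma>, t)) (?a l - 4 * W)" by simp
      moreover have "\<forall>\<^sub>F \<sigma> in nhds 0. P (line y l \<sigma>, t) \<le> P (line y l 0, t)"
        using eventually_line_in_open[OF open_ball y1, of l]
        by eventually_elim (use z(2) yt tt in \<open>auto simp: K_def\<close>)
      ultimately have "?a l - 4 * W \<le> 0" by (rule second_deriv_local_max)
      then show ?thesis by simp
    qed
    \<comment> \<open>The step is varied instead of the point. Reflection does not change a second
      derivative, so \<Phi> contributes the same number \<open>?a i\<close> as for the direction
      \<open>i\<close>, but the barrier now contributes \<open>- 2 * D\<close> instead of
      \<open>4 * W\<close>.\<close>
    have ai: "?a i \<le> - 2 * D"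
    proof -
      have poly: "second_deriv (\<lambda>\<sigma>. 2 * W * (norm (y - x))\<^sup>2 + C * (t + \<sigma>) - D * (t + \<sigma>)\<^sup>2) (- 2 * D)"
        by (rule second_derivI[where q="\<lambda>\<sigma>. C - 2 * D * (t + \<sigma>)"])
           (auto intro!: derivative_eq_intros always_eventually)
      have "second_deriv (\<lambda>\<sigma>. w (line (line y i t) i \<sigma>) - w (line (line y i (-t)) i (- \<sigma>))
          - (2 * W * (norm (y - x))\<^sup>2 + C * (t + \<sigma>) - D * (t + \<sigma>)\<^sup>2)) (?a i - (- 2 * D))"
        by (intro second_deriv_diff poly second_deriv_reflect[of "\<lambda>\<sigma>. w (line _ i \<sigma>)"] line2D H1)
      also have "(\<lambda>\<sigma>. w (line (line y i t) i \<sigma>) - w (line (line y i (-t)) i (- \<sigma>))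
          - (2 * W * (norm (y - x))\<^sup>2 + C * (t + \<sigma>) - D * (t + \<sigma>)\<^sup>2)) = (\<lambda>\<sigma>. P (y, t + \<sigma>))"
        by (simp add: P_def \<Phi>_def \<Psi>_def algebra_simps)
      finally have "second_deriv (\<lambda>\<sigma>. P (y, t + \<sigma>)) (?a i + 2 * D)" by simp
      moreover have "\<forall>\<^sub>F \<sigma> in nhds 0. P (y, t + \<sigma>) \<le> P (y, t + 0)"
      proof -
        have "\<forall>\<^sub>F \<sigma> in nhds 0. t + \<sigma> \<in> {0<..<1}"
          using tt tendsto_add[OF tendsto_const[of t] filterlim_ident, of 0]
          unfolding tendsto_def by (metis add.right_neutral open_greaterThanLessThan)
        then show ?thesis
          by eventually_elim (use z(2) yt y in \<open>auto simp: K_def\<close>)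
      qed
      ultimately have "?a i + 2 * D \<le> 0" by (rule second_deriv_local_max)
      then show ?thesis by simp
    qed
    have "(\<Sum>l\<in>UNIV. ?a l) = ?a i + (\<Sum>l\<in>UNIV - {i}. ?a l)"
      by (rule sum.remove) auto
    also have "(\<Sum>l\<in>UNIV - {i}. ?a l) \<le> of_nat (card (UNIV - {i})) * (4 * W)"
      by (rule sum_bounded_above) (rule a)
    also have "\<dots> \<le> N * (4 * W)"
      by (rule mult_right_mono) (use W in \<open>auto simp: N_def intro!: card_mono\<close>)
    finally have "(\<Sum>l\<in>UNIV. ?a l) \<le> - 2 * D + N * (4 * W)" using ai by linarith
    moreover have "(\<Sum>l\<in>UNIV. ?a l) \<ge> - 2 * G"
      unfolding sum_subtractf using lap[OF in2[OF y, of t]] lap[OF in2[OF y, of "-t"]] t by auto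
    ultimately show False using W by (simp add: D_def algebra_simps)
  qed
  moreover have "(x, s) \<in> K" using s by (auto simp: K_def)
  ultimately have "P (x, s) \<le> 0" using z(2) by fastforce
  then have "\<Phi> x s \<le> C * s - D * s\<^sup>2" by (simp add: P_def \<Psi>_def)
  also have "\<dots> \<le> C * s" using D by simp
  finally show ?thesis by (simp add: \<Phi>_def C_def D_def N_def algebra_simps)
qed

lemma central_difference_bound:
  fixes w :: "real^'n \<Rightarrow> real" and H :: "'n \<Rightarrow> real^'n \<Rightarrow> real" and W G s :: real
  assumes W: "W > 0" and cont: "continuous_on (cball x 2) w"
    and H: "\<And>y. y \<in> cball x 2 \<Longrightarrow> line2 w H y"
    and bd: "\<And>y. y \<in> cball x 2 \<Longrightarrow> \<bar>w y\<bar> \<le> W"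
    and lap: "\<And>y. y \<in> cball x 2 \<Longrightarrow> \<bar>\<Sum>l\<in>UNIV. H l y\<bar> \<le> G"
    and s: "0 < s" "s \<le> 1"
  shows "\<bar>w (line x i s) - w (line x i (- s))\<bar> \<le> ((2 * CARD('n) + 3) * W + G) * s"
proof -
  have "w (line x i s) - w (line x i (- s)) \<le> ((2 * CARD('n) + 3) * W + G) * s"
    by (rule central_difference_upper[where H=H]) (use assms in auto)
  moreover have "- w (line x i s) - - w (line x i (- s)) \<le> ((2 * CARD('n) + 3) * W + G) * s"
    by (rule central_difference_upper[where H="\<lambda>l y. - H l y" and w="\<lambda>y. - w y"])
       (use assms in \<open>auto intro!: continuous_intros line2_minus simp: sum_negf\<close>)
  ultimately show ?thesis by linarith
qed

lemma second_deriv_powr: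
  assumes "0 < s"
  shows "second_deriv (\<lambda>\<sigma>. (s + \<sigma>) powr a) (a * (a - 1) * s powr (a - 2))"
proof (rule second_derivI)
  have "\<forall>\<^sub>F \<sigma> in nhds 0. s + \<sigma> \<in> {0<..}"
    using assms tendsto_add[OF tendsto_const[of s] filterlim_ident, of 0]
    unfolding tendsto_def by (metis add.right_neutral open_greaterThan greaterThan_iff)
  then show "\<forall>\<^sub>F \<sigma> in nhds 0. ((\<lambda>\<sigma>. (s + \<sigma>) powr a) has_real_derivative a * (s + \<sigma>) powr (a - 1)) (at \<sigma>)"
    by eventually_elim (auto intro!: derivative_eq_intros)
  have "((\<lambda>\<sigma>. a * (s + \<sigma>) powr (a - 1)) has_real_derivative a * ((a - 1) * (s + 0) powr (a - 1 - 1))) (at 0)"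
    using assms by (auto intro!: derivative_eq_intros)
  then show "((\<lambda>\<sigma>. a * (s + \<sigma>) powr (a - 1)) has_real_derivative a * (a - 1) * s powr (a - 2)) (at 0)"
    by (simp add: mult.assoc)
qed

text \<open>The second derivative of \<open>s powr a * t powr a\<close> in the smaller variable
  carries this factor, of total degree \<open>2 * a - 2 < 0\<close>. It therefore stays at least 1
  on the unit square, which gives the barrier a uniform amount of concavity.\<close>

lemma powr_barrier_ge_one:
  fixes s t a :: real
  assumes "0 < s" "s \<le> t" "t \<le> 1" "a < 1"
  shows "1 \<le> s powr (a - 2) * t powr a"
proof -
  have "1 = t powr 0" using assms by simp
  also have "\<dots> \<le> t powr (a - 2 + a)" by (rule powr_mono') (use assms in auto)
  also have "\<dots> = t powr (a - 2) * t powr a" by (rule powr_add)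
  also have "\<dots> \<le> s powr (a - 2) * t powr a"
    by (intro mult_right_mono powr_mono2') (use assms in auto)
  finally show ?thesis .
qed

text \<open>Here half of \<open>\<partial>\<^sub>i\<^sup>2\<close> is replaced with \<open>\<partial>\<^sub>s\<^sup>2\<close> and half of \<open>\<partial>\<^sub>j\<^sup>2\<close> with \<open>\<partial>\<^sub>t\<^sup>2\<close>, which covers \<open>i = j\<close>
  as well. The barrier \<open>(s t)\<^sup>a\<close> is a supersolution because \<open>a < 1\<close>.\<close>

lemma mixed_difference_upper:
  fixes w :: "real^'n \<Rightarrow> real" and H :: "'n \<Rightarrow> real^'n \<Rightarrow> real" and W G P a s t :: real
  assumes W: "W > 0" and cont: "continuous_on (cball x 3) w"
    and H: "\<And>y. y \<in> cball x 3 \<Longrightarrow> line2 w H y"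
    and bd: "\<And>y. y \<in> cball x 3 \<Longrightarrow> \<bar>w y\<bar> \<le> W"
    and lap: "\<And>y. y \<in> cball x 3 \<Longrightarrow> \<bar>\<Sum>l\<in>UNIV. H l y\<bar> \<le> G"
    and lip: "\<And>y l s. y \<in> cball x 2 \<Longrightarrow> 0 < s \<Longrightarrow> s \<le> 1 \<Longrightarrow>
                \<bar>w (line y l s) - w (line y l (- s))\<bar> \<le> P * s"
    and a: "0 < a" "a < 1" and s: "0 < s" "s \<le> 1" and t: "0 < t" "t \<le> 1"
  shows "w (line (line x i s) j t) - w (line (line x i (-s)) j t) - w (line (line x i s) j (-t))
           + w (line (line x i (-s)) j (-t))
       \<le> (2 * P + 2 * ((8 * CARD('n) + 1) * W + 4 * G) / (a * (1 - a))) * (s powr a * t powr a)"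
proof -
  define N where "N = real CARD('n)"
  have G: "G \<ge> 0" using lap[of x] by (auto intro: order_trans[OF abs_ge_zero])
  have P: "P \<ge> 0" using lip[of x 1 i] order_trans[OF abs_ge_zero] by fastforce
  \<comment> \<open>\<open>Q\<close> forces \<open>b i + b j\<close> below
    \<open>- 2 * ((8 * N + 1) * W + 4 * G)\<close>. Half of this plus at most
    \<open>8 * N * W\<close> from the remaining weights is \<open>- W - 4 * G\<close>, less than the
    \<open>- 4 * G\<close> that four Laplacians permit. The summand \<open>2 * P\<close> of
    \<open>C\<close> handles the faces \<open>s = 1\<close> and \<open>t = 1\<close>, where the
    Lipschitz bound is applied twice.\<close>
  define Q where "Q = 2 * ((8 * N + 1) * W + 4 * G) / (a * (1 - a))"
  define C where "C = 2 * P + Q"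
  have N: "N \<ge> 0" by (simp add: N_def)
  have Q: "Q \<ge> 0" using W G a N by (auto simp: Q_def)
  have C: "C \<ge> 2 * P" "C \<ge> Q" "C \<ge> 0" using P Q by (auto simp: C_def)
  define m where "m = (\<lambda>y \<sigma> \<tau>. line (line y i \<sigma>) j \<tau>)"
  define \<Phi> where "\<Phi> = (\<lambda>y s t. w (m y s t) - w (m y (-s) t) - w (m y s (-t)) + w (m y (-s) (-t)))"
  define \<Psi> where "\<Psi> = (\<lambda>y s t. 4 * W * (norm (y - x))\<^sup>2 + C * (s powr a * t powr a))"
  define K where "K = cball x 1 \<times> {0..1::real} \<times> {0..1::real}"
  define D where "D = (\<lambda>z. \<Phi> (fst z) (fst (snd z)) (snd (snd z)) - \<Psi> (fst z) (fst (snd z)) (snd (snd z)))"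
  have in2: "line y l \<sigma> \<in> cball x 2" if "y \<in> cball x 1" "\<bar>\<sigma>\<bar> \<le> 1" for y l \<sigma>
    by (rule line_in_cball[of _ _ 1]) (use that in auto)
  have in3: "m y \<sigma> \<tau> \<in> cball x 3" if "y \<in> cball x 1" "\<bar>\<sigma>\<bar> \<le> 1" "\<bar>\<tau>\<bar> \<le> 1" for y \<sigma> \<tau>
    unfolding m_def by (rule line_in_cball[of _ _ 2]) (use that in2[of y \<sigma>] in auto)
  have mcomm: "m y \<sigma> \<tau> = line (line y j \<tau>) i \<sigma>" for y \<sigma> \<tau> by (simp add: m_def)
  have "continuous_on K (\<lambda>z. w (m (fst z) (c * fst (snd z)) (d * snd (snd z))))"
    if "c \<in> {1, -1}" "d \<in> {1, -1}" for c d
  proof (rule continuous_on_compose2[OF cont])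
    show "continuous_on K (\<lambda>z. m (fst z) (c * fst (snd z)) (d * snd (snd z)))"
      unfolding m_def by (intro continuous_intros)
    show "(\<lambda>z. m (fst z) (c * fst (snd z)) (d * snd (snd z))) ` K \<subseteq> cball x 3"
      using that by (auto simp del: mem_cball scaleR_minus_left simp: K_def intro!: in3)
  qed
  from this[of 1 1] this[of "-1" 1] this[of 1 "-1"] this[of "-1" "-1"]
  have "continuous_on K D"
    unfolding D_def \<Phi>_def \<Psi>_def
    by (intro continuous_intros continuous_on_powr') (use a in \<open>auto simp: K_def\<close>)
  moreover have "compact K" "K \<noteq> {}" unfolding K_def by (auto simp: compact_Times)
  ultimately obtain z where z: "z \<in> K" "\<And>z'. z' \<in> K \<Longrightarrow> D z' \<le> D z"
    using continuous_attains_sup[of K D] by meson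
  obtain y \<sigma> \<tau> where yt: "z = (y, \<sigma>, \<tau>)" by (metis prod_cases3)
  with z(1) have y: "y \<in> cball x 1" and \<sigma>: "0 \<le> \<sigma>" "\<sigma> \<le> 1" and \<tau>: "0 \<le> \<tau>" "\<tau> \<le> 1"
    by (auto simp: K_def)
  have \<Psi>1: "\<Psi> y \<sigma> \<tau> \<ge> C * (\<sigma> powr a * \<tau> powr a)" using W by (simp add: \<Psi>_def)
  have "D z \<le> 0"
  proof (rule ccontr)
    assume "\<not> D z \<le> 0"
    then have gt: "\<Phi> y \<sigma> \<tau> > \<Psi> y \<sigma> \<tau>" by (simp add: D_def yt)
    have "\<Psi> y \<sigma> \<tau> \<ge> 0" using W C by (auto simp: \<Psi>_def)
    with gt have \<sigma>0: "\<sigma> \<noteq> 0" and \<tau>0: "\<tau> \<noteq> 0" by (auto simp: \<Phi>_def m_def)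
    have ppow: "P * r \<le> P * r powr a" if "0 < r" "r \<le> 1" for r
      using that a P powr_mono'[of a 1 r] by (auto intro!: mult_left_mono)
    have \<sigma>1: "\<sigma> \<noteq> 1"
    proof
      assume "\<sigma> = 1"
      have "\<Phi> y \<sigma> \<tau> \<le> P * \<tau> + P * \<tau>"
        unfolding \<Phi>_def m_def
        using lip[OF in2[OF y, of \<sigma> i], of \<tau> j] lip[OF in2[OF y, of "-\<sigma>" i], of \<tau> j] \<sigma> \<tau> \<tau>0
        by auto
      also have "\<dots> \<le> 2 * P * \<tau> powr a" using ppow[of \<tau>] \<tau> \<tau>0 by simp
      also have "\<dots> \<le> \<Psi> y \<sigma> \<tau>"
        using \<Psi>1 C mult_right_mono[OF C(1), of "\<tau> powr a"] by (simp add: \<open>\<sigma> = 1\<close>)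
      finally show False using gt by simp
    qed
    have \<tau>1: "\<tau> \<noteq> 1"
    proof
      assume "\<tau> = 1"
      have "\<Phi> y \<sigma> \<tau> \<le> P * \<sigma> + P * \<sigma>"
        unfolding \<Phi>_def mcomm
        using lip[OF in2[OF y, of \<tau> j], of \<sigma> i] lip[OF in2[OF y, of "-\<tau>" j], of \<sigma> i] \<tau> \<sigma> \<sigma>0
        by auto
      also have "\<dots> \<le> 2 * P * \<sigma> powr a" using ppow[of \<sigma>] \<sigma> \<sigma>0 by simp
      also have "\<dots> \<le> \<Psi> y \<sigma> \<tau>"
        using \<Psi>1 C mult_right_mono[OF C(1), of "\<sigma> powr a"] by (simp add: \<open>\<tau> = 1\<close>)
      finally show False using gt by simp
    qed
    have y1: "y \<in> ball x 1"
    proof (rule ccontr)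
      assume "y \<notin> ball x 1"
      with y have "norm (y - x) = 1" by (simp add: dist_norm norm_minus_commute)
      then have "\<Psi> y \<sigma> \<tau> \<ge> 4 * W" using C by (simp add: \<Psi>_def)
      moreover have "\<Phi> y \<sigma> \<tau> \<le> 4 * W"
        unfolding \<Phi>_def
        using bd[OF in3[OF y, of \<sigma> \<tau>]] bd[OF in3[OF y, of "-\<sigma>" \<tau>]]
          bd[OF in3[OF y, of \<sigma> "-\<tau>"]] bd[OF in3[OF y, of "-\<sigma>" "-\<tau>"]] \<sigma> \<tau> by simp
      ultimately show False using gt by simp
    qed
    have \<sigma>\<sigma>: "\<sigma> \<in> {0<..<1}" and \<tau>\<tau>: "\<tau> \<in> {0<..<1}" using \<sigma> \<tau> \<sigma>0 \<sigma>1 \<tau>0 \<tau>1 by auto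
    have H1: "line2 w H (m y \<sigma> \<tau>)" "line2 w H (m y (-\<sigma>) \<tau>)"
      "line2 w H (m y \<sigma> (-\<tau>))" "line2 w H (m y (-\<sigma>) (-\<tau>))"
      by (rule H[OF in3[OF y]]; use \<sigma> \<tau> in simp)+
    define b where "b = (\<lambda>l. H l (m y \<sigma> \<tau>) - H l (m y (-\<sigma>) \<tau>) - H l (m y \<sigma> (-\<tau>))
      + H l (m y (-\<sigma>) (-\<tau>)))"
    have ev: "\<forall>\<^sub>F r in nhds 0. q + r \<in> {0<..<1}" if "q \<in> {0<..<1}" for q :: real
      using that tendsto_add[OF tendsto_const[of q] filterlim_ident, of 0]
      unfolding tendsto_def by (metis add.right_neutral open_greaterThanLessThan)
    have b: "b l \<le> 8 * W" for l
    proof -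
      have "second_deriv (\<lambda>r. w (line (m y \<sigma> \<tau>) l r) - w (line (m y (-\<sigma>) \<tau>) l r)
          - w (line (m y \<sigma> (-\<tau>)) l r) + w (line (m y (-\<sigma>) (-\<tau>)) l r)
          - (4 * W * (norm (line y l r - x))\<^sup>2 + C * (\<sigma> powr a * \<tau> powr a))) (b l - (4 * W * 2 + 0))"
        unfolding b_def
        by (intro second_deriv_diff second_deriv_add second_deriv_cmult second_deriv_const
            second_deriv_norm_sq line2D H1)
      also have "(\<lambda>r. w (line (m y \<sigma> \<tau>) l r) - w (line (m y (-\<sigma>) \<tau>) l r)
          - w (line (m y \<sigma> (-\<tau>)) l r) + w (line (m y (-\<sigma>) (-\<tau>)) l r)
          - (4 * W * (norm (line y l r - x))\<^sup>2 + C * (\<sigma> powr a * \<tau> powr a)))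
          = (\<lambda>r. D (line y l r, \<sigma>, \<tau>))"
        by (simp add: D_def \<Phi>_def \<Psi>_def m_def algebra_simps)
      finally have "second_deriv (\<lambda>r. D (line y l r, \<sigma>, \<tau>)) (b l - 8 * W)" by simp
      moreover have "\<forall>\<^sub>F r in nhds 0. D (line y l r, \<sigma>, \<tau>) \<le> D (line y l 0, \<sigma>, \<tau>)"
        using eventually_line_in_open[OF open_ball y1, of l]
        by eventually_elim (use z(2) yt \<sigma> \<tau> in \<open>auto simp: K_def\<close>)
      ultimately have "b l - 8 * W \<le> 0" by (rule second_deriv_local_max)
      then show ?thesis by simp
    qed
    have bi: "b i \<le> C * (a * (a - 1) * \<sigma> powr (a - 2) * \<tau> powr a)"
    proof -
      have pw: "second_deriv (\<lambda>r. 4 * W * (norm (y - x))\<^sup>2 + C * \<tau> powr a * (\<sigma> + r) powr a)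
          (0 + C * \<tau> powr a * (a * (a - 1) * \<sigma> powr (a - 2)))"
        by (intro second_deriv_add second_deriv_const second_deriv_cmult second_deriv_powr)
           (use \<sigma>\<sigma> in auto)
      have "second_deriv (\<lambda>r. w (line (m y \<sigma> \<tau>) i r) - w (line (m y (-\<sigma>) \<tau>) i (- r))
          - w (line (m y \<sigma> (-\<tau>)) i r) + w (line (m y (-\<sigma>) (-\<tau>)) i (- r))
          - (4 * W * (norm (y - x))\<^sup>2 + C * \<tau> powr a * (\<sigma> + r) powr a))
          (b i - (0 + C * \<tau> powr a * (a * (a - 1) * \<sigma> powr (a - 2))))"
        unfolding b_def
        by (intro second_deriv_diff second_deriv_add pw
            second_deriv_reflect[of "\<lambda>\<sigma>. w (line _ i \<sigma>)"] line2D H1)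
      also have "(\<lambda>r. w (line (m y \<sigma> \<tau>) i r) - w (line (m y (-\<sigma>) \<tau>) i (- r))
          - w (line (m y \<sigma> (-\<tau>)) i r) + w (line (m y (-\<sigma>) (-\<tau>)) i (- r))
          - (4 * W * (norm (y - x))\<^sup>2 + C * \<tau> powr a * (\<sigma> + r) powr a)) = (\<lambda>r. D (y, \<sigma> + r, \<tau>))"
        by (simp add: D_def \<Phi>_def \<Psi>_def m_def algebra_simps)
      finally have "second_deriv (\<lambda>r. D (y, \<sigma> + r, \<tau>)) (b i - C * (a * (a - 1) * \<sigma> powr (a - 2) * \<tau> powr a))"
        by (simp add: algebra_simps)
      moreover have "\<forall>\<^sub>F r in nhds 0. D (y, \<sigma> + r, \<tau>) \<le> D (y, \<sigma> + 0, \<tau>)"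
        using ev[OF \<sigma>\<sigma>] by eventually_elim (use z(2) yt y \<tau> in \<open>auto simp: K_def\<close>)
      ultimately have "b i - C * (a * (a - 1) * \<sigma> powr (a - 2) * \<tau> powr a) \<le> 0"
        by (rule second_deriv_local_max)
      then show ?thesis by simp
    qed
    have bj: "b j \<le> C * (a * (a - 1) * \<tau> powr (a - 2) * \<sigma> powr a)"
    proof -
      have pw: "second_deriv (\<lambda>r. 4 * W * (norm (y - x))\<^sup>2 + C * \<sigma> powr a * (\<tau> + r) powr a)
          (0 + C * \<sigma> powr a * (a * (a - 1) * \<tau> powr (a - 2)))"
        by (intro second_deriv_add second_deriv_const second_deriv_cmult second_deriv_powr)
           (use \<tau>\<tau> in auto)
      have "second_deriv (\<lambda>r. w (line (m y \<sigma> \<tau>) j r) - w (line (m y (-\<sigma>) \<tau>) j r)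
          - w (line (m y \<sigma> (-\<tau>)) j (- r)) + w (line (m y (-\<sigma>) (-\<tau>)) j (- r))
          - (4 * W * (norm (y - x))\<^sup>2 + C * \<sigma> powr a * (\<tau> + r) powr a))
          (b j - (0 + C * \<sigma> powr a * (a * (a - 1) * \<tau> powr (a - 2))))"
        unfolding b_def
        by (intro second_deriv_diff second_deriv_add pw
            second_deriv_reflect[of "\<lambda>\<sigma>. w (line _ j \<sigma>)"] line2D H1)
      also have "(\<lambda>r. w (line (m y \<sigma> \<tau>) j r) - w (line (m y (-\<sigma>) \<tau>) j r)
          - w (line (m y \<sigma> (-\<tau>)) j (- r)) + w (line (m y (-\<sigma>) (-\<tau>)) j (- r))
          - (4 * W * (norm (y - x))\<^sup>2 + C * \<sigma> powr a * (\<tau> + r) powr a)) = (\<lambda>r. D (y, \<sigma>, \<tau> + r))"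
        by (simp add: D_def \<Phi>_def \<Psi>_def m_def algebra_simps)
      finally have "second_deriv (\<lambda>r. D (y, \<sigma>, \<tau> + r)) (b j - C * (a * (a - 1) * \<tau> powr (a - 2) * \<sigma> powr a))"
        by (simp add: algebra_simps)
      moreover have "\<forall>\<^sub>F r in nhds 0. D (y, \<sigma>, \<tau> + r) \<le> D (y, \<sigma>, \<tau> + 0)"
        using ev[OF \<tau>\<tau>] by eventually_elim (use z(2) yt y \<sigma> in \<open>auto simp: K_def\<close>)
      ultimately have "b j - C * (a * (a - 1) * \<tau> powr (a - 2) * \<sigma> powr a) \<le> 0"
        by (rule second_deriv_local_max)
      then show ?thesis by simp
    qed
    define \<gamma> where "\<gamma> = \<sigma> powr (a - 2) * \<tau> powr a + \<tau> powr (a - 2) * \<sigma> powr a"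
    have "\<gamma> \<ge> 1"
    proof (cases "\<sigma> \<le> \<tau>")
      case True
      then show ?thesis
        using powr_barrier_ge_one[of \<sigma> \<tau> a] \<sigma>\<sigma> \<tau>\<tau> a by (auto simp: \<gamma>_def add_increasing2)
    next
      case False
      then show ?thesis
        using powr_barrier_ge_one[of \<tau> \<sigma> a] \<sigma>\<sigma> \<tau>\<tau> a by (auto simp: \<gamma>_def add_increasing)
    qed
    have "b i + b j \<le> - (C * (a * (1 - a)) * \<gamma>)"
      using bi bj by (simp add: \<gamma>_def algebra_simps)
    also have "\<dots> \<le> - (Q * (a * (1 - a)) * 1)"
      unfolding neg_le_iff_le using \<open>\<gamma> \<ge> 1\<close> C Q a by (intro mult_mono mult_right_mono) auto
    also have "\<dots> = - (2 * ((8 * N + 1) * W + 4 * G))"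
      using a by (simp add: Q_def)
    finally have bij: "b i + b j \<le> - (2 * ((8 * N + 1) * W + 4 * G))" .
    \<comment> \<open>The weight is 1/2 at \<open>i\<close> and at \<open>j\<close> if they differ,
      and 1 if they coincide. In both cases \<open>1 - k l\<close> is nonnegative, so the bound
      \<open>b l \<le> 8 * W\<close> may be used on the remainder.\<close>
    define k where "k = (\<lambda>l. (if l = i then 1/2 else 0) + (if l = j then 1/2 else (0::real)))"
    have "(\<Sum>l\<in>UNIV. b l) = (\<Sum>l\<in>UNIV. k l * b l) + (\<Sum>l\<in>UNIV. (1 - k l) * b l)"
      by (simp add: sum.distrib[symmetric] algebra_simps)
    also have "(\<Sum>l\<in>UNIV. k l * b l) = (b i + b j) / 2"
      by (simp add: k_def distrib_right sum.distrib if_distrib[of "\<lambda>c. c * _"] cong: if_cong)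
    also have "(\<Sum>l\<in>UNIV. (1 - k l) * b l) \<le> (\<Sum>l\<in>(UNIV::'n set). 8 * W)"
    proof (rule sum_mono)
      fix l
      have "0 \<le> 1 - k l" "1 - k l \<le> 1" by (auto simp: k_def)
      then have "(1 - k l) * b l \<le> (1 - k l) * (8 * W)" "(1 - k l) * (8 * W) \<le> 1 * (8 * W)"
        using b[of l] W by (auto intro!: mult_left_mono mult_right_mono)
      then show "(1 - k l) * b l \<le> 8 * W" by linarith
    qed
    also have "(\<Sum>l\<in>(UNIV::'n set). 8 * W) = 8 * N * W" by (simp add: N_def)
    finally have "(\<Sum>l\<in>UNIV. b l) \<le> - W - 4 * G"
      using bij by (simp add: algebra_simps add_divide_distrib)
    moreover have "(\<Sum>l\<in>UNIV. b l) \<ge> - 4 * G"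
      unfolding b_def sum_subtractf sum.distrib
      using lap[OF in3[OF y, of \<sigma> \<tau>]] lap[OF in3[OF y, of "-\<sigma>" \<tau>]]
          lap[OF in3[OF y, of \<sigma> "-\<tau>"]] lap[OF in3[OF y, of "-\<sigma>" "-\<tau>"]] \<sigma> \<tau> by simp
    ultimately show False using W by simp
  qed
  moreover have "(x, s, t) \<in> K" using s t by (auto simp: K_def)
  ultimately have "D (x, s, t) \<le> 0" using z(2) by fastforce
  then show ?thesis by (simp add: D_def \<Psi>_def \<Phi>_def m_def C_def Q_def N_def algebra_simps)
qed

lemma mixed_difference_bound:
  fixes w :: "real^'n \<Rightarrow> real" and H :: "'n \<Rightarrow> real^'n \<Rightarrow> real" and W G P a s t :: real
  assumes W: "W > 0" and cont: "continuous_on (cball x 3) w"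
    and H: "\<And>y. y \<in> cball x 3 \<Longrightarrow> line2 w H y"
    and bd: "\<And>y. y \<in> cball x 3 \<Longrightarrow> \<bar>w y\<bar> \<le> W"
    and lap: "\<And>y. y \<in> cball x 3 \<Longrightarrow> \<bar>\<Sum>l\<in>UNIV. H l y\<bar> \<le> G"
    and lip: "\<And>y l s. y \<in> cball x 2 \<Longrightarrow> 0 < s \<Longrightarrow> s \<le> 1 \<Longrightarrow>
                \<bar>w (line y l s) - w (line y l (- s))\<bar> \<le> P * s"
    and a: "0 < a" "a < 1" and s: "0 < s" "s \<le> 1" and t: "0 < t" "t \<le> 1"
  shows "\<bar>w (line (line x i s) j t) - w (line (line x i (-s)) j t) - w (line (line x i s) j (-t))
           + w (line (line x i (-s)) j (-t))\<bar>
       \<le> (2 * P + 2 * ((8 * CARD('n) + 1) * W + 4 * G) / (a * (1 - a))) * (s powr a * t powr a)"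
    (is "\<bar>?\<Phi>\<bar> \<le> ?R")
proof -
  have "?\<Phi> \<le> ?R"
    by (rule mixed_difference_upper[OF W cont H bd lap lip a s t])
  moreover have "- w (line (line x i s) j t) - - w (line (line x i (-s)) j t)
      - - w (line (line x i s) j (-t)) + - w (line (line x i (-s)) j (-t)) \<le> ?R"
  proof (rule mixed_difference_upper[OF W _ line2_minus[OF H] _ _ _ a s t])
    show "continuous_on (cball x 3) (\<lambda>y. - w y)" by (intro continuous_intros cont)
    show "\<bar>- w (line y l s) - - w (line y l (- s))\<bar> \<le> P * s"
      if "y \<in> cball x 2" "0 < s" "s \<le> 1" for y l s
      using lip[OF that, of l] by linarith
  qed (use bd lap in \<open>auto simp: sum_negf\<close>)
  ultimately show ?thesis by linarith
qed

lemma line_add: "line (line y l s) l t = line y l (s + t)"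
  by (simp add: scaleR_add_left)

section \<open>Passage from twice differentiable functions to coordinate lines, and from differences
  to derivatives\<close>

lemma pderiv_line:
  fixes w :: "real^'n \<Rightarrow> real" and x :: "real^'n" and s :: real
  assumes S: "open S" and w: "w differentiable_on S" and x: "line x l s \<in> S"
  shows "((\<lambda>s. w (line x l s)) has_real_derivative pderiv_in S l w (line x l s)) (at s)"
proof -
  let ?D = "frechet_derivative w (at (line x l s) within S)"
  have "w differentiable (at (line x l s) within S)"
    using w x unfolding differentiable_on_def by blast
  then have "(w has_derivative ?D) (at (line x l s) within S)"
    by (simp add: frechet_derivative_works)
  then have D: "(w has_derivative ?D) (at (line x l s))"
    using at_within_open[OF x S] by simp
  have "((\<lambda>s. line x l s) has_derivative (\<lambda>h. h *\<^sub>R axis l 1)) (at s)"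
    by (auto intro!: derivative_eq_intros)
  from has_derivative_compose[OF this D]
  have "((\<lambda>s. w (line x l s)) has_derivative (\<lambda>h. ?D (h *\<^sub>R axis l 1))) (at s)" .
  moreover have "?D (h *\<^sub>R axis l 1) = pderiv_in S l w (line x l s) * h" for h
    using linear_scale[OF has_derivative_linear[OF D], of h "axis l 1"]
    by (simp add: pderiv_in_def mult.commute)
  ultimately show ?thesis by (simp add: has_field_derivative_def)
qed

lemma C2_on_line_pderiv:
  fixes w :: "real^'n \<Rightarrow> real" and S :: "(real^'n) set"
  assumes "open S" "C2_on S w" "x \<in> S"
  shows "((\<lambda>s. w (line x l s)) has_real_derivative pderiv_in S l w x) (at 0)"
    and "((\<lambda>s. pderiv_in S l w (line x j s)) has_real_derivative pderiv2_in S l j w x) (at 0)"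
  using pderiv_line[of S w x 0 l] pderiv_line[of S "pderiv_in S l w" x 0 j] assms
  by (auto simp: C2_on_def pderiv2_in_def)

lemma C2_on_line2:
  fixes w :: "real^'n \<Rightarrow> real" and x :: "real^'n"
  assumes S: "open S" and w: "C2_on S w" and x: "x \<in> S"
  shows "line2 w (\<lambda>l. pderiv2_in S l l w) x"
  unfolding line2_def
proof
  fix l
  show "second_deriv (\<lambda>s. w (line x l s)) (pderiv2_in S l l w x)"
  proof (rule second_derivI)
    show "\<forall>\<^sub>F s in nhds 0. ((\<lambda>s. w (line x l s)) has_real_derivative pderiv_in S l w (line x l s)) (at s)"
      using eventually_line_in_open[OF S x, of l]
      by eventually_elim (rule pderiv_line, use S w in \<open>auto simp: C2_on_def\<close>)
    show "((\<lambda>s. pderiv_in S l w (line x l s)) has_real_derivative pderiv2_in S l l w x) (at 0)"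
      by (rule C2_on_line_pderiv[OF S w x])
  qed
qed

lemma C2_on_continuous: "C2_on S w \<Longrightarrow> continuous_on S w"
  by (simp add: C2_on_def differentiable_imp_continuous_on)

text \<open>Halving the step changes the difference quotient by at most
  \<open>C * t powr \<beta>\<close>. Over the steps \<open>t / 2 ^ n\<close> these changes form a
  geometric series of ratio \<open>2 powr - \<beta>\<close>, and the quotients tend to
  \<open>d\<close>.\<close>

lemma dyadic_difference_quotient:
  fixes p :: "real \<Rightarrow> real"
  assumes d: "(p has_real_derivative d) (at 0)"
    and C: "\<And>t. 0 < t \<Longrightarrow> t \<le> 1 \<Longrightarrow> \<bar>p t - 2 * p (t / 2) + p 0\<bar> \<le> C * t powr (1 + \<beta>)"
    and \<beta>: "\<beta> > 0" and t: "0 < t" "t \<le> 1"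
  shows "\<bar>(p t - p 0) / t - d\<bar> \<le> C / (1 - 2 powr - \<beta>) * t powr \<beta>"
proof -
  define \<theta> :: real where "\<theta> = 2 powr - \<beta>"
  have \<theta>: "0 < \<theta>" "\<theta> < 1" using \<beta> by (auto simp: \<theta>_def powr_less_one)
  define q where "q = (\<lambda>t. (p t - p 0) / t)"
  have step: "\<bar>q t - q (t / 2)\<bar> \<le> C * t powr \<beta>" if t: "0 < t" "t \<le> 1" for t
  proof -
    have "q t - q (t / 2) = (p t - 2 * p (t / 2) + p 0) / t"
      using t by (simp add: q_def field_simps)
    then have "\<bar>q t - q (t / 2)\<bar> \<le> C * t powr (1 + \<beta>) / t"
      using C[OF t] t by (simp add: divide_right_mono)
    also have "\<dots> = C * t powr \<beta>" using t by (simp add: powr_add)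
    finally show ?thesis .
  qed
  have C0: "C \<ge> 0"
    using order_trans[OF abs_ge_zero C[of 1]] by simp
  have tel: "\<bar>q t - q (t / 2 ^ n)\<bar> \<le> C / (1 - \<theta>) * (1 - \<theta> ^ n) * t powr \<beta>"
    if "0 < t" "t \<le> 1" for n t
    using that
  proof (induction n arbitrary: t)
    case (Suc n)
    have "(t / 2) powr \<beta> = \<theta> * t powr \<beta>"
      using Suc.prems by (simp add: \<theta>_def powr_divide powr_minus divide_simps)
    with Suc.IH[of "t / 2"] Suc.prems
    have "\<bar>q (t / 2) - q (t / 2 ^ Suc n)\<bar> \<le> C / (1 - \<theta>) * (1 - \<theta> ^ n) * (\<theta> * t powr \<beta>)"
      by (simp add: field_simps)
    moreover have "C * t powr \<beta> + C / (1 - \<theta>) * (1 - \<theta> ^ n) * (\<theta> * t powr \<beta>)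
        = C / (1 - \<theta>) * (1 - \<theta> ^ Suc n) * t powr \<beta>"
      using \<theta> by (simp add: field_simps)
    ultimately show ?case using step[OF Suc.prems] by linarith
  qed simp
  have "(q \<longlongrightarrow> d) (at 0)"
    using d by (simp add: has_field_derivative_iff q_def)
  moreover have "filterlim (\<lambda>n. t / 2 ^ n) (at 0) sequentially"
    unfolding filterlim_at
  proof
    show "\<forall>\<^sub>F n in sequentially. t / 2 ^ n \<in> UNIV \<and> t / 2 ^ n \<noteq> 0" using t by simp
    have "(\<lambda>n. t * (1 / 2) ^ n) \<longlonglongrightarrow> t * 0" by (intro tendsto_intros LIMSEQ_realpow_zero) auto
    then show "(\<lambda>n. t / 2 ^ n) \<longlonglongrightarrow> 0" by (simp add: power_one_over)
  qed
  ultimately have "(\<lambda>n. q (t / 2 ^ n)) \<longlonglongrightarrow> d" by (rule filterlim_compose)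
  then have lim: "(\<lambda>n. \<bar>q t - q (t / 2 ^ n)\<bar>) \<longlonglongrightarrow> \<bar>q t - d\<bar>" by (intro tendsto_intros)
  have "\<bar>q t - d\<bar> \<le> C / (1 - \<theta>) * t powr \<beta>"
  proof (rule LIMSEQ_le_const2[OF lim], intro exI allI impI)
    fix n :: nat
    have "C / (1 - \<theta>) * (1 - \<theta> ^ n) * t powr \<beta> \<le> C / (1 - \<theta>) * 1 * t powr \<beta>"
      using \<theta> C0 by (intro mult_right_mono mult_left_mono) auto
    with tel[OF t, of n] show "\<bar>q t - q (t / 2 ^ n)\<bar> \<le> C / (1 - \<theta>) * t powr \<beta>" by simp
  qed
  then show ?thesis by (simp add: q_def \<theta>_def)
qed

text \<open>The coordinates of \<open>x\<close> are replaced with those of \<open>z\<close> one at a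
  time. The intermediate points \<open>q B\<close> are componentwise no farther from
  \<open>x\<close> than \<open>z\<close> is, so they stay in the ball and each step has length at
  most \<open>dist x z\<close>.\<close>

lemma coordinate_path_bound:
  fixes F :: "real^'n \<Rightarrow> real" and A \<beta> r :: real
  assumes step: "\<And>y j t. y \<in> cball x r \<Longrightarrow> \<bar>t\<bar> \<le> r \<Longrightarrow> \<bar>F (line y j t) - F y\<bar> \<le> A * \<bar>t\<bar> powr \<beta>"
    and A: "A \<ge> 0" and \<beta>: "\<beta> \<ge> 0" and z: "z \<in> cball x r"
  shows "\<bar>F z - F x\<bar> \<le> CARD('n) * A * dist x z powr \<beta>"
proof -
  define q where "q = (\<lambda>B::'n set. \<chi> l. if l \<in> B then z $ l else x $ l)"
  have "\<bar>F (q B) - F x\<bar> \<le> card B * A * dist x z powr \<beta>" for B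
    using finite[of B]
  proof (induction B rule: finite_induct)
    case empty
    have "q {} = x" by (simp add: q_def)
    then show ?case by simp
  next
    case (insert j B)
    have "q (insert j B) = line (q B) j (z $ j - x $ j)"
      using insert.hyps(2) by (auto simp: q_def vec_eq_iff axis_def)
    moreover have "dist x (q B) \<le> dist x z"
      unfolding dist_norm by (rule norm_le_componentwise_cart) (auto simp: q_def)
    moreover have zx: "\<bar>z $ j - x $ j\<bar> \<le> dist x z"
      using component_le_norm_cart[of "z - x" j] by (simp add: dist_norm norm_minus_commute)
    ultimately have "\<bar>F (q (insert j B)) - F (q B)\<bar> \<le> A * \<bar>z $ j - x $ j\<bar> powr \<beta>"
      using step[of "q B" "z $ j - x $ j" j] z by simp
    also have "\<dots> \<le> A * dist x z powr \<beta>"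
      using A \<beta> zx by (intro mult_left_mono powr_mono2) auto
    finally show ?case using insert by (simp add: algebra_simps)
  qed
  from this[of UNIV] show ?thesis by (simp add: q_def)
qed

text \<open>In applications \<open>v = u - z\<close> for a solution \<open>u\<close> and a zero \<open>z\<close> of \<open>f\<close>, so that all the
  estimates are linear in the sup norm \<open>V\<close> of \<open>v\<close>.\<close>

locale interior_data =
  fixes S :: "(real^'n) set" and v :: "real^'n \<Rightarrow> real" and L V :: real and x0 :: "real^'n"
  assumes open_S: "open S" and sub: "cball x0 12 \<subseteq> S" and C2: "C2_on S v"
    and V: "V > 0" and L: "L \<ge> 0"
    and bd: "\<And>y. y \<in> cball x0 12 \<Longrightarrow> \<bar>v y\<bar> \<le> V"
    and lap_bd: "\<And>y. y \<in> cball x0 12 \<Longrightarrow> \<bar>laplacian_in S v y\<bar> \<le> L * V"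
    and lap_lip: "\<And>y z. y \<in> cball x0 12 \<Longrightarrow> z \<in> cball x0 12 \<Longrightarrow>
                    \<bar>laplacian_in S v y - laplacian_in S v z\<bar> \<le> L * \<bar>v y - v z\<bar>"
begin

text \<open>The factor of \<open>central_difference_bound\<close> for \<open>W = V\<close> and
  \<open>G = L * V\<close>, with \<open>V\<close> taken out.\<close>

definition C\<^sub>1 :: real where "C\<^sub>1 = 2 * CARD('n) + 3 + L"

abbreviation H :: "'n \<Rightarrow> real^'n \<Rightarrow> real" where "H \<equiv> \<lambda>l. pderiv2_in S l l v"

abbreviation g :: "'n \<Rightarrow> real^'n \<Rightarrow> real" where "g \<equiv> \<lambda>l. pderiv_in S l v"

lemma C\<^sub>1_pos: "C\<^sub>1 > 0" using L by (simp add: C\<^sub>1_def add_pos_nonneg)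

lemma near: "y \<in> cball x0 r \<Longrightarrow> z \<in> cball y r' \<Longrightarrow> r + r' \<le> r'' \<Longrightarrow> z \<in> cball x0 r''"
  using dist_triangle[of x0 z y] by simp

lemma near_line: "y \<in> cball x0 r \<Longrightarrow> r + \<bar>s\<bar> \<le> r' \<Longrightarrow> line y l s \<in> cball x0 r'"
  by (rule line_in_cball) auto

lemma line2_v: "y \<in> cball x0 12 \<Longrightarrow> line2 v H y"
  using C2_on_line2[OF open_S C2] sub by blast

lemma cont_v: "continuous_on (cball x0 12) v"
  using C2_on_continuous[OF C2] sub continuous_on_subset by blast

lemma v_central: 
  assumes y: "y \<in> cball x0 10" and s: "0 < s" "s \<le> 1"
  shows "\<bar>v (line y l s) - v (line y l (- s))\<bar> \<le> C\<^sub>1 * V * s"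
proof -
  have n: "z \<in> cball x0 12" if "z \<in> cball y 2" for z by (rule near[OF y that]) simp
  have "\<bar>v (line y l s) - v (line y l (- s))\<bar> \<le> ((2 * CARD('n) + 3) * V + L * V) * s"
  proof (rule central_difference_bound[OF V _ line2_v[OF n] _ _ s])
    show "continuous_on (cball y 2) v" by (rule continuous_on_subset[OF cont_v]) (use n in blast)
  qed (use n bd lap_bd in \<open>auto simp del: mem_cball simp: laplacian_in_def\<close>)
  then show ?thesis by (simp add: C\<^sub>1_def algebra_simps)
qed

text \<open>A one-sided difference of step \<open>s\<close> is the central difference of step
  \<open>s / 2\<close> about the midpoint, which lies in the slightly larger ball.\<close>

lemma v_lipschitz:
  assumes y: "y \<in> cball x0 9" and s: "0 < s" "s \<le> 1"
  shows "\<bar>v (line y l s) - v y\<bar> \<le> C\<^sub>1 * V * s"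
proof -
  have "\<bar>v (line (line y l (s/2)) l (s/2)) - v (line (line y l (s/2)) l (- (s/2)))\<bar> \<le> C\<^sub>1 * V * (s/2)"
    by (rule v_central[OF near_line[OF y]]) (use s in auto)
  also have "C\<^sub>1 * V * (s/2) \<le> C\<^sub>1 * V * s" using C\<^sub>1_pos V s by (intro mult_left_mono) auto
  finally show ?thesis unfolding line_add by simp
qed

text \<open>The quotients satisfy the same kind of bounds as \<open>v\<close>, with
  \<open>C\<^sub>1 * V\<close> in place of \<open>V\<close>: the assumption \<open>lap_lip\<close>
  bounds their Laplacian without differentiating \<open>f\<close>. Hence the comparison can be
  applied a second time, uniformly in \<open>h\<close>.\<close>

definition w :: "'n \<Rightarrow> real \<Rightarrow> real^'n \<Rightarrow> real" where
  "w l h y = (v (line y l h) - v y) / h"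

definition Hw :: "'n \<Rightarrow> real \<Rightarrow> 'n \<Rightarrow> real^'n \<Rightarrow> real" where
  "Hw l h j y = (H j (line y l h) - H j y) / h"

context
  fixes l :: 'n and h :: real
  assumes h: "0 < h" "h \<le> 1"
begin

lemma line2_w:
  assumes y: "y \<in> cball x0 9"
  shows "line2 (w l h) (Hw l h) y"
  unfolding line2_def
proof
  fix j
  have y': "y \<in> cball x0 12" using y by simp
  have *: "line y l h \<in> cball x0 12" by (rule near_line[OF y]) (use h in simp)
  have "second_deriv (\<lambda>s. (1/h) * (v (line (line y l h) j s) - v (line y j s)))
      ((1/h) * (H j (line y l h) - H j y))"
    by (intro second_deriv_cmult second_deriv_diff line2D line2_v y' *)
  then show "second_deriv (\<lambda>s. w l h (line y j s)) (Hw l h j y)"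
    by (simp add: w_def Hw_def add_ac)
qed

lemma w_bd: "y \<in> cball x0 9 \<Longrightarrow> \<bar>w l h y\<bar> \<le> C\<^sub>1 * V"
  using v_lipschitz[of y h l] h by (simp add: w_def pos_divide_le_eq)

lemma w_lap:
  assumes y: "y \<in> cball x0 9"
  shows "\<bar>\<Sum>j\<in>UNIV. Hw l h j y\<bar> \<le> L * (C\<^sub>1 * V)"
proof -
  have "(\<Sum>j\<in>UNIV. Hw l h j y) = (laplacian_in S v (line y l h) - laplacian_in S v y) / h"
    by (simp add: Hw_def laplacian_in_def sum_subtractf sum_divide_distrib[symmetric])
  moreover have "\<bar>laplacian_in S v (line y l h) - laplacian_in S v y\<bar> \<le> L * \<bar>v (line y l h) - v y\<bar>"
    by (rule lap_lip) (use near_line[OF y, of h 12 l] h y in auto)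
  moreover have "L * \<bar>v (line y l h) - v y\<bar> \<le> L * (C\<^sub>1 * V * h)"
    using v_lipschitz[OF y h] L by (intro mult_left_mono) auto
  ultimately show ?thesis using h by (simp add: pos_divide_le_eq mult.assoc)
qed

lemma cont_w: "continuous_on (cball x0 9) (w l h)"
  unfolding w_def
proof (intro continuous_intros)
  show "continuous_on (cball x0 9) (\<lambda>y. v (line y l h))"
    by (rule continuous_on_compose2[OF cont_v])
       (use h in \<open>auto simp del: mem_cball intro!: continuous_intros near_line\<close>)
  show "continuous_on (cball x0 9) v" by (rule continuous_on_subset[OF cont_v]) (rule subset_cball, simp)
qed (use h in auto)

lemma w_central:
  assumes y: "y \<in> cball x0 7" and s: "0 < s" "s \<le> 1"
  shows "\<bar>w l h (line y j s) - w l h (line y j (- s))\<bar> \<le> C\<^sub>1\<^sup>2 * V * s"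
proof -
  have n: "z \<in> cball x0 9" if "z \<in> cball y 2" for z by (rule near[OF y that]) simp
  have "\<bar>w l h (line y j s) - w l h (line y j (- s))\<bar>
      \<le> ((2 * CARD('n) + 3) * (C\<^sub>1 * V) + L * (C\<^sub>1 * V)) * s"
  proof (rule central_difference_bound[OF _ _ line2_w[OF n] _ _ s])
    show "continuous_on (cball y 2) (w l h)" by (rule continuous_on_subset[OF cont_w]) (use n in blast)
  qed (use n w_bd w_lap C\<^sub>1_pos V in \<open>auto simp del: mem_cball\<close>)
  then show ?thesis by (simp add: C\<^sub>1_def algebra_simps power2_eq_square)
qed

end

text \<open>The factor of \<open>mixed_difference_bound\<close> for the quotients, where
  \<open>W = C\<^sub>1 * V\<close>, \<open>G = L * (C\<^sub>1 * V)\<close> and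
  \<open>P = C\<^sub>1\<^sup>2 * V\<close>.\<close>

definition C\<^sub>2 :: "real \<Rightarrow> real" where
  "C\<^sub>2 a = 2 * C\<^sub>1\<^sup>2 + 2 * ((8 * CARD('n) + 1) * C\<^sub>1 + 4 * (L * C\<^sub>1)) / (a * (1 - a))"

lemma C\<^sub>2_pos: "0 < a \<Longrightarrow> a < 1 \<Longrightarrow> C\<^sub>2 a \<ge> 0"
  using C\<^sub>1_pos L by (simp add: C\<^sub>2_def)

lemma w_mixed:
  assumes h: "0 < h" "h \<le> 1" and y: "y \<in> cball x0 5" and a: "0 < a" "a < 1"
    and s: "0 < s" "s \<le> 1" and t: "0 < t" "t \<le> 1"
  shows "\<bar>w l h (line (line y i s) j t) - w l h (line (line y i (-s)) j t)
      - w l h (line (line y i s) j (-t)) + w l h (line (line y i (-s)) j (-t))\<bar>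
      \<le> C\<^sub>2 a * V * (s powr a * t powr a)"
    (is "\<bar>?\<Phi>\<bar> \<le> _")
proof -
  have n: "z \<in> cball x0 9" if "z \<in> cball y 3" for z by (rule near[OF y that]) simp
  have "\<bar>?\<Phi>\<bar> \<le> (2 * (C\<^sub>1\<^sup>2 * V) + 2 * ((8 * CARD('n) + 1) * (C\<^sub>1 * V) + 4 * (L * (C\<^sub>1 * V))) / (a * (1 - a)))
      * (s powr a * t powr a)"
  proof (rule mixed_difference_bound[OF _ _ line2_w[OF h n] _ _ w_central[OF h near[OF y]] a s t])
    show "continuous_on (cball y 3) (w l h)" by (rule continuous_on_subset[OF cont_w[OF h]]) (use n in blast)
  qed (use n w_bd[OF h] w_lap[OF h] C\<^sub>1_pos V in \<open>auto simp del: mem_cball\<close>)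
  also have "(2 * (C\<^sub>1\<^sup>2 * V) + 2 * ((8 * CARD('n) + 1) * (C\<^sub>1 * V) + 4 * (L * (C\<^sub>1 * V))) / (a * (1 - a)))
      = C\<^sub>2 a * V" using a by (simp add: C\<^sub>2_def field_simps)
  finally show ?thesis .
qed

text \<open>Since all bounds on the quotients are uniform in \<open>h\<close>, this limit hands them
  over to the first partial derivatives.\<close>

lemma w_tendsto:
  assumes "y \<in> cball x0 12"
  shows "((\<lambda>h. w l h y) \<longlongrightarrow> g l y) (at_right 0)"
proof -
  have "y \<in> S" using assms sub by blast
  from C2_on_line_pderiv(1)[OF open_S C2 this, of l]
  have "((\<lambda>h. w l h y) \<longlongrightarrow> g l y) (at 0)"
    by (simp add: has_field_derivative_iff w_def)
  then show ?thesis by (rule tendsto_mono[rotated]) (simp add: at_le)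
qed

lemma ev_h: "\<forall>\<^sub>F h in at_right (0::real). 0 < h \<and> h \<le> 1"
  using eventually_at_right_less[of 0] eventually_at_right_real[of 0 1]
  by (auto elim: eventually_mono)

lemma g_bd: "y \<in> cball x0 9 \<Longrightarrow> \<bar>g l y\<bar> \<le> C\<^sub>1 * V"
  by (rule tendsto_upperbound[OF tendsto_rabs[OF w_tendsto]])
     (auto intro!: eventually_mono[OF ev_h] w_bd)

lemma g_lipschitz:
  assumes y: "y \<in> cball x0 6" and s: "0 < s" "s \<le> 1"
  shows "\<bar>g l (line y j s) - g l y\<bar> \<le> C\<^sub>1\<^sup>2 * V * s"
proof (rule tendsto_upperbound[OF tendsto_rabs[OF tendsto_diff[OF w_tendsto w_tendsto]]])
  show "\<forall>\<^sub>F h in at_right 0. \<bar>w l h (line y j s) - w l h y\<bar> \<le> C\<^sub>1\<^sup>2 * V * s"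
    using ev_h
  proof eventually_elim
    case (elim h)
    have "\<bar>w l h (line (line y j (s/2)) j (s/2)) - w l h (line (line y j (s/2)) j (- (s/2)))\<bar> \<le> C\<^sub>1\<^sup>2 * V * (s/2)"
      by (rule w_central[OF _ _ near_line[OF y]]) (use s elim in auto)
    also have "C\<^sub>1\<^sup>2 * V * (s/2) \<le> C\<^sub>1\<^sup>2 * V * s" using V s by (intro mult_left_mono) auto
    finally show ?case unfolding line_add by simp
  qed
  show "line y j s \<in> cball x0 12" by (rule near_line[OF y]) (use s in simp)
  show "y \<in> cball x0 12" using y by simp
qed simp

lemma second_bd:
  assumes y: "y \<in> cball x0 6"
  shows "\<bar>pderiv2_in S l j v y\<bar> \<le> C\<^sub>1\<^sup>2 * V"
proof -
  have "y \<in> S" using y sub by auto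
  from C2_on_line_pderiv(2)[OF open_S C2 this, of l j]
  have "((\<lambda>s. (g l (line y j s) - g l y) / s) \<longlongrightarrow> pderiv2_in S l j v y) (at 0)"
    by (simp add: has_field_derivative_iff)
  then have "((\<lambda>s. (g l (line y j s) - g l y) / s) \<longlongrightarrow> pderiv2_in S l j v y) (at_right 0)"
    by (rule tendsto_mono[rotated]) (simp add: at_le)
  then show ?thesis
    by (rule tendsto_upperbound[OF tendsto_rabs])
       (auto intro!: eventually_mono[OF ev_h] simp: pos_divide_le_eq g_lipschitz[OF y])
qed

lemma g_mixed:
  assumes y: "y \<in> cball x0 5" and a: "0 < a" "a < 1"
    and s: "0 < s" "s \<le> 1" and t: "0 < t" "t \<le> 1"
  shows "\<bar>g l (line (line y i s) j t) - g l (line (line y i (-s)) j t)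
      - g l (line (line y i s) j (-t)) + g l (line (line y i (-s)) j (-t))\<bar>
      \<le> C\<^sub>2 a * V * (s powr a * t powr a)"
proof -
  have n: "line (line y i \<sigma>) j \<tau> \<in> cball x0 12" if "\<bar>\<sigma>\<bar> \<le> 1" "\<bar>\<tau>\<bar> \<le> 1" for \<sigma> \<tau>
    by (rule near_line[OF near_line[OF y], of _ 6]) (use that in auto)
  show ?thesis
    by (rule tendsto_upperbound[OF tendsto_rabs[OF tendsto_add[OF tendsto_diff[OF tendsto_diff[OF
            w_tendsto w_tendsto] w_tendsto] w_tendsto]]])
       (use s t in \<open>auto simp del: mem_cball scaleR_minus_left intro!: n eventually_mono[OF ev_h]
          w_mixed[OF _ _ y a s t]\<close>)
qed

context
  fixes \<beta> :: real
  assumes \<beta>: "0 < \<beta>" "\<beta> < 1"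
begin

text \<open>With exponent \<open>(1 + \<beta>) / 2\<close> in each step, equal steps
  \<open>s = t\<close> give the power \<open>1 + \<beta>\<close>, the size of a second difference of
  a function whose derivative is Hoelder continuous with exponent \<beta>.\<close>

definition C\<^sub>3 :: real where "C\<^sub>3 = C\<^sub>2 ((1 + \<beta>) / 2)"
definition C\<^sub>4 :: real where "C\<^sub>4 = C\<^sub>3 / (1 - 2 powr - \<beta>)"

lemma C\<^sub>3_pos: "C\<^sub>3 \<ge> 0" using C\<^sub>2_pos[of "(1 + \<beta>)/2"] \<beta> by (simp add: C\<^sub>3_def)

lemma C\<^sub>4_pos: "C\<^sub>4 \<ge> 0" using C\<^sub>3_pos \<beta> by (simp add: C\<^sub>4_def powr_less_one less_imp_le)

lemma g_mixed_diag:
  assumes y: "y \<in> cball x0 5" and s: "0 < s" "s \<le> 1"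
  shows "\<bar>g l (line (line y i s) j s) - g l (line (line y i (-s)) j s)
      - g l (line (line y i s) j (-s)) + g l (line (line y i (-s)) j (-s))\<bar>
      \<le> C\<^sub>3 * V * s powr (1 + \<beta>)"
  using g_mixed[OF y _ _ s s, of "(1 + \<beta>)/2" l i j] \<beta> powr_add[of s "(1 + \<beta>)/2" "(1 + \<beta>)/2"]
  by (simp add: C\<^sub>3_def mult.assoc)

lemma g_quotient:
  assumes y: "y \<in> cball x0 4" and t: "0 < t" "t \<le> 1"
  shows "\<bar>(g l (line y i t) - g l y) / t - pderiv2_in S l i v y\<bar> \<le> C\<^sub>4 * V * t powr \<beta>"
proof -
  have yS: "y \<in> S" using y sub by auto
  have "\<bar>(g l (line y i t) - g l (line y i 0)) / t - pderiv2_in S l i v y\<bar>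
      \<le> C\<^sub>3 * V / (1 - 2 powr - \<beta>) * t powr \<beta>"
  proof (rule dyadic_difference_quotient[OF C2_on_line_pderiv(2)[OF open_S C2 yS] _ \<beta>(1) t])
    \<comment> \<open>The mixed difference with both directions equal to \<open>i\<close> and both
      steps \<open>t / 4\<close> about the midpoint collapses to the second difference at
      \<open>t\<close>, \<open>t / 2\<close> and 0.\<close>
    fix t :: real assume t: "0 < t" "t \<le> 1"
    have "\<bar>g l (line (line (line y i (t/2)) i (t/4)) i (t/4))
        - g l (line (line (line y i (t/2)) i (-(t/4))) i (t/4))
        - g l (line (line (line y i (t/2)) i (t/4)) i (-(t/4)))
        + g l (line (line (line y i (t/2)) i (-(t/4))) i (-(t/4)))\<bar> \<le> C\<^sub>3 * V * (t/4) powr (1 + \<beta>)"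
      by (rule g_mixed_diag[OF near_line[OF y]]) (use t in auto)
    also have "\<dots> \<le> C\<^sub>3 * V * t powr (1 + \<beta>)"
      using C\<^sub>3_pos V \<beta> t by (intro mult_left_mono powr_mono2) auto
    finally show "\<bar>g l (line y i t) - 2 * g l (line y i (t/2)) + g l (line y i 0)\<bar>
        \<le> C\<^sub>3 * V * t powr (1 + \<beta>)"
      unfolding line_add by simp
  qed
  then show ?thesis by (simp add: C\<^sub>4_def)
qed

text \<open>Both second derivatives are replaced with difference quotients whose step is the
  distance \<open>t\<close> of the two points. The difference of these quotients is a mixed
  difference over a square of side \<open>t\<close>, of order \<open>t powr (1 + \<beta>)\<close>,
  divided by \<open>t\<close>.\<close>

lemma second_holder_pos:
  assumes y: "y \<in> cball x0 3" and t: "0 < t" "t \<le> 1"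
  shows "\<bar>pderiv2_in S l i v (line y j t) - pderiv2_in S l i v y\<bar> \<le> (2 * C\<^sub>4 + C\<^sub>3) * V * t powr \<beta>"
proof -
  let ?D = "pderiv2_in S l i v"
  have q1: "\<bar>(g l (line (line y j t) i t) - g l (line y j t)) / t - ?D (line y j t)\<bar> \<le> C\<^sub>4 * V * t powr \<beta>"
    by (rule g_quotient[OF near_line[OF y] t]) (use t in simp)
  have q2: "\<bar>(g l (line y i t) - g l y) / t - ?D y\<bar> \<le> C\<^sub>4 * V * t powr \<beta>"
    by (rule g_quotient[OF _ t]) (use y in simp)
  define c where "c = line (line y i (t/2)) j (t/2)"
  have c: "c \<in> cball x0 5"
    unfolding c_def by (rule near_line[OF near_line[OF y], of _ 4]) (use t in auto)
  have half: "(t/2) *\<^sub>R u + (t/2) *\<^sub>R u = t *\<^sub>R u" for u :: "real^'n"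
    by (simp add: scaleR_add_left[symmetric])
  have e: "line (line c i (t/2)) j (t/2) = line (line y j t) i t"
    "line (line c i (-(t/2))) j (t/2) = line y j t"
    "line (line c i (t/2)) j (-(t/2)) = line y i t"
    "line (line c i (-(t/2))) j (-(t/2)) = y"
    using half[of "axis i 1"] half[of "axis j 1"] by (auto simp: c_def algebra_simps)
  have "\<bar>g l (line (line y j t) i t) - g l (line y j t) - g l (line y i t) + g l y\<bar>
      \<le> C\<^sub>3 * V * (t/2) powr (1 + \<beta>)"
    using g_mixed_diag[OF c, of "t/2" l i j] t unfolding e by simp
  also have "\<dots> \<le> C\<^sub>3 * V * t powr (1 + \<beta>)"
    using C\<^sub>3_pos V \<beta> t by (intro mult_left_mono powr_mono2) auto
  also have "\<dots> = C\<^sub>3 * V * t powr \<beta> * t" using t by (simp add: powr_add)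
  finally have "\<bar>(g l (line (line y j t) i t) - g l (line y j t)) / t - (g l (line y i t) - g l y) / t\<bar>
      \<le> C\<^sub>3 * V * t powr \<beta>"
    using t by (simp add: diff_divide_distrib[symmetric] pos_divide_le_eq algebra_simps)
  with q1 q2 have "\<bar>?D (line y j t) - ?D y\<bar> \<le> C\<^sub>3 * V * t powr \<beta> + 2 * (C\<^sub>4 * V * t powr \<beta>)"
    by linarith
  then show ?thesis by (simp add: algebra_simps)
qed

lemma second_holder_line:
  assumes y: "y \<in> cball x0 1" and t: "\<bar>t\<bar> \<le> 1"
  shows "\<bar>pderiv2_in S l i v (line y j t) - pderiv2_in S l i v y\<bar> \<le> (2 * C\<^sub>4 + C\<^sub>3) * V * \<bar>t\<bar> powr \<beta>"
proof -
  consider "t = 0" | "t > 0" | "t < 0" by linarith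
  then show ?thesis
  proof cases
    case 3
    have "\<bar>pderiv2_in S l i v (line (line y j t) j (-t)) - pderiv2_in S l i v (line y j t)\<bar>
        \<le> (2 * C\<^sub>4 + C\<^sub>3) * V * (-t) powr \<beta>"
      by (rule second_holder_pos[OF near_line[OF y]]) (use t 3 in auto)
    then show ?thesis using 3 by (simp add: abs_minus_commute)
  qed (use second_holder_pos[of y t l i j] y t in auto)
qed

lemma second_holder:
  assumes y: "y \<in> cball x0 1"
  shows "\<bar>pderiv2_in S l i v y - pderiv2_in S l i v x0\<bar>
      \<le> CARD('n) * (2 * C\<^sub>4 + C\<^sub>3) * V * dist x0 y powr \<beta>"
proof -
  have "\<bar>pderiv2_in S l i v y - pderiv2_in S l i v x0\<bar>
      \<le> CARD('n) * ((2 * C\<^sub>4 + C\<^sub>3) * V) * dist x0 y powr \<beta>"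
    by (rule coordinate_path_bound[OF second_holder_line _ _ y]) (use C\<^sub>3_pos C\<^sub>4_pos V \<beta> in auto)
  then show ?thesis by (simp add: mult.assoc)
qed

end
end

text \<open>Constants named inside the locale formally depend on its parameters. Recomputing them
  outside shows that one \<open>C\<close>, determined by \<beta>, \<open>L\<close> and the
  dimension, serves all solutions, points and sizes \<open>V\<close> at once.\<close>

lemma interior_estimate:
  fixes \<beta> L :: real
  assumes \<beta>: "0 < \<beta>" "\<beta> < 1" and L: "L \<ge> 0"
  obtains C where "C > 0"
    "\<And>(S :: (real^'n) set) v V x i j y. interior_data S v L V x \<Longrightarrow>
       \<bar>pderiv_in S i v x\<bar> \<le> C * V \<and> \<bar>pderiv2_in S i j v x\<bar> \<le> C * V \<and>
       (y \<in> cball x 1 \<longrightarrow> \<bar>pderiv2_in S i j v y - pderiv2_in S i j v x\<bar> \<le> C * V * dist x y powr \<beta>)"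
proof -
  define a where "a = (1 + \<beta>) / 2"
  define C1 where "C1 = 2 * real CARD('n) + 3 + L"
  define C3 where "C3 = 2 * C1\<^sup>2 + 2 * ((8 * real CARD('n) + 1) * C1 + 4 * (L * C1)) / (a * (1 - a))"
  define C4 where "C4 = C3 / (1 - 2 powr - \<beta>)"
  define C where "C = max (max C1 (C1\<^sup>2)) (CARD('n) * (2 * C4 + C3))"
  show ?thesis
  proof (rule that[of C])
    have "C1 > 0" using L by (simp add: C1_def add_pos_nonneg)
    then show "C > 0" by (simp add: C_def)
    fix S :: "(real^'n) set" and v V x i j y
    assume "interior_data S v L V x"
    then interpret interior_data S v L V x .
    have eq: "C\<^sub>1 = C1" "C\<^sub>3 \<beta> = C3" "C\<^sub>4 \<beta> = C4"
      by (simp_all add: C\<^sub>1_def C\<^sub>3_def[OF \<beta>] C\<^sub>4_def[OF \<beta>] C\<^sub>2_def C1_def C3_def C4_def a_def)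
    have le: "c * V \<le> C * V" if "c \<le> C" for c :: real
      using that V by (intro mult_right_mono) auto
    have "\<bar>pderiv_in S i v x\<bar> \<le> C * V"
      using order_trans[OF g_bd[of x i] le[of C1, folded eq]] by (simp add: eq C_def)
    moreover have "\<bar>pderiv2_in S i j v x\<bar> \<le> C * V"
      using order_trans[OF second_bd[of x i j] le[of "C1\<^sup>2", folded eq]] by (simp add: eq C_def)
    moreover have "\<bar>pderiv2_in S i j v y - pderiv2_in S i j v x\<bar> \<le> C * V * dist x y powr \<beta>"
      if "y \<in> cball x 1"
    proof -
      have "CARD('n) * (2 * C4 + C3) * V * dist x y powr \<beta> \<le> C * V * dist x y powr \<beta>"
        by (intro mult_right_mono le) (auto simp: C_def)
      with second_holder[OF \<beta> that, of i j] show ?thesis by (simp add: eq)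
    qed
    ultimately show "\<bar>pderiv_in S i v x\<bar> \<le> C * V \<and> \<bar>pderiv2_in S i j v x\<bar> \<le> C * V \<and>
       (y \<in> cball x 1 \<longrightarrow> \<bar>pderiv2_in S i j v y - pderiv2_in S i j v x\<bar> \<le> C * V * dist x y powr \<beta>)"
      by blast
  qed
qed

text \<open>The two functions have the same derivatives in the sense of
  \<open>has_derivative\<close>, so the choice operator behind \<open>frechet_derivative\<close>
  selects the same map, even at points where neither is differentiable.\<close>

lemma pderiv_in_diff_const: "pderiv_in S i (\<lambda>x. u x - c) = pderiv_in S i u"
proof -
  have "((\<lambda>x. u x - c) has_derivative D) F \<longleftrightarrow> (u has_derivative D) F" for D F
    using has_derivative_diff[of "\<lambda>x. u x - c" D F "\<lambda>_. - c" "\<lambda>_. 0"]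
      has_derivative_diff[of u D F "\<lambda>_. c" "\<lambda>_. 0"] by auto
  then show ?thesis by (simp add: pderiv_in_def frechet_derivative_def fun_eq_iff)
qed

lemma pderiv2_in_diff_const: "pderiv2_in S i j (\<lambda>x. u x - c) = pderiv2_in S i j u"
  by (simp add: pderiv2_in_def pderiv_in_diff_const)

lemma laplacian_in_diff_const: "laplacian_in S (\<lambda>x. u x - c) = laplacian_in S u"
  by (simp add: laplacian_in_def pderiv2_in_diff_const fun_eq_iff)

lemma C2_on_diff_const: "C2_on S u \<Longrightarrow> C2_on S (\<lambda>x. u x - c)"
  by (auto simp: C2_on_def pderiv_in_diff_const pderiv2_in_diff_const intro: differentiable_on_diff)

lemma norm_sq_eq_sum: "(norm (y :: real^'n))\<^sup>2 = (\<Sum>l\<in>UNIV. (y $ l)\<^sup>2)"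
  unfolding power2_norm_eq_inner inner_vec_def by (simp add: power2_eq_square)

section \<open>Quantitative maximum principles\<close>

lemma second_deriv_gaussian:
  "second_deriv (\<lambda>s. exp (- \<alpha> * (norm (line y l s - x))\<^sup>2))
     (exp (- \<alpha> * (norm (y - x))\<^sup>2) * (4 * \<alpha>\<^sup>2 * ((y - x) $ l)\<^sup>2 - 2 * \<alpha>))"
proof (rule second_derivI)
  let ?d = "(y - x) $ l" and ?r = "(norm (y - x))\<^sup>2"
  let ?q = "\<lambda>s. ?r + 2 * s * ?d + s\<^sup>2"
  let ?D = "\<lambda>s. exp (- \<alpha> * ?q s) * (- \<alpha> * (2 * ?d + 2 * s))"
  show "\<forall>\<^sub>F s in nhds 0. ((\<lambda>s. exp (- \<alpha> * (norm (line y l s - x))\<^sup>2)) has_real_derivative ?D s) (at s)"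
    unfolding norm_line_sq
    by (intro always_eventually allI) (auto intro!: derivative_eq_intros)
  have "(?D has_real_derivative exp (- \<alpha> * ?q 0) * (- \<alpha> * (2 * ?d + 2 * 0)) * (- \<alpha> * (2 * ?d + 2 * 0))
      + exp (- \<alpha> * ?q 0) * (- \<alpha> * 2)) (at 0)"
    by (auto intro!: derivative_eq_intros simp: algebra_simps)
  then show "(?D has_real_derivative exp (- \<alpha> * ?r) * (4 * \<alpha>\<^sup>2 * ?d\<^sup>2 - 2 * \<alpha>)) (at 0)"
    by (rule DERIV_cong) (simp add: algebra_simps power2_eq_square)
qed

lemma second_deriv_quartic:
  "second_deriv (\<lambda>s. (R\<^sup>2 - (norm (line y l s - x))\<^sup>2)\<^sup>2)
     (8 * ((y - x) $ l)\<^sup>2 - 4 * (R\<^sup>2 - (norm (y - x))\<^sup>2))"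
proof (rule second_derivI)
  let ?d = "(y - x) $ l" and ?r = "(norm (y - x))\<^sup>2"
  let ?q = "\<lambda>s. ?r + 2 * s * ?d + s\<^sup>2"
  let ?D = "\<lambda>s. - (2 * (R\<^sup>2 - ?q s) * (2 * ?d + 2 * s))"
  show "\<forall>\<^sub>F s in nhds 0. ((\<lambda>s. (R\<^sup>2 - (norm (line y l s - x))\<^sup>2)\<^sup>2) has_real_derivative ?D s) (at s)"
    unfolding norm_line_sq
    by (intro always_eventually allI) (auto intro!: derivative_eq_intros simp: algebra_simps)
  show "(?D has_real_derivative 8 * ?d\<^sup>2 - 4 * (R\<^sup>2 - ?r)) (at 0)"
    by (auto intro!: derivative_eq_intros simp: algebra_simps power2_eq_square)
qed

lemma line2_interior_max:
  assumes S: "open S" "y \<in> S" and max: "\<And>z. z \<in> S \<Longrightarrow> p z \<le> p y"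
    and d: "\<And>l. second_deriv (\<lambda>s. p (line y l s)) (D l)"
  shows "(\<Sum>l\<in>UNIV. D l) \<le> 0"
proof (rule sum_nonpos)
  fix l
  show "D l \<le> 0"
  proof (rule second_deriv_local_max[OF d])
    show "\<forall>\<^sub>F s in nhds 0. p (line y l s) \<le> p (line y l 0)"
      using eventually_line_in_open[OF S, of l] by eventually_elim (simp add: max)
  qed
qed

text \<open>Hopf's barrier. The Gaussian minus its value on the outer sphere vanishes on that
  sphere, is at most 1 on the core, and is a strict subsolution in the annulus between them once
  \<alpha> is large. It therefore cannot first exceed \<open>v\<close> at any of the three
  places.\<close>

lemma gaussian_lower_bound:
  fixes v :: "real^'n \<Rightarrow> real" and H :: "'n \<Rightarrow> real^'n \<Rightarrow> real" and \<alpha> \<kappa> \<delta> L r R :: real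
  assumes cont: "continuous_on (cball x R) v" and H: "\<And>y. y \<in> ball x R \<Longrightarrow> line2 v H y"
    and pos: "\<And>y. y \<in> cball x R \<Longrightarrow> v y \<ge> 0"
    and lap: "\<And>y. y \<in> ball x R \<Longrightarrow> (\<Sum>l\<in>UNIV. H l y) \<le> L * v y + \<delta>"
    and core: "\<And>y. y \<in> cball x r \<Longrightarrow> v y \<ge> \<kappa>"
    and R: "0 < r" "r < R" and \<kappa>: "\<kappa> > 0" and L: "L \<ge> 0"
    and \<alpha>: "\<alpha> > 0" "4 * \<alpha>\<^sup>2 * r\<^sup>2 - 2 * CARD('n) * \<alpha> \<ge> L + 1"
    and \<delta>: "\<delta> < \<kappa> * exp (- \<alpha> * R\<^sup>2)"
    and z: "z \<in> cball x R"
  shows "v z \<ge> \<kappa> * (exp (- \<alpha> * (norm (z - x))\<^sup>2) - exp (- \<alpha> * R\<^sup>2))"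
proof -
  define \<phi> where "\<phi> = (\<lambda>y. exp (- \<alpha> * (norm (y - x))\<^sup>2))"
  define D where "D = (\<lambda>y. \<kappa> * (\<phi> y - exp (- \<alpha> * R\<^sup>2)) - v y)"
  have "continuous_on (cball x R) D" unfolding D_def \<phi>_def by (intro continuous_intros cont)
  moreover have "cball x R \<noteq> {}" using R by auto
  ultimately obtain y where y: "y \<in> cball x R" "\<And>z. z \<in> cball x R \<Longrightarrow> D z \<le> D y"
    using continuous_attains_sup[of "cball x R" D] by auto
  have "D y \<le> 0"
  proof (rule ccontr)
    assume "\<not> D y \<le> 0"
    then have gt: "v y < \<kappa> * (\<phi> y - exp (- \<alpha> * R\<^sup>2))" by (simp add: D_def)
    have "y \<notin> cball x r"
    proof
      assume "y \<in> cball x r"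
      then have "\<kappa> \<le> v y" by (rule core)
      moreover have "\<phi> y \<le> 1" using \<alpha> by (simp add: \<phi>_def)
      then have "\<kappa> * (\<phi> y - exp (- \<alpha> * R\<^sup>2)) \<le> \<kappa> * 1"
        using \<kappa> by (intro mult_left_mono) (auto intro: order_trans[of _ "\<phi> y"])
      ultimately show False using gt by simp
    qed
    then have ry: "r < norm (y - x)" by (simp add: dist_norm norm_minus_commute)
    have yR: "y \<in> ball x R"
    proof (rule ccontr)
      assume "y \<notin> ball x R"
      with y(1) have "norm (y - x) = R" by (simp add: dist_norm norm_minus_commute)
      then have "v y < 0" using gt by (simp add: \<phi>_def)
      with pos[OF y(1)] show False by simp
    qed
    define e where "e = (\<lambda>l. \<phi> y * (4 * \<alpha>\<^sup>2 * ((y - x) $ l)\<^sup>2 - 2 * \<alpha>))"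
    have "(\<Sum>l\<in>UNIV. \<kappa> * (e l - 0) - H l y) \<le> 0"
    proof (rule line2_interior_max[OF open_ball yR, of D])
      show "D z \<le> D y" if "z \<in> ball x R" for z using y(2) that by auto
      show "second_deriv (\<lambda>s. D (line y l s)) (\<kappa> * (e l - 0) - H l y)" for l
        unfolding D_def \<phi>_def e_def
        by (intro second_deriv_diff second_deriv_cmult second_deriv_const
            second_deriv_gaussian line2D H yR)
    qed
    then have "\<kappa> * (\<Sum>l\<in>UNIV. e l) \<le> L * v y + \<delta>"
      using lap[OF yR] by (simp add: sum_subtractf sum_distrib_left)
    moreover have "(\<Sum>l\<in>UNIV. e l) = \<phi> y * (4 * \<alpha>\<^sup>2 * (norm (y - x))\<^sup>2 - 2 * CARD('n) * \<alpha>)"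
      by (simp add: e_def norm_sq_eq_sum sum_distrib_left[symmetric] sum_subtractf)
    moreover have "4 * \<alpha>\<^sup>2 * (norm (y - x))\<^sup>2 - 2 * CARD('n) * \<alpha> \<ge> L + 1"
    proof -
      have "4 * \<alpha>\<^sup>2 * r\<^sup>2 \<le> 4 * \<alpha>\<^sup>2 * (norm (y - x))\<^sup>2"
        using ry R by (intro mult_left_mono power_mono) auto
      then show ?thesis using \<alpha> by linarith
    qed
    then have "\<kappa> * (\<phi> y * (L + 1)) \<le> \<kappa> * (\<phi> y * (4 * \<alpha>\<^sup>2 * (norm (y - x))\<^sup>2 - 2 * CARD('n) * \<alpha>))"
      using \<kappa> by (intro mult_left_mono) (auto simp: \<phi>_def)
    moreover have "L * v y \<le> L * (\<kappa> * \<phi> y)"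
    proof (rule mult_left_mono[OF _ L])
      show "v y \<le> \<kappa> * \<phi> y" using gt \<kappa> by (smt (verit) exp_gt_zero mult_left_mono)
    qed
    \<comment> \<open>The surplus 1 in \<open>L + 1\<close> leaves the term
      \<open>\<kappa> * \<phi> y\<close> over, and this lower bound for it exceeds the admissible
      error \<delta>.\<close>
    moreover have "\<kappa> * exp (- \<alpha> * R\<^sup>2) \<le> \<kappa> * \<phi> y"
      unfolding \<phi>_def using yR \<kappa> \<alpha>
      by (intro mult_left_mono) (auto simp: dist_norm norm_minus_commute intro!: power_mono)
    ultimately show False using \<delta> by (simp add: algebra_simps)
  qed
  with y(2)[OF z] show ?thesis by (simp add: D_def \<phi>_def)
qed

text \<open>If \<open>v y > \<eta>\<close>, the Lipschitz bound keeps \<open>v\<close> above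
  \<open>\<eta> / 2\<close> on a ball of fixed radius about \<open>y\<close>. The Gaussian barrier
  centred at \<open>y\<close> carries a definite fraction of this to \<open>x\<close>, contradicting
  the smallness of \<open>v x\<close>. Every constant is fixed before \<open>v\<close> is
  given.\<close>

lemma uniform_strong_minimum_principle:
  fixes \<eta> R L P :: real
  assumes \<eta>: "\<eta> > 0" and R: "R \<ge> 1" and L: "L \<ge> 0" and P: "P > 0"
  obtains \<epsilon> where "\<epsilon> > 0"
    "\<And>(v :: real^'n \<Rightarrow> real) H x y. continuous_on (cball x (3 * R)) v \<Longrightarrow>
       (\<And>y. y \<in> cball x (3 * R) \<Longrightarrow> line2 v H y \<and> 0 \<le> v y \<and> (\<Sum>l\<in>UNIV. H l y) \<le> L * v y + \<epsilon>) \<Longrightarrow>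
       (\<And>y z. y \<in> cball x R \<Longrightarrow> z \<in> cball y 1 \<Longrightarrow> \<bar>v z - v y\<bar> \<le> P * dist y z) \<Longrightarrow>
       v x \<le> \<epsilon> \<Longrightarrow> y \<in> cball x R \<Longrightarrow> v y \<le> \<eta>"
proof -
  define r where "r = min 1 (\<eta> / (2 * P))"
  have r: "0 < r" "r \<le> 1" "P * r \<le> \<eta> / 2"
    using \<eta> P by (auto simp: r_def min_def field_simps)
  define \<alpha> where "\<alpha> = (2 * CARD('n) + L + 1) / (4 * r\<^sup>2) + 1"
  have \<alpha>1: "\<alpha> \<ge> 1" using L r by (simp add: \<alpha>_def)
  have \<alpha>: "4 * \<alpha>\<^sup>2 * r\<^sup>2 - 2 * CARD('n) * \<alpha> \<ge> L + 1"
  proof -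
    have "2 * CARD('n) + L + 1 \<le> 4 * r\<^sup>2 * \<alpha>" using r by (simp add: \<alpha>_def field_simps)
    then have "\<alpha> * (2 * CARD('n) + L + 1) \<le> \<alpha> * (4 * r\<^sup>2 * \<alpha>)" using \<alpha>1 by (intro mult_left_mono) auto
    moreover have "L + 1 \<le> \<alpha> * (L + 1)" using \<alpha>1 L mult_right_mono[of 1 \<alpha> "L + 1"] by simp
    ultimately show ?thesis by (simp add: algebra_simps power2_eq_square)
  qed
  \<comment> \<open>The value of the barrier at distance \<open>R\<close> from its centre, hence a
    lower bound for its value at any admissible \<open>x\<close>. Radius \<open>2 * R\<close> keeps
    it positive, and the ball of that radius about \<open>y\<close> still lies in
    \<open>cball x (3 * R)\<close>.\<close>
  define m where "m = \<eta> / 2 * (exp (- \<alpha> * R\<^sup>2) - exp (- \<alpha> * (2 * R)\<^sup>2))"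
  have "R\<^sup>2 < (2 * R)\<^sup>2" using R by (intro power_strict_mono) auto
  then have "\<alpha> * R\<^sup>2 < \<alpha> * (2 * R)\<^sup>2" using \<alpha>1 by (intro mult_strict_left_mono) auto
  then have "exp (- \<alpha> * (2 * R)\<^sup>2) < exp (- \<alpha> * R\<^sup>2)" by (simp only: exp_less_cancel_iff mult_minus_left neg_less_iff_less)
  then have m: "m > 0" unfolding m_def using \<eta> by (intro mult_pos_pos) auto
  \<comment> \<open>The first term makes \<open>v x \<le> \<epsilon>\<close> contradict
    \<open>m \<le> v x\<close>; the second is half of the error in the differential inequality that
    \<open>gaussian_lower_bound\<close> tolerates for \<kappa> = \<open>\<eta> / 2\<close>.\<close>
  define \<epsilon> where "\<epsilon> = min (m / 2) (\<eta> / 4 * exp (- \<alpha> * (2 * R)\<^sup>2))"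
  have \<epsilon>: "\<epsilon> > 0" "\<epsilon> < m" "\<epsilon> < \<eta> / 2 * exp (- \<alpha> * (2 * R)\<^sup>2)"
  proof -
    have "\<epsilon> \<le> m / 2" "\<epsilon> \<le> \<eta> / 4 * exp (- \<alpha> * (2 * R)\<^sup>2)"
      unfolding \<epsilon>_def by (rule min.cobounded1, rule min.cobounded2)
    moreover have "\<eta> / 4 * exp (- \<alpha> * (2 * R)\<^sup>2) < \<eta> / 2 * exp (- \<alpha> * (2 * R)\<^sup>2)"
      using \<eta> by (intro mult_strict_right_mono) auto
    ultimately show "\<epsilon> < m" "\<epsilon> < \<eta> / 2 * exp (- \<alpha> * (2 * R)\<^sup>2)" using m by linarith+
    show "\<epsilon> > 0" unfolding \<epsilon>_def min_less_iff_conj using m \<eta> by simp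
  qed
  show ?thesis
  proof (rule that[OF \<epsilon>(1)])
    fix v :: "real^'n \<Rightarrow> real" and H x y
    assume cont: "continuous_on (cball x (3 * R)) v"
      and data: "\<And>y. y \<in> cball x (3 * R) \<Longrightarrow> line2 v H y \<and> 0 \<le> v y \<and> (\<Sum>l\<in>UNIV. H l y) \<le> L * v y + \<epsilon>"
      and lip: "\<And>y z. y \<in> cball x R \<Longrightarrow> z \<in> cball y 1 \<Longrightarrow> \<bar>v z - v y\<bar> \<le> P * dist y z"
      and vx: "v x \<le> \<epsilon>" and y: "y \<in> cball x R"
    show "v y \<le> \<eta>"
    proof (rule ccontr)
      assume ny: "\<not> v y \<le> \<eta>"
      have sub: "z \<in> cball x (3 * R)" if "z \<in> cball y (2 * R)" for z
        using y that dist_triangle[of x z y] by simp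
      have "v x \<ge> \<eta> / 2 * (exp (- \<alpha> * (norm (x - y))\<^sup>2) - exp (- \<alpha> * (2 * R)\<^sup>2))"
      proof (rule gaussian_lower_bound[where r=r and L=L and \<delta>=\<epsilon>])
        show "continuous_on (cball y (2 * R)) v"
          by (rule continuous_on_subset[OF cont]) (use sub in blast)
        show "line2 v H z" if "z \<in> ball y (2 * R)" for z
          using data[OF sub, of z] that by (meson ball_subset_cball subsetD)
        show "(\<Sum>l\<in>UNIV. H l z) \<le> L * v z + \<epsilon>" if "z \<in> ball y (2 * R)" for z
          using data[OF sub, of z] that by (meson ball_subset_cball subsetD)
        show "v z \<ge> 0" if "z \<in> cball y (2 * R)" for z using data[OF sub[OF that]] by simp
        show "\<eta> / 2 \<le> v z" if "z \<in> cball y r" for z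
        proof -
          have "\<bar>v z - v y\<bar> \<le> P * dist y z" using lip[OF y, of z] that r by simp
          also have "\<dots> \<le> P * r" using that P by (intro mult_left_mono) auto
          finally show ?thesis using ny r by linarith
        qed
        show "x \<in> cball y (2 * R)" using y R by (simp add: dist_commute)
      qed (use r R \<alpha> \<alpha>1 \<epsilon> \<eta> L in auto)
      moreover have "exp (- \<alpha> * R\<^sup>2) \<le> exp (- \<alpha> * (norm (x - y))\<^sup>2)"
        using y \<alpha>1 by (auto simp: dist_norm intro!: power_mono)
      then have "m \<le> \<eta> / 2 * (exp (- \<alpha> * (norm (x - y))\<^sup>2) - exp (- \<alpha> * (2 * R)\<^sup>2))"
        unfolding m_def using \<eta> by (intro mult_left_mono) auto
      ultimately show False using vx \<epsilon> by linarith
    qed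
  qed
qed

text \<open>\<open>(R\<^sup>2 - \<bar>y - x\<bar>\<^sup>2)\<^sup>2\<close> serves as a strict subsolution of \<open>\<Delta>\<phi> + c \<phi> = 0\<close> on a large ball,
  in place of the principal eigenfunction.\<close>

lemma no_positive_supersolution:
  fixes w :: "real^'n \<Rightarrow> real" and H :: "'n \<Rightarrow> real^'n \<Rightarrow> real" and c R :: real
  assumes cont: "continuous_on (cball x R) w" and H: "\<And>y. y \<in> ball x R \<Longrightarrow> line2 w H y"
    and pos: "\<And>y. y \<in> cball x R \<Longrightarrow> w y > 0"
    and lap: "\<And>y. y \<in> ball x R \<Longrightarrow> (\<Sum>l\<in>UNIV. H l y) \<le> - c * w y"
    and R: "R > 0" and c: "c > 0" "(4 * CARD('n) + 8)\<^sup>2 < 32 * c * R\<^sup>2"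
  shows False
proof -
  define \<phi> where "\<phi> = (\<lambda>y. (R\<^sup>2 - (norm (y - x))\<^sup>2)\<^sup>2)"
  have "continuous_on (cball x R) (\<lambda>y. \<phi> y / w y)"
    unfolding \<phi>_def using pos by (intro continuous_intros cont) force
  moreover have "cball x R \<noteq> {}" using R by auto
  ultimately obtain y where y: "y \<in> cball x R" "\<And>z. z \<in> cball x R \<Longrightarrow> \<phi> z / w z \<le> \<phi> y / w y"
    using continuous_attains_sup[of "cball x R" "\<lambda>y. \<phi> y / w y"] by auto
  \<comment> \<open>The smallest multiple of \<open>w\<close> above \<phi> is \<open>t * w\<close>;
    it touches \<phi> at \<open>y\<close>, where the Laplacians can be compared.\<close>
  define t where "t = \<phi> y / w y"
  have "0 < \<phi> x / w x" using pos[of x] R by (simp add: \<phi>_def)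
  also have "\<dots> \<le> t" unfolding t_def by (rule y) (use R in simp)
  finally have t: "t > 0" .
  have yR: "y \<in> ball x R"
  proof (rule ccontr)
    assume "y \<notin> ball x R"
    with y(1) have "norm (y - x) = R" by (simp add: dist_norm norm_minus_commute)
    then show False using t by (simp add: t_def \<phi>_def)
  qed
  define e where "e = (\<lambda>l. 8 * ((y - x) $ l)\<^sup>2 - 4 * (R\<^sup>2 - (norm (y - x))\<^sup>2))"
  have le: "\<phi> z - t * w z \<le> 0" if "z \<in> cball x R" for z
    using y(2)[OF that] pos[OF that] by (simp add: t_def[symmetric] pos_divide_le_eq)
  have eq: "\<phi> y - t * w y = 0" using pos[OF y(1)] by (simp add: t_def)
  have "(\<Sum>l\<in>UNIV. e l - t * H l y) \<le> 0"
  proof (rule line2_interior_max[OF open_ball yR, of "\<lambda>y. \<phi> y - t * w y"])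
    show "\<phi> z - t * w z \<le> \<phi> y - t * w y" if "z \<in> ball x R" for z using le[of z] eq that by auto
    show "second_deriv (\<lambda>s. \<phi> (line y l s) - t * w (line y l s)) (e l - t * H l y)" for l
      unfolding \<phi>_def e_def
      by (intro second_deriv_diff second_deriv_cmult second_deriv_quartic line2D H yR)
  qed
  then have "(\<Sum>l\<in>UNIV. e l) \<le> t * (\<Sum>l\<in>UNIV. H l y)"
    by (simp add: sum_subtractf sum_distrib_left)
  also have "\<dots> \<le> t * (- c * w y)" using lap[OF yR] t by (intro mult_left_mono) auto
  also have "\<dots> = - c * \<phi> y" using eq by (simp add: algebra_simps)
  finally have 1: "(\<Sum>l\<in>UNIV. e l) \<le> - c * \<phi> y" .
  define q where "q = R\<^sup>2 - (norm (y - x))\<^sup>2"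
  define N where "N = real CARD('n)"
  have "(\<Sum>l\<in>UNIV. e l) = 8 * (norm (y - x))\<^sup>2 - 4 * N * q"
    unfolding e_def q_def[symmetric] sum_subtractf sum_distrib_left[symmetric] norm_sq_eq_sum[symmetric]
    by (simp add: N_def)
  then have "(\<Sum>l\<in>UNIV. e l) = 8 * (R\<^sup>2 - q) - 4 * N * q" by (simp add: q_def)
  moreover have "\<phi> y = q\<^sup>2" by (simp add: \<phi>_def q_def)
  ultimately have "c * q\<^sup>2 - (4 * N + 8) * q + 8 * R\<^sup>2 \<le> 0" using 1 by (simp add: algebra_simps)
  \<comment> \<open>Completing the square: the assumption on \<open>R\<close> says that this
    quadratic in \<open>q\<close> has negative discriminant, so it cannot be nonpositive.\<close>
  then have "4 * c * (c * q\<^sup>2 - (4 * N + 8) * q + 8 * R\<^sup>2) \<le> 0" using c by (simp add: mult_nonneg_nonpos)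
  moreover have "4 * c * (c * q\<^sup>2 - (4 * N + 8) * q + 8 * R\<^sup>2)
      = (2 * c * q - (4 * N + 8))\<^sup>2 + (32 * c * R\<^sup>2 - (4 * N + 8)\<^sup>2)"
    by (simp add: power2_eq_square algebra_simps)
  moreover have "0 \<le> (2 * c * q - (4 * N + 8))\<^sup>2" by simp
  moreover have "(4 * N + 8)\<^sup>2 < 32 * c * R\<^sup>2" using c by (simp add: N_def)
  ultimately show False by linarith
qed

section \<open>The Liouville theorem\<close>

definition sol_on :: "(real \<Rightarrow> real) \<Rightarrow> real \<Rightarrow> (real^'n) set \<Rightarrow> (real^'n \<Rightarrow> real) \<Rightarrow> bool" where
  "sol_on f M S u \<longleftrightarrow> open S \<and> C2_on S u \<and>
     (\<forall>y\<in>S. 0 \<le> u y \<and> u y \<le> M \<and> laplacian_in S u y + f (u y) = 0)"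

text \<open>Local uniform limits of solutions are only ever used through their approximants, so that no
  convergence of derivatives is needed.\<close>

definition limit_sol :: "(real \<Rightarrow> real) \<Rightarrow> real \<Rightarrow> (real^'n \<Rightarrow> real) \<Rightarrow> bool" where
  "limit_sol f M U \<longleftrightarrow> (\<forall>x R \<epsilon>. \<epsilon> > 0 \<longrightarrow>
     (\<exists>S u a. sol_on f M S u \<and> cball a R \<subseteq> S \<and> (\<forall>y\<in>cball 0 R. \<bar>u (a + y) - U (x + y)\<bar> \<le> \<epsilon>)))"

lemma limit_solE:
  assumes "limit_sol f M U" "\<epsilon> > 0"
  obtains S u a where "sol_on f M S u" "cball a R \<subseteq> S"
    "\<And>y. y \<in> cball 0 R \<Longrightarrow> \<bar>u (a + y) - U (x + y)\<bar> \<le> \<epsilon>"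
  using assms unfolding limit_sol_def by blast

lemma sol_onD:
  assumes "sol_on f M S u" "y \<in> S"
  shows "0 \<le> u y" "u y \<le> M" "line2 u (\<lambda>l. pderiv2_in S l l u) y"
    "(\<Sum>l\<in>UNIV. pderiv2_in S l l u y) = - f (u y)"
proof -
  show "0 \<le> u y" "u y \<le> M" "line2 u (\<lambda>l. pderiv2_in S l l u) y"
    using assms C2_on_line2 by (auto simp: sol_on_def)
  have "laplacian_in S u y + f (u y) = 0" using assms by (simp add: sol_on_def)
  then show "(\<Sum>l\<in>UNIV. pderiv2_in S l l u y) = - f (u y)" by (simp add: laplacian_in_def)
qed

lemma sol_on_continuous: "sol_on f M S u \<Longrightarrow> continuous_on S u"
  by (simp add: sol_on_def C2_on_continuous)

section \<open>The hypotheses on \<open>f\<close> in quantitative form, and bounds for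
  solutions\<close>

locale nonlinearity =
  fixes f :: "real \<Rightarrow> real" and \<mu> M L :: real
  assumes L: "L \<ge> 0"
    and lip: "\<And>a b. a \<in> {0..M} \<Longrightarrow> b \<in> {0..M} \<Longrightarrow> \<bar>f a - f b\<bar> \<le> L * \<bar>a - b\<bar>"
    and \<mu>: "0 < \<mu>" "\<mu> \<le> M"
    and f_pos: "\<And>s. 0 < s \<Longrightarrow> s < \<mu> \<Longrightarrow> f s > 0"
    and f_nonpos: "\<And>s. \<mu> \<le> s \<Longrightarrow> f s \<le> 0"
    and f_zero: "f 0 > 0 \<or> (f 0 = 0 \<and> (\<exists>c>0. \<exists>\<delta>>0. \<forall>s. 0 < s \<and> s < \<delta> \<longrightarrow> c * s \<le> f s))"
    and f_left: "\<And>z. \<mu> < z \<Longrightarrow> f z = 0 \<Longrightarrow>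
      \<exists>c>0. \<exists>\<delta>>0. \<forall>s. z - \<delta> < s \<and> s < z \<longrightarrow> f s \<le> - c * (z - s)"
begin

text \<open>The signs on both sides of \<mu> meet by continuity: if \<open>f \<mu>\<close> were
  negative, the Lipschitz bound would leave no room to become positive at distance \<open>d\<close>
  to the left.\<close>

lemma f_\<mu>: "f \<mu> = 0"
proof (rule ccontr)
  assume "f \<mu> \<noteq> 0"
  with f_nonpos[of \<mu>] have neg: "f \<mu> < 0" by simp
  define d where "d = min (\<mu> / 2) (- f \<mu> / (2 * (L + 1)))"
  have d1: "d \<le> \<mu> / 2" "d \<le> - f \<mu> / (2 * (L + 1))"
    unfolding d_def by (rule min.cobounded1, rule min.cobounded2)
  have "0 < - f \<mu> / (2 * (L + 1))" using neg L by (intro divide_pos_pos) auto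
  then have d: "0 < d" "d < \<mu>" using \<mu> d1(1) by (auto simp: d_def)
  have "(L + 1) * d \<le> (L + 1) * (- f \<mu> / (2 * (L + 1)))"
    using L d1(2) by (intro mult_left_mono) auto
  also have "\<dots> = - f \<mu> / 2" using L by (simp add: field_simps)
  finally have "L * d \<le> - f \<mu> / 2" using d by (simp add: algebra_simps)
  moreover have "\<bar>f (\<mu> - d) - f \<mu>\<bar> \<le> L * \<bar>\<mu> - d - \<mu>\<bar>"
    by (rule lip) (use d \<mu> in auto)
  moreover have "f (\<mu> - d) > 0" by (rule f_pos) (use d in auto)
  ultimately show False using neg d by simp
qed

lemma sol_interior_data:
  assumes u: "sol_on f M S u" and sub: "cball x 12 \<subseteq> S" and z: "z \<in> {0..M}" "f z = 0"
    and V: "V > 0" "\<And>y. y \<in> cball x 12 \<Longrightarrow> \<bar>u y - z\<bar> \<le> V"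
  shows "interior_data S (\<lambda>y. u y - z) L V x"
proof
  have lap: "laplacian_in S u y = - f (u y)" "u y \<in> {0..M}" if "y \<in> cball x 12" for y
    using sol_onD[OF u, of y] sub that by (auto simp: laplacian_in_def)
  show "\<bar>laplacian_in S (\<lambda>y. u y - z) y\<bar> \<le> L * V" if y: "y \<in> cball x 12" for y
  proof -
    have "\<bar>laplacian_in S u y\<bar> = \<bar>f (u y) - f z\<bar>" by (simp add: lap[OF y] z)
    also have "\<dots> \<le> L * \<bar>u y - z\<bar>" by (rule lip[OF lap(2)[OF y] z(1)])
    also have "\<dots> \<le> L * V" using V(2)[OF y] L by (rule mult_left_mono)
    finally show ?thesis by (simp add: laplacian_in_diff_const)
  qed
  show "\<bar>laplacian_in S (\<lambda>y. u y - z) y - laplacian_in S (\<lambda>y. u y - z) y'\<bar> \<le> L * \<bar>u y - z - (u y' - z)\<bar>"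
    if y: "y \<in> cball x 12" "y' \<in> cball x 12" for y y'
    using lip[OF lap(2)[OF y(1)] lap(2)[OF y(2)]] by (simp add: laplacian_in_diff_const lap[OF y(1)] lap[OF y(2)])
qed (use assms L in \<open>auto simp: sol_on_def intro: C2_on_diff_const\<close>)

lemma sol_lipschitz:
  obtains P where "P > 0" "\<And>(S :: (real^'n) set) u x y. sol_on f M S u \<Longrightarrow> cball x 12 \<subseteq> S \<Longrightarrow>
      y \<in> cball x 1 \<Longrightarrow> \<bar>u y - u x\<bar> \<le> P * dist x y"
proof (rule that)
  let ?P = "CARD('n) * ((2 * CARD('n) + 3 + L) * M)"
  show "?P > 0" using L \<mu> by (intro mult_pos_pos add_pos_nonneg) auto
  fix S :: "(real^'n) set" and u x y
  assume u: "sol_on f M S u" and sub: "cball x 12 \<subseteq> S" and y: "y \<in> cball x 1"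
  \<comment> \<open>The constant \<mu> is a zero of \<open>f\<close> in \<open>{0..M}\<close>, and
    all values of \<open>u\<close> lie within \<open>M\<close> of it; this gives a bound that is the
    same for all solutions.\<close>
  interpret interior_data S "\<lambda>y. u y - \<mu>" L M x
  proof (rule sol_interior_data[OF u sub])
    show "\<bar>u y - \<mu>\<bar> \<le> M" if "y \<in> cball x 12" for y
      using sol_onD[OF u, of y] sub that \<mu> by fastforce
  qed (use \<mu> f_\<mu> in auto)
  have "\<bar>(u y - \<mu>) - (u x - \<mu>)\<bar> \<le> CARD('n) * (C\<^sub>1 * M) * dist x y powr 1"
  proof (rule coordinate_path_bound[OF _ _ _ y])
    fix y :: "real^'n" and j and t :: real assume y: "y \<in> cball x 1" and t: "\<bar>t\<bar> \<le> 1"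
    consider "t = 0" | "t > 0" | "t < 0" by linarith
    then show "\<bar>(u (line y j t) - \<mu>) - (u y - \<mu>)\<bar> \<le> C\<^sub>1 * M * \<bar>t\<bar> powr 1"
    proof cases
      case 2
      have "\<bar>(u (line y j t) - \<mu>) - (u y - \<mu>)\<bar> \<le> C\<^sub>1 * M * t"
        by (rule v_lipschitz) (use y t 2 in auto)
      then show ?thesis using 2 by simp
    next
      case 3
      have "\<bar>(u (line (line y j t) j (- t)) - \<mu>) - (u (line y j t) - \<mu>)\<bar> \<le> C\<^sub>1 * M * (- t)"
        by (rule v_lipschitz[OF near_line[OF y]]) (use t 3 in auto)
      then show ?thesis unfolding line_add using 3 by (simp add: abs_minus_commute)
    qed simp
  qed (use C\<^sub>1_pos \<mu> in auto)
  then show "\<bar>u y - u x\<bar> \<le> ?P * dist x y" by (simp add: C\<^sub>1_def)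
qed

section \<open>Bounds inherited by local uniform limits of solutions\<close>

lemma limit_sol_lipschitz:
  obtains P where "P > 0" "\<And>(U :: real^'n \<Rightarrow> real) x y. limit_sol f M U \<Longrightarrow>
      y \<in> cball x 1 \<Longrightarrow> \<bar>U y - U x\<bar> \<le> P * dist x y"
proof -
  obtain P where P: "P > 0" "\<And>(S :: (real^'n) set) u x y. sol_on f M S u \<Longrightarrow> cball x 12 \<subseteq> S \<Longrightarrow>
      y \<in> cball x 1 \<Longrightarrow> \<bar>u y - u x\<bar> \<le> P * dist x y" by (rule sol_lipschitz) blast
  show ?thesis
  proof (rule that[OF P(1)])
    fix U :: "real^'n \<Rightarrow> real" and x y :: "real^'n"
    assume U: "limit_sol f M U" and y: "y \<in> cball x 1"
    show "\<bar>U y - U x\<bar> \<le> P * dist x y"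
    proof (rule field_le_epsilon)
      fix e :: real assume "e > 0"
      then have "e / 2 > 0" by simp
      from limit_solE[OF U this, of 12 x] obtain S u a where S: "sol_on f M S u" "cball a 12 \<subseteq> S"
        and c: "\<And>y. y \<in> cball 0 12 \<Longrightarrow> \<bar>u (a + y) - U (x + y)\<bar> \<le> e / 2" by blast
      have "dist a (a + (y - x)) = dist x y" by (simp add: dist_norm norm_minus_commute)
      then have "\<bar>u (a + (y - x)) - u a\<bar> \<le> P * dist x y"
        using P(2)[OF S, of "a + (y - x)"] y by simp
      moreover have "\<bar>u (a + (y - x)) - U y\<bar> \<le> e / 2"
        using c[of "y - x"] y by (simp add: dist_norm norm_minus_commute)
      moreover have "\<bar>u a - U x\<bar> \<le> e / 2" using c[of 0] by simp
      ultimately show "\<bar>U y - U x\<bar> \<le> P * dist x y + e" by linarith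
    qed
  qed
qed

lemma limit_sol_continuous:
  assumes U: "limit_sol f M U"
  shows "continuous_on UNIV U"
proof -
  obtain P where P: "P > 0" "\<And>x y. y \<in> cball x 1 \<Longrightarrow> \<bar>U y - U x\<bar> \<le> P * dist x y"
    using U by (metis limit_sol_lipschitz)
  show ?thesis
    unfolding continuous_on_iff
  proof (intro ballI allI impI)
    fix x and e :: real assume e: "e > 0"
    show "\<exists>d>0. \<forall>x'\<in>UNIV. dist x' x < d \<longrightarrow> dist (U x') (U x) < e"
    proof (intro exI[of _ "min 1 (e / P)"] conjI ballI impI)
      fix x' assume d: "dist x' x < min 1 (e / P)"
      then have "dist (U x') (U x) \<le> P * dist x x'"
        using P(2)[of x' x] by (simp add: dist_commute dist_real_def)
      also have "\<dots> < e" using d P(1) by (simp add: dist_commute pos_less_divide_eq mult.commute)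
      finally show "dist (U x') (U x) < e" .
    qed (use e P in auto)
  qed
qed

lemma limit_sol_bounds:
  assumes U: "limit_sol f M U"
  shows "0 \<le> U x \<and> U x \<le> M"
proof -
  have "0 \<le> U x + e \<and> U x \<le> M + e" if "e > 0" for e
  proof -
    from limit_solE[OF U that, of 0 x] obtain S u a where S: "sol_on f M S u" "cball a 0 \<subseteq> S"
      and c: "\<And>y. y \<in> cball 0 0 \<Longrightarrow> \<bar>u (a + y) - U (x + y)\<bar> \<le> e" by blast
    have "0 \<le> u a" "u a \<le> M" using sol_onD[OF S(1), of a] S(2) by auto
    then show ?thesis using c[of 0] by (auto simp: abs_le_iff)
  qed
  then show ?thesis by (meson field_le_epsilon)
qed

text \<open>With \<open>\<sigma> = 1\<close> (\<open>\<sigma> = -1\<close>) the following lemmas concern the infimum (supremum) \<open>m\<close> of \<open>U\<close>,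
  which need not be attained.\<close>

lemma extremum_sign:
  fixes U :: "real^'n \<Rightarrow> real"
  assumes U: "limit_sol f M U" and \<sigma>: "\<sigma> \<in> {1, -1}" and m: "m \<in> {0..M}"
    and ge: "\<And>x. \<sigma> * (U x - m) \<ge> 0" and inf: "\<And>\<epsilon>. \<epsilon> > 0 \<Longrightarrow> \<exists>x. \<sigma> * (U x - m) \<le> \<epsilon>"
  shows "\<sigma> * f m \<le> 0"
proof (rule ccontr)
  assume "\<not> \<sigma> * f m \<le> 0"
  then have q: "\<sigma> * f m > 0" by simp
  \<comment> \<open>The perturbed extremum below yields
    \<open>\<sigma> * f m \<le> (8 * CARD('n) + 2 * L) * \<delta>\<close>; the first part comes from
    the paraboloid, the second from replacing \<open>f (u y)\<close> with
    \<open>f m\<close>.\<close>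
  define A where "A = 8 * real CARD('n) + 2 * L + 1"
  have A: "A > 0" using L by (simp add: A_def add_nonneg_pos)
  define \<delta> where "\<delta> = \<sigma> * f m / (2 * A)"
  have \<delta>: "\<delta> > 0" "A * \<delta> < \<sigma> * f m" using q A by (auto simp: \<delta>_def)
  obtain x where x: "\<sigma> * (U x - m) \<le> \<delta>" using inf[OF \<delta>(1)] by blast
  obtain S u a where S: "sol_on f M S u" "cball a 1 \<subseteq> S"
    and c: "\<And>y. y \<in> cball 0 1 \<Longrightarrow> \<bar>u (a + y) - U (x + y)\<bar> \<le> \<delta>"
    using limit_solE[OF U \<delta>(1), of 1 x] by blast
  have \<sigma>abs: "\<bar>\<sigma> * t\<bar> = \<bar>t\<bar>" for t using \<sigma> by auto
  have ua: "\<sigma> * (u a - m) \<le> 2 * \<delta>"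
    using c[of 0] x \<sigma>abs[of "u a - U x"] by (simp add: algebra_simps)
  have low: "\<sigma> * (u y - m) \<ge> - \<delta>" if "y \<in> cball a 1" for y
    using c[of "y - a"] that ge[of "x + (y - a)"] \<sigma>abs[of "u y - U (x + (y - a))"]
    by (simp add: algebra_simps dist_norm norm_minus_commute)
  \<comment> \<open>The paraboloid forces an extremum into the interior:
    \<open>\<sigma> * (u - m)\<close> is at most \<open>2 * \<delta>\<close> at the centre, but
    after adding \<open>4 * \<delta>\<close> at least \<open>3 * \<delta>\<close> on the unit
    sphere.\<close>
  define p where "p = (\<lambda>y. (- \<sigma>) * u y - 4 * \<delta> * (norm (y - a))\<^sup>2)"
  have "continuous_on (cball a 1) p"
    unfolding p_def
    by (intro continuous_intros continuous_on_subset[OF sol_on_continuous[OF S(1)] S(2)])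
  then obtain y where y: "y \<in> cball a 1" "\<And>z. z \<in> cball a 1 \<Longrightarrow> p z \<le> p y"
    using continuous_attains_sup[of "cball a 1" p] by auto
  have pa: "p a \<le> p y" using y(2)[of a] by simp
  have y1: "y \<in> ball a 1"
  proof (rule ccontr)
    assume "y \<notin> ball a 1"
    with y(1) have "norm (y - a) = 1" by (simp add: dist_norm norm_minus_commute)
    with pa ua low[OF y(1)] \<delta>(1) show False by (simp add: p_def algebra_simps)
  qed
  have yS: "y \<in> S" using y(1) S(2) by auto
  have uy: "\<sigma> * (u y - m) \<le> 2 * \<delta>"
  proof -
    have "0 \<le> 4 * \<delta> * (norm (y - a))\<^sup>2" using \<delta> by simp
    then show ?thesis using pa ua by (simp add: p_def algebra_simps)
  qed
  have "(\<Sum>l\<in>UNIV. (- \<sigma>) * pderiv2_in S l l u y - 4 * \<delta> * 2) \<le> 0"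
  proof (rule line2_interior_max[OF open_ball y1, of p])
    show "second_deriv (\<lambda>s. p (line y l s)) ((- \<sigma>) * pderiv2_in S l l u y - 4 * \<delta> * 2)" for l
      unfolding p_def
      by (intro second_deriv_diff second_deriv_cmult second_deriv_norm_sq line2D[OF sol_onD(3)[OF S(1) yS]])
  qed (use y(2) in auto)
  then have "(- \<sigma>) * (\<Sum>l\<in>UNIV. pderiv2_in S l l u y) \<le> 8 * CARD('n) * \<delta>"
    by (simp add: sum_subtractf sum_distrib_left sum_negf)
  then have "\<sigma> * f (u y) \<le> 8 * CARD('n) * \<delta>" using sol_onD(4)[OF S(1) yS] by simp
  moreover have "\<bar>f (u y) - f m\<bar> \<le> L * (2 * \<delta>)"
  proof -
    have "\<bar>u y - m\<bar> \<le> 2 * \<delta>" using uy low[OF y(1)] \<sigma>abs[of "u y - m"] \<delta> by linarith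
    then have "L * \<bar>u y - m\<bar> \<le> L * (2 * \<delta>)" using L by (rule mult_left_mono)
    moreover have "\<bar>f (u y) - f m\<bar> \<le> L * \<bar>u y - m\<bar>"
      by (rule lip) (use sol_onD[OF S(1) yS] m in auto)
    ultimately show ?thesis by linarith
  qed
  then have "\<sigma> * f m \<le> \<sigma> * f (u y) + 2 * L * \<delta>"
    using \<sigma>abs[of "f (u y) - f m"] by (simp add: algebra_simps)
  ultimately have "\<sigma> * f m \<le> (8 * CARD('n) + 2 * L) * \<delta>" by (simp add: algebra_simps)
  also have "\<dots> \<le> A * \<delta>" using \<delta> by (intro mult_right_mono) (auto simp: A_def)
  finally show False using \<delta> by simp
qed

text \<open>The strong minimum principle is applied to an approximating solution, lifted by the
  approximation error \<open>d\<close> so that it stays nonnegative. Because \<open>f m = 0\<close>,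
  the Laplacian of the lifted function \<open>v\<close> is at most \<open>L * (v + d)\<close>, and
  \<open>d\<close> is small enough for the excess to be tolerated.\<close>

lemma flat_near_extremum:
  fixes U :: "real^'n \<Rightarrow> real"
  assumes U: "limit_sol f M U" and \<sigma>: "\<sigma> \<in> {1, -1}" and m: "m \<in> {0..M}" "f m = 0"
    and ge: "\<And>x. \<sigma> * (U x - m) \<ge> 0" and \<eta>: "\<eta> > 0" and R: "R \<ge> 1"
  shows "\<exists>\<epsilon>>0. \<forall>x. \<sigma> * (U x - m) \<le> \<epsilon> \<longrightarrow> (\<forall>y\<in>cball x R. \<sigma> * (U y - m) \<le> \<eta>)"
proof -
  obtain P where P: "P > 0" "\<And>(S :: (real^'n) set) u x y. sol_on f M S u \<Longrightarrow> cball x 12 \<subseteq> S \<Longrightarrow>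
      y \<in> cball x 1 \<Longrightarrow> \<bar>u y - u x\<bar> \<le> P * dist x y" by (rule sol_lipschitz) blast
  have "\<eta> / 2 > 0" using \<eta> by simp
  from uniform_strong_minimum_principle[OF this R L P(1), where 'n='n]
  obtain e where e: "e > 0" and smp: "\<And>(v :: real^'n \<Rightarrow> real) H x y. continuous_on (cball x (3 * R)) v \<Longrightarrow>
       (\<And>y. y \<in> cball x (3 * R) \<Longrightarrow> line2 v H y \<and> 0 \<le> v y \<and> (\<Sum>l\<in>UNIV. H l y) \<le> L * v y + e) \<Longrightarrow>
       (\<And>y z. y \<in> cball x R \<Longrightarrow> z \<in> cball y 1 \<Longrightarrow> \<bar>v z - v y\<bar> \<le> P * dist y z) \<Longrightarrow>
       v x \<le> e \<Longrightarrow> y \<in> cball x R \<Longrightarrow> v y \<le> \<eta> / 2"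
    by blast
  define d where "d = min (e / (4 * (L + 1))) (\<eta> / 2)"
  have d: "d > 0" "d \<le> \<eta> / 2" "(L + 1) * d \<le> e / 4"
  proof -
    have d1: "d \<le> e / (4 * (L + 1))" "d \<le> \<eta> / 2"
      unfolding d_def by (rule min.cobounded1, rule min.cobounded2)
    show "d > 0" using e \<eta> L by (simp add: d_def)
    show "d \<le> \<eta> / 2" by (rule d1)
    have "(L + 1) * d \<le> (L + 1) * (e / (4 * (L + 1)))" using L d1 by (intro mult_left_mono) auto
    also have "\<dots> = e / 4" using L by (simp add: field_simps)
    finally show "(L + 1) * d \<le> e / 4" .
  qed
  have Ld: "L * d \<le> e / 4" "d \<le> e / 4"
  proof -
    have "0 \<le> L * d" "(L + 1) * d = L * d + d" using L d by (simp_all add: algebra_simps)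
    with d show "L * d \<le> e / 4" "d \<le> e / 4" by linarith+
  qed
  have \<sigma>abs: "\<bar>\<sigma> * t\<bar> = \<bar>t\<bar>" for t using \<sigma> by auto
  show ?thesis
  proof (intro exI[of _ "e / 4"] conjI allI impI ballI)
    show "e / 4 > 0" using e by simp
    fix x y assume x: "\<sigma> * (U x - m) \<le> e / 4" and y: "y \<in> cball x R"
    obtain S u a where S: "sol_on f M S u" "cball a (3 * R + 12) \<subseteq> S"
      and c: "\<And>y. y \<in> cball 0 (3 * R + 12) \<Longrightarrow> \<bar>u (a + y) - U (x + y)\<bar> \<le> d"
      using limit_solE[OF U d(1), of "3 * R + 12" x] by blast
    define v where "v = (\<lambda>y. \<sigma> * u y - (\<sigma> * m - d))"
    define H where "H = (\<lambda>l y. \<sigma> * pderiv2_in S l l u y - 0)"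
    have sub: "cball a (3 * R) \<subseteq> S" using S(2) subset_cball[of "3 * R" "3 * R + 12" a] by auto
    have near: "\<bar>v (a + z) - d - \<sigma> * (U (x + z) - m)\<bar> \<le> d" if "z \<in> cball 0 (3 * R + 12)" for z
      using c[OF that] \<sigma>abs[of "u (a + z) - U (x + z)"] by (simp add: v_def algebra_simps)
    have "v (a + (y - x)) \<le> \<eta> / 2"
    proof (rule smp[of a v H])
      show "continuous_on (cball a (3 * R)) v"
        unfolding v_def
        by (intro continuous_intros continuous_on_subset[OF sol_on_continuous[OF S(1)] sub])
      show "line2 v H z \<and> 0 \<le> v z \<and> (\<Sum>l\<in>UNIV. H l z) \<le> L * v z + e" if z: "z \<in> cball a (3 * R)" for z
      proof (intro conjI)
        have zS: "z \<in> S" using z sub by blast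
        show "line2 v H z"
          unfolding line2_def v_def H_def
          by (intro allI second_deriv_diff second_deriv_cmult second_deriv_const line2D[OF sol_onD(3)[OF S(1) zS]])
        show v0: "0 \<le> v z"
          using near[of "z - a"] z ge[of "x + (z - a)"] by (simp add: dist_norm norm_minus_commute)
        have "(\<Sum>l\<in>UNIV. H l z) = - (\<sigma> * (f (u z) - f m))"
          using sol_onD(4)[OF S(1) zS] by (simp add: H_def m sum_distrib_left[symmetric])
        also have "\<dots> \<le> \<bar>f (u z) - f m\<bar>" using \<sigma>abs[of "f (u z) - f m"] by linarith
        also have "\<dots> \<le> L * \<bar>u z - m\<bar>" by (rule lip) (use sol_onD[OF S(1) zS] m in auto)
        also have "\<dots> \<le> L * (v z + d)"
        proof (rule mult_left_mono[OF _ L])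
          have "\<sigma> * (u z - m) = v z - d" by (simp add: v_def algebra_simps)
          then show "\<bar>u z - m\<bar> \<le> v z + d" using \<sigma>abs[of "u z - m"] v0 d by linarith
        qed
        also have "\<dots> \<le> L * v z + e" using Ld e by (simp add: algebra_simps)
        finally show "(\<Sum>l\<in>UNIV. H l z) \<le> L * v z + e" .
      qed
      show "\<bar>v z' - v z\<bar> \<le> P * dist z z'" if z: "z \<in> cball a R" "z' \<in> cball z 1" for z z'
      proof -
        have "cball z 12 \<subseteq> cball a (3 * R + 12)"
          using z(1) R dist_triangle[of a _ z] by (force intro: order_trans)
        then have "cball z 12 \<subseteq> S" using S(2) by blast
        from P(2)[OF S(1) this z(2)] show ?thesis
          using \<sigma>abs[of "u z' - u z"] by (simp add: v_def algebra_simps)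
      qed
      show "v a \<le> e" using near[of 0] x Ld R by simp
      show "a + (y - x) \<in> cball a R" using y by (simp add: dist_norm norm_minus_commute)
    qed
    then show "\<sigma> * (U y - m) \<le> \<eta>"
      using near[of "y - x"] y d R by (simp add: dist_norm norm_minus_commute)
  qed
qed

text \<open>If \<open>U\<close> avoided \<open>m\<close>, near-flatness would provide a ball of
  radius \<open>R\<close> on which \<open>\<sigma> * (U - m)\<close> is positive but at most half of
  \<delta>. There an approximating solution would give a positive supersolution of Laplace w + c w =
  0, which a ball of this radius does not admit. So \<open>m\<close> is attained, and near-flatness
  around that point on balls of arbitrary radius makes \<open>U\<close> constant.\<close>

lemma hair_trigger:
  fixes U :: "real^'n \<Rightarrow> real"
  assumes U: "limit_sol f M U" and \<sigma>: "\<sigma> \<in> {1, -1}" and m: "m \<in> {0..M}" "f m = 0"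
    and ge: "\<And>x. \<sigma> * (U x - m) \<ge> 0" and inf: "\<And>\<epsilon>. \<epsilon> > 0 \<Longrightarrow> \<exists>x. \<sigma> * (U x - m) \<le> \<epsilon>"
    and c: "c > 0" and \<delta>: "\<delta> > 0"
    and grow: "\<And>s. 0 < s \<Longrightarrow> s < \<delta> \<Longrightarrow> c * s \<le> \<sigma> * f (m + \<sigma> * s)"
  shows "U x = m"
proof -
  have \<sigma>abs: "\<bar>\<sigma> * t\<bar> = \<bar>t\<bar>" for t using \<sigma> by auto
  have \<sigma>\<sigma>: "\<sigma> * (\<sigma> * t) = t" for t using \<sigma> by auto
  have "\<exists>x. U x = m"
  proof (rule ccontr)
    assume "\<nexists>x. U x = m"
    then have gt: "\<sigma> * (U x - m) > 0" for x
      using ge[of x] \<sigma> by (metis insertE less_eq_real_def mult_eq_0_iff right_minus_eq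
          singletonD zero_neq_neg_one zero_neq_one)
    \<comment> \<open>The integer 5 replaces the square root of 32: the choice gives
      \<open>25 * c * R^2 \<ge> (4 * CARD('n) + 9)^2\<close>, and both the passage from 25 to 32 and
      that from 9 to 8 leave slack.\<close>
    define R where "R = max 1 ((4 * CARD('n) + 9) / (5 * sqrt c))"
    have R: "R \<ge> 1" by (simp add: R_def)
    have cR: "(4 * CARD('n) + 8)\<^sup>2 < 32 * c * R\<^sup>2"
    proof -
      have "(4 * CARD('n) + 9) / 5 \<le> sqrt c * R"
        using c by (simp add: R_def field_simps max_def)
      then have "((4 * CARD('n) + 9) / 5)\<^sup>2 \<le> (sqrt c * R)\<^sup>2" by (intro power_mono) auto
      then have "(4 * real CARD('n) + 9)\<^sup>2 \<le> 25 * (c * R\<^sup>2)"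
        using c by (simp add: power_mult_distrib power_divide)
      moreover have "(4 * real CARD('n) + 8)\<^sup>2 < (4 * real CARD('n) + 9)\<^sup>2"
        by (intro power_strict_mono) auto
      moreover have "0 \<le> c * R\<^sup>2" using c by simp
      ultimately show ?thesis by simp
    qed
    have "\<delta> / 2 > 0" using \<delta> by simp
    from flat_near_extremum[OF U \<sigma> m ge this R] obtain e where e: "e > 0"
      "\<And>x y. \<sigma> * (U x - m) \<le> e \<Longrightarrow> y \<in> cball x R \<Longrightarrow> \<sigma> * (U y - m) \<le> \<delta> / 2" by blast
    obtain x where x: "\<sigma> * (U x - m) \<le> e" using inf[OF e(1)] by blast
    have "continuous_on (cball x R) (\<lambda>y. \<sigma> * (U y - m))"
      by (intro continuous_intros continuous_on_subset[OF limit_sol_continuous[OF U]]) auto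
    then obtain y0 where y0: "y0 \<in> cball x R"
      "\<And>y. y \<in> cball x R \<Longrightarrow> \<sigma> * (U y0 - m) \<le> \<sigma> * (U y - m)"
      using continuous_attains_inf[of "cball x R" "\<lambda>y. \<sigma> * (U y - m)"] R by auto
    \<comment> \<open>Half of the attained minimum keeps the approximant on the correct side of
      \<open>m\<close>; the bound \<open>\<delta> / 4\<close>, added to \<open>\<delta> / 2\<close>,
      keeps it in the range where \<open>grow\<close> applies.\<close>
    define d where "d = min (\<sigma> * (U y0 - m) / 2) (\<delta> / 4)"
    have d: "d > 0" using gt[of y0] \<delta> by (simp add: d_def)
    obtain S u a where S: "sol_on f M S u" "cball a R \<subseteq> S"
      and cl: "\<And>y. y \<in> cball 0 R \<Longrightarrow> \<bar>u (a + y) - U (x + y)\<bar> \<le> d"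
      using limit_solE[OF U d, of R x] by blast
    define w where "w = (\<lambda>y. \<sigma> * u y - \<sigma> * m)"
    have w: "0 < w y \<and> w y < \<delta>" if y: "y \<in> cball a R" for y
    proof -
      have xy: "x + (y - a) \<in> cball x R" using y by (simp add: dist_norm norm_minus_commute)
      have "\<bar>u y - U (x + (y - a))\<bar> \<le> d"
        using cl[of "y - a"] y by (simp add: dist_norm norm_minus_commute)
      then have "\<bar>w y - \<sigma> * (U (x + (y - a)) - m)\<bar> \<le> d"
        using \<sigma>abs[of "u y - U (x + (y - a))"] by (simp add: w_def algebra_simps)
      moreover have "d \<le> \<sigma> * (U y0 - m) / 2" "d \<le> \<delta> / 4" by (auto simp: d_def)
      ultimately show ?thesis
        using y0(2)[OF xy] e(2)[OF x xy] gt[of y0] \<delta> by linarith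
    qed
    show False
    proof (rule no_positive_supersolution[OF _ _ _ _ _ c cR])
      show "continuous_on (cball a R) w"
        unfolding w_def
        by (intro continuous_intros continuous_on_subset[OF sol_on_continuous[OF S(1)] S(2)])
      show "line2 w (\<lambda>l y. \<sigma> * pderiv2_in S l l u y - 0) y" if "y \<in> ball a R" for y
      proof -
        have yS: "y \<in> S" using that S(2) by auto
        show ?thesis
          unfolding line2_def w_def
          by (intro allI second_deriv_diff second_deriv_cmult second_deriv_const line2D[OF sol_onD(3)[OF S(1) yS]])
      qed
      show "(\<Sum>l\<in>UNIV. \<sigma> * pderiv2_in S l l u y - 0) \<le> - c * w y" if "y \<in> ball a R" for y
      proof -
        have yR: "y \<in> cball a R" and yS: "y \<in> S" using that S(2) by auto
        have "m + \<sigma> * w y = u y" by (simp add: w_def right_diff_distrib \<sigma>\<sigma>)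
        then have "c * w y \<le> \<sigma> * f (u y)" using grow[of "w y"] w[OF yR] by simp
        then show ?thesis using sol_onD(4)[OF S(1) yS] by (simp add: sum_distrib_left[symmetric])
      qed
    qed (use w R in auto)
  qed
  then obtain x0 where x0: "U x0 = m" by blast
  have "\<sigma> * (U x - m) \<le> 0"
  proof (rule field_le_epsilon)
    fix e :: real assume "e > 0"
    have R: "dist x0 x + 1 \<ge> 1" by simp
    from flat_near_extremum[OF U \<sigma> m ge \<open>e > 0\<close> R] obtain \<epsilon> where "\<epsilon> > 0"
      "\<And>x' y. \<sigma> * (U x' - m) \<le> \<epsilon> \<Longrightarrow> y \<in> cball x' (dist x0 x + 1) \<Longrightarrow> \<sigma> * (U y - m) \<le> e" by blast
    from this(2)[of x0 x] this(1) x0 show "\<sigma> * (U x - m) \<le> 0 + e" by simp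
  qed
  with ge[of x] \<sigma> show ?thesis by auto
qed

text \<open>Growth is available at 0 only from above and at zeros larger than \<mu> only from below,
  so the first case has to use the infimum and the second the supremum. When
  \<open>m \<ge> \<mu>\<close>, the sign of \<open>f\<close> on this range turns
  \<open>f m' \<ge> 0\<close> into equality.\<close>

lemma liouville:
  fixes U :: "real^'n \<Rightarrow> real"
  assumes U: "limit_sol f M U"
  shows "\<exists>z\<in>{0..M}. f z = 0 \<and> (\<forall>x. U x = z)"
proof -
  have b: "0 \<le> U x" "U x \<le> M" for x using limit_sol_bounds[OF U] by auto
  have bdd: "bdd_below (range U)" "bdd_above (range U)"
    using b by (auto intro!: bdd_belowI[of _ 0] bdd_aboveI[of _ M])
  define m where "m = Inf (range U)"
  define m' where "m' = Sup (range U)"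
  have m: "m \<le> U x" "U x \<le> m'" for x
    unfolding m_def m'_def using bdd by (auto intro: cInf_lower cSup_upper)
  have m0: "0 \<le> m" unfolding m_def by (rule cInf_greatest) (use b in auto)
  have m'M: "m' \<le> M" unfolding m'_def by (rule cSup_least) (use b in auto)
  have mM: "m \<in> {0..M}" "m' \<in> {0..M}" using m0 m'M m[of 0] b[of 0] by auto
  have inf: "\<exists>x. 1 * (U x - m) \<le> e" if "e > 0" for e
  proof -
    have "\<exists>x\<in>range U. x < m + e" unfolding m_def by (rule cInf_lessD) (use that in \<open>auto simp: m_def\<close>)
    then obtain x where "U x < m + e" by auto
    then show ?thesis by (intro exI[of _ x]) simp
  qed
  have sup: "\<exists>x. -1 * (U x - m') \<le> e" if "e > 0" for e
  proof -
    have "\<exists>x\<in>range U. m' - e < x" unfolding m'_def by (rule less_cSupD) (use that in \<open>auto simp: m'_def\<close>)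
    then obtain x where "m' - e < U x" by auto
    then show ?thesis by (intro exI[of _ x]) simp
  qed
  have fm: "f m \<le> 0" using extremum_sign[OF U _ mM(1) _ inf] m by simp
  have fm': "f m' \<ge> 0" using extremum_sign[OF U _ mM(2) _ sup] m by simp
  show ?thesis
  proof (cases "m < \<mu>")
    case True
    then have "m = 0" using f_pos[of m] fm m0 by fastforce
    then have "\<not> f 0 > 0" using fm by simp
    then obtain c \<delta> where c: "f 0 = 0" "c > 0" "\<delta> > 0" "\<And>s. 0 < s \<Longrightarrow> s < \<delta> \<Longrightarrow> c * s \<le> f s"
      using f_zero by blast
    have "U x = m" for x
      by (rule hair_trigger[OF U _ mM(1) _ _ inf c(2,3)]) (use m c \<open>m = 0\<close> in auto)
    then show ?thesis using c mM \<open>m = 0\<close> by blast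
  next
    case False
    then have "m' \<ge> \<mu>" using m[of 0] by simp
    then have fm'0: "f m' = 0" using fm' f_nonpos[of m'] by simp
    show ?thesis
    proof (cases "m' = \<mu>")
      case True
      have "U x = \<mu>" for x using m[of x] False True by simp
      then show ?thesis using f_\<mu> \<mu> by auto
    next
      case ne: False
      then obtain c \<delta> where c: "c > 0" "\<delta> > 0"
        "\<And>s. m' - \<delta> < s \<Longrightarrow> s < m' \<Longrightarrow> f s \<le> - c * (m' - s)"
        using f_left[of m'] \<open>m' \<ge> \<mu>\<close> fm'0 by force
      have "U x = m'" for x
      proof (rule hair_trigger[OF U _ mM(2) fm'0 _ sup c(1,2)])
        show "c * s \<le> -1 * f (m' + -1 * s)" if "0 < s" "s < \<delta>" for s
          using c(3)[of "m' - s"] that by simp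
      qed (use m in auto)
      then show ?thesis using fm'0 mM by blast
    qed
  qed
qed

end

section \<open>Compactness\<close>

lemma cball_translate_subset:
  fixes a y :: "'a::real_normed_vector"
  assumes "norm y + r \<le> R"
  shows "cball (a + y) r \<subseteq> cball a R"
proof
  fix p assume "p \<in> cball (a + y) r"
  moreover have "dist a p \<le> dist a (a + y) + dist (a + y) p" by (rule dist_triangle)
  moreover have "dist a (a + y) = norm y" by (simp add: dist_norm)
  ultimately show "p \<in> cball a R" using assms by simp
qed

lemma finite_ball_cover:
  assumes "compact K" "e > 0"
  shows "\<exists>T. finite T \<and> K \<subseteq> (\<Union>t\<in>T. ball t e)"
  using assms unfolding compact_eq_totally_bounded by simp

context nonlinearity
begin

text \<open>An Arzela-Ascoli argument: a diagonal subsequence converges on a countable dense set,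
  the common Lipschitz bound extends this to every point, and finite nets make it locally uniform.
  The limit is a constant by the Liouville theorem, so no equation has to be passed to the
  limit.\<close>

lemma compactness:
  fixes S :: "nat \<Rightarrow> (real^'n) set" and u :: "nat \<Rightarrow> real^'n \<Rightarrow> real" and a :: "nat \<Rightarrow> real^'n"
  assumes sol: "\<And>n. sol_on f M (S n) (u n)" and sub: "\<And>n. cball (a n) (real n) \<subseteq> S n"
  obtains r z where "strict_mono r" "z \<in> {0..M}" "f z = 0"
    "\<And>R \<epsilon>. \<epsilon> > 0 \<Longrightarrow> \<forall>\<^sub>F n in sequentially. \<forall>y\<in>cball 0 R. \<bar>u (r n) (a (r n) + y) - z\<bar> \<le> \<epsilon>"
proof -
  obtain P where P: "P > 0" "\<And>(S :: (real^'n) set) u x y. sol_on f M S u \<Longrightarrow> cball x 12 \<subseteq> S \<Longrightarrow>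
      y \<in> cball x 1 \<Longrightarrow> \<bar>u y - u x\<bar> \<le> P * dist x y" by (rule sol_lipschitz) blast
  \<comment> \<open>Recentring at \<open>a n\<close> puts all solutions on a common domain. The
    default 0 outside the ball keeps the sequence bounded on the whole space; each fixed point
    eventually lies inside.\<close>
  define W where "W = (\<lambda>n y. if y \<in> cball 0 (real n) then u n (a n + y) else 0)"
  have W_eq: "W n y = u n (a n + y)" if "norm y \<le> real n" for n y using that by (simp add: W_def)
  have W_bd: "norm (W n y) \<le> M" for n y
  proof (cases "norm y \<le> real n")
    case True
    then have "a n + y \<in> S n" using sub[of n] by (auto simp: dist_norm)
    from sol_onD(1,2)[OF sol this] show ?thesis by (simp add: W_eq[OF True])
  next
    case False
    then have "W n y = 0" by (simp add: W_def)
    then show ?thesis using \<mu> by simp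
  qed
  have W_lip: "\<bar>W n z - W n y\<bar> \<le> P * dist y z" if n: "norm y + 12 \<le> real n" and z: "z \<in> cball y 1" for n y z
  proof -
    have "norm (z - y) \<le> 1" using z by (simp add: dist_norm norm_minus_commute)
    then have zn: "norm z \<le> norm y + 1" using norm_triangle_sub[of z y] by linarith
    have "cball (a n + y) 12 \<subseteq> cball (a n) (real n)" by (rule cball_translate_subset[OF n])
    then have "cball (a n + y) 12 \<subseteq> S n" using sub[of n] by blast
    from P(2)[OF sol this, of "a n + z"] show ?thesis
      using W_eq[of y n] W_eq[of z n] n zn z by simp
  qed
  obtain D :: "(real^'n) set" where D: "countable D"
    "\<And>X. open X \<Longrightarrow> X \<noteq> {} \<Longrightarrow> \<exists>d\<in>D. d \<in> X"
    by (rule countable_dense_setE) blast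
  obtain k where k: "strict_mono (k::nat\<Rightarrow>nat)" "\<And>x. x \<in> D \<Longrightarrow> \<exists>l. (\<lambda>n. W (k n) x) \<longlonglongrightarrow> l"
    using function_convergent_subsequence[OF D(1), of W M] W_bd by blast
  have kn: "real n \<le> real (k n)" for n using seq_suble[OF k(1), of n] by simp
  have evk: "\<forall>\<^sub>F n in sequentially. B \<le> real (k n)" for B :: real
  proof -
    obtain n0 :: nat where "B \<le> real n0" using real_arch_simple by blast
    then show ?thesis
      using kn by (intro eventually_sequentiallyI[of n0]) (meson of_nat_le_iff order_trans)
  qed
  have small_step: "\<exists>\<delta>. \<delta> \<le> 1 \<and> \<delta> > 0 \<and> P * \<delta> \<le> e / 4" if "e > 0" for e
  proof (intro exI[of _ "min 1 (e / (4 * P))"] conjI)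
    have "P * min 1 (e / (4 * P)) \<le> P * (e / (4 * P))"
      using P(1) by (intro mult_left_mono min.cobounded2) auto
    then show "P * min 1 (e / (4 * P)) \<le> e / 4" using P(1) by simp
  qed (use that P(1) in auto)
  have conv: "\<exists>l. (\<lambda>n. W (k n) y) \<longlonglongrightarrow> l" for y
  proof -
    have "Cauchy (\<lambda>n. W (k n) y)"
      unfolding Cauchy_def
    proof (intro allI impI)
      fix e :: real assume e: "e > 0"
      obtain \<delta> where \<delta>1: "\<delta> \<le> 1" and \<delta>: "\<delta> > 0" "P * \<delta> \<le> e / 4"
        using small_step[OF e] by blast
      obtain d where d: "d \<in> D" "d \<in> ball y \<delta>" using D(2)[of "ball y \<delta>"] \<delta> by auto
      have "Cauchy (\<lambda>n. W (k n) d)" using k(2)[OF d(1)] LIMSEQ_imp_Cauchy by blast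
      then obtain n1 where n1: "\<And>m n. m \<ge> n1 \<Longrightarrow> n \<ge> n1 \<Longrightarrow> \<bar>W (k m) d - W (k n) d\<bar> < e / 2"
        using e unfolding Cauchy_def dist_real_def by (meson half_gt_zero)
      obtain n2 where n2: "\<And>n. n \<ge> n2 \<Longrightarrow> norm y + 12 \<le> real (k n)"
        using evk unfolding eventually_sequentially by blast
      have near: "\<bar>W (k n) d - W (k n) y\<bar> \<le> e / 4" if "n \<ge> n2" for n
      proof -
        have "\<bar>W (k n) d - W (k n) y\<bar> \<le> P * dist y d" by (rule W_lip[OF n2[OF that]]) (use d \<delta>1 in auto)
        also have "\<dots> \<le> P * \<delta>" using d P(1) by (intro mult_left_mono) auto
        finally show ?thesis using \<delta> by simp
      qed
      have "dist (W (k m) y) (W (k n) y) < e" if "m \<ge> max n1 n2" "n \<ge> max n1 n2" for m n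
      proof -
        have "m \<ge> n1" "n \<ge> n1" "m \<ge> n2" "n \<ge> n2" using that by auto
        from n1[OF this(1,2)] near[OF this(3)] near[OF this(4)] show ?thesis
          unfolding dist_real_def abs_less_iff abs_le_iff by linarith
      qed
      then show "\<exists>N. \<forall>m\<ge>N. \<forall>n\<ge>N. dist (W (k m) y) (W (k n) y) < e" by blast
    qed
    then show ?thesis by (simp add: Cauchy_convergent_iff convergent_def)
  qed
  define U where "U = (\<lambda>y. lim (\<lambda>n. W (k n) y))"
  have U: "(\<lambda>n. W (k n) y) \<longlonglongrightarrow> U y" for y
    using conv[of y] by (simp add: U_def convergent_LIMSEQ_iff[symmetric] convergent_def)
  have U_lip: "\<bar>U z - U y\<bar> \<le> P * dist y z" if "z \<in> cball y 1" for y z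
    by (rule tendsto_upperbound[OF tendsto_rabs[OF tendsto_diff[OF U U]]])
       (use that in \<open>auto intro!: eventually_mono[OF evk[of "norm y + 12"]] W_lip\<close>)
  have unif: "\<forall>\<^sub>F n in sequentially. \<forall>y\<in>cball 0 R. \<bar>W (k n) y - U y\<bar> \<le> e" if e: "e > 0" for R e
  proof -
    obtain \<delta> where \<delta>1: "\<delta> \<le> 1" and \<delta>: "\<delta> > 0" "P * \<delta> \<le> e / 4"
      using small_step[OF e] by blast
    obtain T :: "(real^'n) set" where T: "finite T" "cball 0 R \<subseteq> (\<Union>t\<in>T. ball t \<delta>)"
      using finite_ball_cover[OF compact_cball[of "0 :: real^'n" R] \<delta>(1)] by blast
    have "\<forall>\<^sub>F n in sequentially. \<forall>t\<in>T. \<bar>W (k n) t - U t\<bar> \<le> e / 2 \<and> norm t + 12 \<le> real (k n)"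
    proof (intro eventually_ball_finite[OF T(1)] ballI eventually_conj evk)
      fix t
      have "\<forall>\<^sub>F n in sequentially. dist (W (k n) t) (U t) < e / 2"
        using tendstoD[OF U, of "e / 2" t] e by simp
      then show "\<forall>\<^sub>F n in sequentially. \<bar>W (k n) t - U t\<bar> \<le> e / 2"
        by eventually_elim (simp add: dist_real_def)
    qed
    then show ?thesis
    proof eventually_elim
      case (elim n)
      show ?case
      proof
        fix y :: "real^'n" assume "y \<in> cball 0 R"
        then obtain t where t: "t \<in> T" "y \<in> ball t \<delta>" using T(2) by blast
        have y1: "y \<in> cball t 1" using t(2) \<delta>1 by simp
        have Pd: "P * dist t y \<le> e / 4"
          by (rule order_trans[OF mult_left_mono \<delta>(2)]) (use t(2) P(1) in auto)
        have "\<bar>W (k n) y - W (k n) t\<bar> \<le> e / 4" "\<bar>U y - U t\<bar> \<le> e / 4"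
          using order_trans[OF W_lip[OF _ y1] Pd] order_trans[OF U_lip[OF y1] Pd] elim t(1) by blast+
        moreover have "\<bar>W (k n) t - U t\<bar> \<le> e / 2" using elim t(1) by blast
        ultimately show "\<bar>W (k n) y - U y\<bar> \<le> e" unfolding abs_le_iff by linarith
      qed
    qed
  qed
  \<comment> \<open>The recentred solutions themselves are the required approximants. To see a ball
    about \<open>x\<close> they must be close on the ball of radius \<open>norm x + R\<close> about
    the origin.\<close>
  have "limit_sol f M U"
    unfolding limit_sol_def
  proof (intro allI impI)
    fix x :: "real^'n" and R e :: real assume e: "e > 0"
    have "\<forall>\<^sub>F n in sequentially. (\<forall>y\<in>cball 0 (norm x + R). \<bar>W (k n) y - U y\<bar> \<le> e) \<and> norm x + R \<le> real (k n)"
      using unif[OF e] evk by (rule eventually_conj)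
    then obtain n where n: "\<And>y. y \<in> cball 0 (norm x + R) \<Longrightarrow> \<bar>W (k n) y - U y\<bar> \<le> e"
      "norm x + R \<le> real (k n)"
      using eventually_happens'[OF sequentially_bot] by blast
    show "\<exists>S u a. sol_on f M S u \<and> cball a R \<subseteq> S \<and> (\<forall>y\<in>cball 0 R. \<bar>u (a + y) - U (x + y)\<bar> \<le> e)"
    proof (intro exI conjI ballI)
      show "sol_on f M (S (k n)) (u (k n))" by (rule sol)
      have "cball (a (k n) + x) R \<subseteq> cball (a (k n)) (real (k n))"
        by (rule cball_translate_subset[OF n(2)])
      then show "cball (a (k n) + x) R \<subseteq> S (k n)" using sub by blast
      fix y :: "real^'n" assume "y \<in> cball 0 R"
      then have "norm (x + y) \<le> norm x + R" using norm_triangle_ineq[of x y] by simp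
      then show "\<bar>u (k n) (a (k n) + x + y) - U (x + y)\<bar> \<le> e"
        using n(1)[of "x + y"] W_eq[OF order_trans[OF _ n(2)], of "x + y"] by (simp add: add.assoc)
    qed
  qed
  from liouville[OF this] obtain z where z: "z \<in> {0..M}" "f z = 0" "\<And>x. U x = z" by blast
  show ?thesis
  proof (rule that[OF k(1) z(1,2)])
    fix R e :: real assume e: "e > 0"
    show "\<forall>\<^sub>F n in sequentially. \<forall>y\<in>cball 0 R. \<bar>u (k n) (a (k n) + y) - z\<bar> \<le> e"
      using unif[OF e, of R] evk[of R]
    proof eventually_elim
      case (elim n)
      show ?case
      proof
        fix y :: "real^'n" assume y: "y \<in> cball 0 R"
        then have "norm y \<le> real (k n)" using elim(2) by simp
        from bspec[OF elim(1) y] show "\<bar>u (k n) (a (k n) + y) - z\<bar> \<le> e"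
          by (simp only: W_eq[OF \<open>norm y \<le> real (k n)\<close>] z(3))
      qed
    qed
  qed
qed

end

section \<open>Derivatives within half-spaces\<close>

text \<open>On such sets the derivative within the set is unique, which makes \<open>frechet_derivative\<close>
  meaningful.\<close>

definition axis_thick :: "(real^'n) set \<Rightarrow> bool" where
  "axis_thick F \<longleftrightarrow> (\<forall>x\<in>F. \<forall>i. \<forall>e>0. \<exists>d. 0 < \<bar>d\<bar> \<and> \<bar>d\<bar> < e \<and> line x i d \<in> F)"

lemma open_axis_thick:
  assumes "open F"
  shows "axis_thick F"
  unfolding axis_thick_def
proof (intro ballI allI impI)
  fix x i and e :: real assume x: "x \<in> F" and e: "e > 0"
  obtain r where r: "r > 0" "cball x r \<subseteq> F" using assms x open_contains_cball by blast
  define d where "d = min (e / 2) r"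
  have d: "d > 0" "d \<le> e / 2" "d \<le> r" using e r by (auto simp: d_def)
  have "line x i d \<in> cball x r" using d by simp
  then have "line x i d \<in> F" using r by blast
  then show "\<exists>d. 0 < \<bar>d\<bar> \<and> \<bar>d\<bar> < e \<and> line x i d \<in> F"
    using d e by (intro exI[of _ d]) auto
qed

lemma closure_half_space: "closure (half_space k) = {x. 0 \<le> x $ k}"
  using closure_halfspace_component_gt[of 0 k] by (simp add: half_space_def)

lemma open_half_space: "open (half_space k)"
  unfolding half_space_def by (rule open_halfspace_component_gt_cart)

lemma half_space_axis_thick: "axis_thick (closure (half_space k) :: (real^'n) set)"
  unfolding axis_thick_def
proof (intro ballI allI impI)
  fix x :: "real^'n" and i and e :: real
  assume x: "x \<in> closure (half_space k)" and e: "e > 0"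
  show "\<exists>d. 0 < \<bar>d\<bar> \<and> \<bar>d\<bar> < e \<and> line x i d \<in> closure (half_space k)"
    \<comment> \<open>Positive steps suffice: increasing a coordinate never leaves the half-space,
      even from a boundary point.\<close>
    by (rule exI[of _ "e / 2"]) (use x e in \<open>auto simp: closure_half_space axis_def\<close>)
qed

lemma frechet_derivative_unique_axis_thick:
  fixes w :: "real^'n \<Rightarrow> real"
  assumes F: "axis_thick F" "x \<in> F" and D: "(w has_derivative D) (at x within F)"
  shows "frechet_derivative w (at x within F) = D"
proof (rule frechet_derivative_unique_within[OF _ D])
  show "(w has_derivative frechet_derivative w (at x within F)) (at x within F)"
    using D by (simp add: frechet_derivative_works[symmetric] differentiableI)
  fix i :: "real^'n" and e :: real assume "i \<in> Basis" "e > 0"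
  then obtain l where "i = axis l 1" by (auto simp: Basis_vec_def)
  then show "\<exists>d. 0 < \<bar>d\<bar> \<and> \<bar>d\<bar> < e \<and> x + d *\<^sub>R i \<in> F"
    using F \<open>e > 0\<close> unfolding axis_thick_def by blast
qed

text \<open>This reads derivatives within \<open>F\<close>, including those at boundary points, off
  ordinary derivatives of \<open>u\<close> in an open set. Agreement is required on \<open>F\<close>
  only, since \<open>shift\<close> produces restricted functions; subtracting \<open>c\<close> also
  covers their distance to a constant.\<close>

lemma pderiv_in_translate:
  fixes w u :: "real^'n \<Rightarrow> real"
  assumes F: "axis_thick F" and S: "open S" and u: "u differentiable_on S"
    and sub: "\<And>x. x \<in> F \<Longrightarrow> x + a \<in> S" and w: "\<And>x. x \<in> F \<Longrightarrow> w x = u (x + a) - c"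
  shows "w differentiable_on F" "\<And>x. x \<in> F \<Longrightarrow> pderiv_in F i w x = pderiv_in S i u (x + a)"
proof -
  have D: "(w has_derivative frechet_derivative u (at (x + a) within S)) (at x within F)" if x: "x \<in> F" for x
  proof (rule has_derivative_transform[OF x w])
    let ?D = "frechet_derivative u (at (x + a) within S)"
    have "(u has_derivative ?D) (at (x + a) within S)"
      using u sub[OF x] by (simp add: differentiable_on_def frechet_derivative_works)
    then have D: "(u has_derivative ?D) (at (x + a))"
      using at_within_open[OF sub[OF x] S] by simp
    have "((\<lambda>x. x + a) has_derivative (\<lambda>h. h)) (at x)" by (auto intro!: derivative_eq_intros)
    from has_derivative_diff[OF has_derivative_compose[OF this D] has_derivative_const[of c]]
    have "((\<lambda>x. u (x + a) - c) has_derivative ?D) (at x)" by simp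
    then show "((\<lambda>x. u (x + a) - c) has_derivative ?D) (at x within F)"
      by (rule has_derivative_at_withinI)
  qed auto
  show "w differentiable_on F"
    unfolding differentiable_on_def using D differentiableI by blast
  show "pderiv_in F i w x = pderiv_in S i u (x + a)" if "x \<in> F" for x
    using frechet_derivative_unique_axis_thick[OF F that D[OF that]] by (simp add: pderiv_in_def)
qed

lemma C2_on_translate:
  fixes w u :: "real^'n \<Rightarrow> real"
  assumes F: "axis_thick F" and S: "open S" and u: "C2_on S u"
    and sub: "\<And>x. x \<in> F \<Longrightarrow> x + a \<in> S" and w: "\<And>x. x \<in> F \<Longrightarrow> w x = u (x + a) - c"
  shows "C2_on F w" "\<And>x i. x \<in> F \<Longrightarrow> pderiv_in F i w x = pderiv_in S i u (x + a)"
    "\<And>x i j. x \<in> F \<Longrightarrow> pderiv2_in F i j w x = pderiv2_in S i j u (x + a)"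
proof -
  have u': "u differentiable_on S" "\<And>i. pderiv_in S i u differentiable_on S"
    "\<And>i j. continuous_on S (pderiv2_in S i j u)" using u by (auto simp: C2_on_def)
  show D1: "pderiv_in F i w x = pderiv_in S i u (x + a)" if "x \<in> F" for x i
    by (rule pderiv_in_translate(2)[OF F S u'(1) sub w that])
  have D1': "pderiv_in F i w x = pderiv_in S i u (x + a) - 0" if "x \<in> F" for x i using D1[OF that] by simp
  show 2: "pderiv2_in F i j w x = pderiv2_in S i j u (x + a)" if "x \<in> F" for x i j
    unfolding pderiv2_in_def by (rule pderiv_in_translate(2)[OF F S u'(2) sub D1' that])
  show "C2_on F w"
    unfolding C2_on_def
  proof (intro conjI allI)
    show "w differentiable_on F" by (rule pderiv_in_translate(1)[OF F S u'(1) sub w])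
    show "pderiv_in F i w differentiable_on F" for i
      by (rule pderiv_in_translate(1)[OF F S u'(2) sub D1'])
    show "continuous_on F (pderiv2_in F i j w)" for i j
    proof (rule continuous_on_eq)
      show "continuous_on F (\<lambda>x. pderiv2_in S i j u (x + a))"
        by (rule continuous_on_compose2[OF u'(3)]) (use sub in \<open>auto intro!: continuous_intros\<close>)
    qed (simp add: 2)
  qed
qed

lemma pderiv_in_const [simp]: "pderiv_in UNIV i (\<lambda>x. c) = (\<lambda>x. 0)"
  by (simp add: pderiv_in_def fun_eq_iff)

lemma C2_on_const: "C2_on (UNIV :: (real^'n) set) (\<lambda>x. c)"
  by (simp add: C2_on_def pderiv2_in_def differentiable_on_def)

lemma C2h_norm_le:
  fixes w :: "real^'n \<Rightarrow> real" and A B \<beta> :: real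
  assumes A: "A \<ge> 0" and B: "B \<ge> 0" and w: "\<And>x. x \<in> K \<Longrightarrow> \<bar>w x\<bar> \<le> B"
    and d: "\<And>x i. x \<in> K \<Longrightarrow> \<bar>pderiv_in F i w x\<bar> \<le> A"
    and d2: "\<And>x i j. x \<in> K \<Longrightarrow> \<bar>pderiv2_in F i j w x\<bar> \<le> A"
    and h: "\<And>x y i j. x \<in> K \<Longrightarrow> y \<in> K \<Longrightarrow> x \<noteq> y \<Longrightarrow>
       \<bar>pderiv2_in F i j w x - pderiv2_in F i j w y\<bar> \<le> A * dist x y powr \<beta>"
  shows "C2h_norm F \<beta> K w \<le> ennreal (B + (CARD('n) + 2 * (CARD('n))\<^sup>2) * A)"
proof -
  define N where "N = real CARD('n)"
  have sum1: "(\<Sum>i\<in>(UNIV::'n set). t i) \<le> ennreal (N * T)" if "\<And>i. t i \<le> ennreal T" "T \<ge> 0" for t T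
  proof -
    have "(\<Sum>i\<in>(UNIV::'n set). t i) \<le> of_nat (CARD('n)) * ennreal T"
      by (rule sum_bounded_above) (rule that)
    also have "\<dots> = ennreal (N * T)"
      using that(2) by (simp add: N_def ennreal_mult ennreal_of_nat_eq_real_of_nat)
    finally show ?thesis .
  qed
  have sup: "(SUP x\<in>K. ennreal \<bar>g x\<bar>) \<le> ennreal T" if "\<And>x. x \<in> K \<Longrightarrow> \<bar>g x\<bar> \<le> T" for g T
    by (rule SUP_least) (use that in \<open>simp add: ennreal_leI\<close>)
  have "(SUP (x, y)\<in>{(x, y). x \<in> K \<and> y \<in> K \<and> x \<noteq> y}.
      ennreal (\<bar>pderiv2_in F i j w x - pderiv2_in F i j w y\<bar> / dist x y powr \<beta>)) \<le> ennreal A" for i j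
    by (rule SUP_least) (auto intro!: ennreal_leI h simp: pos_divide_le_eq)
  then have "C2h_norm F \<beta> K w \<le> ennreal B + ennreal (N * A) + ennreal (N * (N * A)) + ennreal (N * (N * A))"
    unfolding C2h_norm_def
    by (intro add_mono sum1 sup w d d2 mult_nonneg_nonneg A) (auto simp: N_def)
  also have "\<dots> = ennreal (B + (N + 2 * N\<^sup>2) * A)"
    using A B by (simp add: ennreal_plus[symmetric] N_def algebra_simps power2_eq_square del: ennreal_plus)
  finally show ?thesis by (simp add: N_def)
qed

lemma C2h_norm_const_le:
  fixes w :: "real^'n \<Rightarrow> real"
  assumes F: "axis_thick F" and K: "K \<subseteq> F" and w: "\<And>x. x \<in> F \<Longrightarrow> w x = c"
  shows "C2h_norm F \<beta> K w \<le> ennreal \<bar>c\<bar>"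
proof -
  have w': "w x = (\<lambda>_. c) (x + 0) - 0" if "x \<in> F" for x using w[OF that] by simp
  note D = C2_on_translate(2,3)[OF F open_UNIV C2_on_const UNIV_I w']
  have "C2h_norm F \<beta> K w \<le> ennreal (\<bar>c\<bar> + (CARD('n) + 2 * (CARD('n))\<^sup>2) * (0::real))"
    by (rule C2h_norm_le) (use D K w in \<open>auto simp: pderiv2_in_def subset_iff\<close>)
  then show ?thesis by simp
qed

lemma C2_on_eq_const:
  assumes "axis_thick F" "\<And>x. x \<in> F \<Longrightarrow> w x = c"
  shows "C2_on F w"
  by (rule C2_on_translate(1)[OF assms(1) open_UNIV C2_on_const, of 0 w c 0]) (use assms in auto)

lemma laplacian_in_eq_const:
  assumes F: "axis_thick F" and w: "\<And>x. x \<in> F \<Longrightarrow> w x = c" and x: "x \<in> F"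
  shows "laplacian_in F w x = 0"
proof -
  have w': "w x = (\<lambda>_. c) (x + 0) - 0" if "x \<in> F" for x using w[OF that] by simp
  show ?thesis
    unfolding laplacian_in_def
    using C2_on_translate(3)[OF F open_UNIV C2_on_const UNIV_I w' x] by (simp add: pderiv2_in_def)
qed

section \<open>Attraction\<close>

lemma KplusM_sol_on: "u \<in> KplusM f \<Omega> M \<Longrightarrow> open \<Omega> \<Longrightarrow> sol_on f M \<Omega> u"
  using closure_subset[of \<Omega>] unfolding KplusM_def Kplus_def sol_on_def by blast

lemma cball_in_half_space:
  assumes "x \<in> closure (half_space k)" "r < h"
  shows "cball (x + axis k h) r \<subseteq> half_space k"
proof
  fix y assume "y \<in> cball (x + axis k h) r"
  then have "norm (y - (x + axis k h)) \<le> r" by (simp add: dist_norm norm_minus_commute)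
  then have "\<bar>(y - (x + axis k h)) $ k\<bar> \<le> r" using component_le_norm_cart order_trans by blast
  then show "y \<in> half_space k" using assms by (simp add: half_space_def closure_half_space)
qed

lemma zero_in_closure_half_space: "0 \<in> closure (half_space k)"
  by (simp add: closure_half_space)

lemma closure_half_space_translate:
  "x \<in> closure (half_space k) \<Longrightarrow> 0 < h \<Longrightarrow> x + axis k h \<in> half_space k"
  by (simp add: closure_half_space half_space_def)

text \<open>Evaluation at a point is controlled by the norm over the compact set \<open>{x}\<close>.
  These sets later separate two candidate limits.\<close>

lemma evaluation_open:
  fixes F :: "(real^'n) set"
  assumes "x \<in> F"
  shows "C2h_loc_open F \<beta> {w \<in> C2h_loc F \<beta>. \<bar>w x - c\<bar> < e}"
  unfolding C2h_loc_open_def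
proof (intro conjI ballI)
  fix u assume "u \<in> {w \<in> C2h_loc F \<beta>. \<bar>w x - c\<bar> < e}"
  then have u: "\<bar>u x - c\<bar> < e" by simp
  show "\<exists>K \<epsilon>. compact K \<and> K \<subseteq> F \<and> (\<epsilon>::real) > 0 \<and> (\<forall>v\<in>C2h_loc F \<beta>.
      C2h_norm F \<beta> K (\<lambda>x. v x - u x) < ennreal \<epsilon> \<longrightarrow> v \<in> {w \<in> C2h_loc F \<beta>. \<bar>w x - c\<bar> < e})"
  proof (intro exI[of _ "{x}"] exI[of _ "e - \<bar>u x - c\<bar>"] conjI ballI impI)
    fix v assume v: "v \<in> C2h_loc F \<beta>" and n: "C2h_norm F \<beta> {x} (\<lambda>x. v x - u x) < ennreal (e - \<bar>u x - c\<bar>)"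
    have "ennreal \<bar>v x - u x\<bar> \<le> C2h_norm F \<beta> {x} (\<lambda>x. v x - u x)"
      unfolding C2h_norm_def by (simp add: add.assoc)
    also note n
    finally have "\<bar>v x - u x\<bar> < e - \<bar>u x - c\<bar>" by (simp add: ennreal_less_iff)
    then show "v \<in> {w \<in> C2h_loc F \<beta>. \<bar>w x - c\<bar> < e}" using v by auto
  qed (use assms u in auto)
qed auto

section \<open>Constant functions as solutions and as points of the function spaces\<close>

lemma const_fun_eq: "x \<in> closure (half_space k) \<Longrightarrow> const_fun k z x = z"
  by (simp add: const_fun_def)

lemma const_fun_C2h_b_norm: "C2h_b_norm (closure (half_space k)) \<beta> (const_fun k z) \<le> ennreal \<bar>z\<bar>"
  unfolding C2h_b_norm_def
  by (intro SUP_least C2h_norm_const_le half_space_axis_thick) (auto simp: const_fun_eq)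

lemma const_fun_C2_on: "C2_on (closure (half_space k)) (const_fun k z)"
  by (rule C2_on_eq_const[OF half_space_axis_thick const_fun_eq])

lemma const_fun_in_C2h_b: "const_fun k z \<in> C2h_b (closure (half_space k)) \<beta>"
  using const_fun_C2_on const_fun_C2h_b_norm[of k \<beta> z]
  by (auto simp: C2h_b_def const_fun_def order.strict_trans1[OF _ ennreal_less_top] less_top[symmetric] top_unique)

lemma const_fun_in_C2h_loc: "const_fun k z \<in> C2h_loc (closure (half_space k)) \<beta>"
proof -
  have "C2h_norm (closure (half_space k)) \<beta> K (const_fun k z) < \<infinity>" if "K \<subseteq> closure (half_space k)" for K
    using C2h_norm_const_le[OF half_space_axis_thick that, of "const_fun k z" z \<beta>]
    by (auto simp: const_fun_eq intro: order.strict_trans1[OF _ ennreal_less_top])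
  then show ?thesis using const_fun_C2_on by (auto simp: C2h_loc_def const_fun_def)
qed

text \<open>All derivatives of a difference of constants vanish, so its norm over any
  \<open>K\<close> is at most \<open>\<bar>z' - z\<bar>\<close>. The attractor thus becomes a
  continuous image of a compact set of zeros, for every \<beta> alike.\<close>

lemma const_fun_continuous_map:
  "continuous_map euclideanreal (C2h_loc_topology (closure (half_space k)) \<beta>) (const_fun k)"
  unfolding continuous_map_def topspace_C2h_loc_topology openin_C2h_loc_topology
proof (intro conjI allI impI)
  let ?F = "closure (half_space k)"
  show "const_fun k \<in> topspace euclideanreal \<rightarrow> C2h_loc ?F \<beta>" by (auto intro: const_fun_in_C2h_loc)
  fix U assume U: "C2h_loc_open ?F \<beta> U"
  have "open {z. const_fun k z \<in> U}"
    unfolding open_dist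
  proof
    fix z assume "z \<in> {z. const_fun k z \<in> U}"
    then obtain K e where K: "K \<subseteq> ?F" "(e::real) > 0"
      "\<And>v. v \<in> C2h_loc ?F \<beta> \<Longrightarrow> C2h_norm ?F \<beta> K (\<lambda>x. v x - const_fun k z x) < ennreal e \<Longrightarrow> v \<in> U"
      using U unfolding C2h_loc_open_def by blast
    have "const_fun k z' \<in> U" if "dist z' z < e" for z'
    proof (rule K(3)[OF const_fun_in_C2h_loc])
      have "C2h_norm ?F \<beta> K (\<lambda>x. const_fun k z' x - const_fun k z x) \<le> ennreal \<bar>z' - z\<bar>"
        by (rule C2h_norm_const_le[OF half_space_axis_thick K(1)]) (simp add: const_fun_eq)
      also have "\<dots> < ennreal e" using that K(2) by (simp add: ennreal_less_iff dist_real_def)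
      finally show "C2h_norm ?F \<beta> K (\<lambda>x. const_fun k z' x - const_fun k z x) < ennreal e" .
    qed
    then show "\<exists>e>0. \<forall>z'. dist z' z < e \<longrightarrow> z' \<in> {z. const_fun k z \<in> U}" using K(2) by auto
  qed
  then show "openin euclideanreal {z \<in> topspace euclideanreal. const_fun k z \<in> U}" by simp
qed

lemma const_fun_in_KplusM:
  assumes "z \<in> {0..M}" "f z = 0"
  shows "const_fun k z \<in> KplusM f (half_space k) M"
proof -
  let ?F = "closure (half_space k)"
  have c: "const_fun k z x = z" if "x \<in> half_space k" for x
    using that closure_subset const_fun_eq by blast
  have H: "axis_thick (half_space k)" by (rule open_axis_thick[OF open_half_space])
  have "continuous_on ?F (const_fun k z)" by (rule C2_on_continuous[OF const_fun_C2_on])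
  moreover have "C2_on (half_space k) (const_fun k z)" by (rule C2_on_eq_const[OF H c])
  moreover have "bounded (const_fun k z ` ?F)"
    by (rule boundedI[of _ "\<bar>z\<bar>"]) (auto simp: const_fun_eq)
  moreover have "laplacian_in (half_space k) (const_fun k z) x = 0" if "x \<in> half_space k" for x
    by (rule laplacian_in_eq_const[OF H c that])
  ultimately show ?thesis
    using assms by (auto simp: KplusM_def Kplus_def const_fun_eq c) (auto simp: const_fun_def)
qed

lemma const_in_KplusM_UNIV:
  assumes "z \<in> {0..M}" "f z = 0"
  shows "(\<lambda>x. z) \<in> KplusM f UNIV M"
  using assms C2_on_const[of z] laplacian_in_eq_const[OF open_axis_thick[OF open_UNIV], of "\<lambda>x. z" z]
  by (auto simp: KplusM_def Kplus_def)

lemma shift_const_fun: "0 \<le> h \<Longrightarrow> shift k h (const_fun k z) = const_fun k z"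
  by (auto simp: shift_def const_fun_def closure_half_space fun_eq_iff)

context nonlinearity
begin

text \<open>Here \<open>S\<close> is where the equation holds and \<open>F\<close> is where
  derivatives are taken. With \<open>c = 0\<close> the estimate shows that a translate belongs to
  the function space, with \<open>c = z\<close> that it is close to the constant
  \<open>z\<close>.\<close>

lemma C2h_norm_sol_le:
  assumes \<beta>: "\<beta> \<in> {0..<1}"
  obtains C where "C > 0"
    "\<And>(S :: (real^'n) set) u a F w z c V B K. sol_on f M S u \<Longrightarrow> axis_thick F \<Longrightarrow> K \<subseteq> F \<Longrightarrow>
      (\<And>x. x \<in> F \<Longrightarrow> x + a \<in> S) \<Longrightarrow> (\<And>x. x \<in> F \<Longrightarrow> w x = u (x + a) - c) \<Longrightarrow>
      (\<And>x. x \<in> K \<Longrightarrow> cball (x + a) 12 \<subseteq> S) \<Longrightarrow> z \<in> {0..M} \<Longrightarrow> f z = 0 \<Longrightarrow> V > 0 \<Longrightarrow>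
      (\<And>x y. x \<in> K \<Longrightarrow> y \<in> cball (x + a) 12 \<Longrightarrow> \<bar>u y - z\<bar> \<le> V) \<Longrightarrow>
      B \<ge> 0 \<Longrightarrow> (\<And>x. x \<in> K \<Longrightarrow> \<bar>w x\<bar> \<le> B) \<Longrightarrow> C2h_norm F \<beta> K w \<le> ennreal (B + C * V)"
proof -
  define \<gamma> where "\<gamma> = max \<beta> (1/2)"
  have \<gamma>: "0 < \<gamma>" "\<gamma> < 1" "\<beta> \<le> \<gamma>" using \<beta> by (auto simp: \<gamma>_def max_def)
  obtain C where C: "C > 0"
    "\<And>(S :: (real^'n) set) v V x i j y. interior_data S v L V x \<Longrightarrow>
       \<bar>pderiv_in S i v x\<bar> \<le> C * V \<and> \<bar>pderiv2_in S i j v x\<bar> \<le> C * V \<and>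
       (y \<in> cball x 1 \<longrightarrow> \<bar>pderiv2_in S i j v y - pderiv2_in S i j v x\<bar> \<le> C * V * dist x y powr \<gamma>)"
    using interior_estimate[OF \<gamma>(1,2) L, where 'n='n] by blast
  define N where "N = real CARD('n)"
  have N: "N > 0" by (simp add: N_def)
  show ?thesis
  proof (rule that)
    show "(N + 2 * N\<^sup>2) * (2 * C) > 0" using N C(1) by (intro mult_pos_pos add_pos_nonneg) auto
    fix S :: "(real^'n) set" and u a F w z c V B K
    assume u: "sol_on f M S u" and F: "axis_thick F" and K: "K \<subseteq> F"
      and sub: "\<And>x. x \<in> F \<Longrightarrow> x + a \<in> S" and w: "\<And>x. x \<in> F \<Longrightarrow> w x = u (x + a) - c"
      and cb: "\<And>x. x \<in> K \<Longrightarrow> cball (x + a) 12 \<subseteq> S" and z: "z \<in> {0..M}" "f z = 0" and V: "V > 0"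
      and close: "\<And>x y. x \<in> K \<Longrightarrow> y \<in> cball (x + a) 12 \<Longrightarrow> \<bar>u y - z\<bar> \<le> V"
      and B: "B \<ge> 0" "\<And>x. x \<in> K \<Longrightarrow> \<bar>w x\<bar> \<le> B"
    have S: "open S" "C2_on S u" using u by (auto simp: sol_on_def)
    have D: "pderiv_in F i w x = pderiv_in S i u (x + a)" "pderiv2_in F i j w x = pderiv2_in S i j u (x + a)"
      if "x \<in> K" for x i j
    proof -
      show "pderiv_in F i w x = pderiv_in S i u (x + a)"
        by (rule C2_on_translate(2)[OF F S sub w subsetD[OF K that]])
      show "pderiv2_in F i j w x = pderiv2_in S i j u (x + a)"
        by (rule C2_on_translate(3)[OF F S sub w subsetD[OF K that]])
    qed
    have E: "\<bar>pderiv_in S i u (x + a)\<bar> \<le> C * V" "\<bar>pderiv2_in S i j u (x + a)\<bar> \<le> C * V"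
      "y \<in> cball (x + a) 1 \<Longrightarrow> \<bar>pderiv2_in S i j u y - pderiv2_in S i j u (x + a)\<bar> \<le> C * V * dist (x + a) y powr \<gamma>"
      if x: "x \<in> K" for x y i j
    proof -
      have "interior_data S (\<lambda>y. u y - z) L V (x + a)"
        by (rule sol_interior_data[OF u cb[OF x] z V close[OF x]])
      from C(2)[OF this, of i j y]
      show "\<bar>pderiv_in S i u (x + a)\<bar> \<le> C * V" "\<bar>pderiv2_in S i j u (x + a)\<bar> \<le> C * V"
        "y \<in> cball (x + a) 1 \<Longrightarrow> \<bar>pderiv2_in S i j u y - pderiv2_in S i j u (x + a)\<bar> \<le> C * V * dist (x + a) y powr \<gamma>"
        by (simp_all only: pderiv_in_diff_const pderiv2_in_diff_const)
    qed
    \<comment> \<open>The factor 2 serves pairs at distance more than 1, where the two second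
      derivatives are simply bounded separately.\<close>
    define A where "A = 2 * C * V"
    have A: "A \<ge> 0" "C * V \<le> A" using C(1) V by (auto simp: A_def)
    have "C2h_norm F \<beta> K w \<le> ennreal (B + (CARD('n) + 2 * (CARD('n))\<^sup>2) * A)"
    proof (rule C2h_norm_le[OF A(1) B(1)])
      show "\<bar>w x\<bar> \<le> B" if "x \<in> K" for x by (rule B(2)[OF that])
      show "\<bar>pderiv_in F i w x\<bar> \<le> A" if "x \<in> K" for x i
        using D(1)[OF that, of i] E(1)[OF that, of i] A(2) by simp
      show "\<bar>pderiv2_in F i j w x\<bar> \<le> A" if "x \<in> K" for x i j
        using D(2)[OF that, of i j] E(2)[OF that, of i j] A(2) by simp
      fix x y i j assume x: "x \<in> K" and y: "y \<in> K" and ne: "x \<noteq> y"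
      have eq: "pderiv2_in F i j w x - pderiv2_in F i j w y
          = pderiv2_in S i j u (x + a) - pderiv2_in S i j u (y + a)"
        by (simp only: D(2)[OF x] D(2)[OF y])
      show "\<bar>pderiv2_in F i j w x - pderiv2_in F i j w y\<bar> \<le> A * dist x y powr \<beta>"
      proof (cases "dist x y \<le> 1")
        case True
        have "\<bar>pderiv2_in S i j u (y + a) - pderiv2_in S i j u (x + a)\<bar>
            \<le> C * V * dist (x + a) (y + a) powr \<gamma>"
          by (rule E(3)[OF x]) (use True in simp)
        also have "dist (x + a) (y + a) = dist x y" by simp
        also have "C * V * dist x y powr \<gamma> \<le> A * dist x y powr \<beta>"
          using True A V C(1) \<gamma>(3) by (intro mult_mono powr_mono') auto
        finally show ?thesis unfolding eq by (simp add: abs_minus_commute)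
      next
        case False
        have "\<bar>pderiv2_in S i j u (x + a) - pderiv2_in S i j u (y + a)\<bar> \<le> A * 1"
          using abs_triangle_ineq4[of "pderiv2_in S i j u (x + a)" "pderiv2_in S i j u (y + a)"]
            E(2)[OF x, of i j] E(2)[OF y, of i j] by (simp add: A_def)
        also have "\<dots> \<le> A * dist x y powr \<beta>"
          using False \<beta> A by (intro mult_left_mono ge_one_powr_ge_zero) auto
        finally show ?thesis unfolding eq .
      qed
    qed
    also have "B + (CARD('n) + 2 * (CARD('n))\<^sup>2) * A = B + (N + 2 * N\<^sup>2) * (2 * C) * V"
      by (simp add: N_def A_def)
    finally show "C2h_norm F \<beta> K w \<le> ennreal (B + (N + 2 * N\<^sup>2) * (2 * C) * V)" .
  qed
qed

text \<open>Neighbourhoods contain only members of \<open>C2h_loc\<close>, to which \<open>u\<close>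
  itself may fail to belong because of its boundary values. Beyond 12 the interior estimate is
  available at every point of the closed half-space.\<close>

lemma shift_in_C2h_loc:
  fixes u :: "real^'n \<Rightarrow> real"
  assumes u: "u \<in> KplusM f (half_space k) M" and h: "h > 12" and \<beta>: "\<beta> \<in> {0..<1}"
  shows "shift k h u \<in> C2h_loc (closure (half_space k)) \<beta>"
proof -
  let ?F = "closure (half_space k)"
  have sol: "sol_on f M (half_space k) u" by (rule KplusM_sol_on[OF u open_half_space])
  have tr: "x + axis k h \<in> half_space k" if "x \<in> ?F" for x
    by (rule closure_half_space_translate[OF that]) (use h in simp)
  have w: "shift k h u x = u (x + axis k h) - 0" if "x \<in> ?F" for x using that by (simp add: shift_def)
  have C2: "C2_on (half_space k) u" using sol by (simp add: sol_on_def)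
  obtain C where C: "C > 0"
    "\<And>(S :: (real^'n) set) u a F w z c V B K. sol_on f M S u \<Longrightarrow> axis_thick F \<Longrightarrow> K \<subseteq> F \<Longrightarrow>
      (\<And>x. x \<in> F \<Longrightarrow> x + a \<in> S) \<Longrightarrow> (\<And>x. x \<in> F \<Longrightarrow> w x = u (x + a) - c) \<Longrightarrow>
      (\<And>x. x \<in> K \<Longrightarrow> cball (x + a) 12 \<subseteq> S) \<Longrightarrow> z \<in> {0..M} \<Longrightarrow> f z = 0 \<Longrightarrow> V > 0 \<Longrightarrow>
      (\<And>x y. x \<in> K \<Longrightarrow> y \<in> cball (x + a) 12 \<Longrightarrow> \<bar>u y - z\<bar> \<le> V) \<Longrightarrow>
      B \<ge> 0 \<Longrightarrow> (\<And>x. x \<in> K \<Longrightarrow> \<bar>w x\<bar> \<le> B) \<Longrightarrow> C2h_norm F \<beta> K w \<le> ennreal (B + C * V)"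
    by (rule C2h_norm_sol_le[OF \<beta>]) blast
  have "C2h_norm ?F \<beta> K (shift k h u) < \<infinity>" if K: "K \<subseteq> ?F" for K
  proof -
    have "C2h_norm ?F \<beta> K (shift k h u) \<le> ennreal (M + C * M)"
    proof (rule C(2)[OF sol half_space_axis_thick K tr w, where z=\<mu>])
      show cb: "cball (x + axis k h) 12 \<subseteq> half_space k" if "x \<in> K" for x
        by (rule cball_in_half_space) (use that K h in auto)
      show "\<bar>u y - \<mu>\<bar> \<le> M" if "x \<in> K" "y \<in> cball (x + axis k h) 12" for x y
        using sol_onD(1,2)[OF sol subsetD[OF cb[OF that(1)] that(2)]] \<mu> by (auto simp: abs_le_iff)
      show "\<bar>shift k h u x\<bar> \<le> M" if "x \<in> K" for x
        using sol_onD(1,2)[OF sol tr, of x] w[of x] that K by auto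
    qed (use \<mu> f_\<mu> in auto)
    then show ?thesis by (auto intro: order.strict_trans1[OF _ ennreal_less_top])
  qed
  moreover have "C2_on ?F (shift k h u)"
    by (rule C2_on_translate(1)[OF half_space_axis_thick open_half_space C2 tr w])
  moreover have "shift k h u \<in> extensional ?F" by (simp add: shift_def)
  ultimately show ?thesis by (simp add: C2h_loc_def)
qed

text \<open>Letting the solution vary with \<open>n\<close> gives attraction that is uniform over
  sets of solutions; keeping it fixed gives the limits of a single trajectory. The lower bound on
  \<open>h n\<close> leaves a ball of radius \<open>n\<close> about \<open>axis k (h n)\<close>
  inside the half-space.\<close>

lemma attraction_along_sequence:
  fixes u :: "nat \<Rightarrow> real^'n \<Rightarrow> real" and k :: 'n and h :: "nat \<Rightarrow> real"
  assumes u: "\<And>n. u n \<in> KplusM f (half_space k) M" and h: "\<And>n. real n + 1 \<le> h n"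
  obtains r z where "strict_mono r" "z \<in> {0..M}" "f z = 0"
    "(\<lambda>n. u (r n) (axis k (h (r n)))) \<longlonglongrightarrow> z"
    "\<And>\<beta> U. \<beta> \<in> {0..<1} \<Longrightarrow> C2h_loc_open (closure (half_space k)) \<beta> U \<Longrightarrow> const_fun k z \<in> U \<Longrightarrow>
        \<forall>\<^sub>F n in sequentially. shift k (h (r n)) (u (r n)) \<in> U"
proof -
  let ?F = "closure (half_space k)"
  have sol: "sol_on f M (half_space k) (u n)" for n by (rule KplusM_sol_on[OF u open_half_space])
  have sub: "cball (axis k (h n)) (real n) \<subseteq> half_space k" for n
    using cball_in_half_space[OF zero_in_closure_half_space, of "real n" "h n" k] h[of n] by simp
  obtain r z where r: "strict_mono r" and z: "z \<in> {0..M}" "f z = 0"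
    and ev: "\<And>R \<epsilon>. \<epsilon> > 0 \<Longrightarrow> \<forall>\<^sub>F n in sequentially. \<forall>y\<in>cball 0 R. \<bar>u (r n) (axis k (h (r n)) + y) - z\<bar> \<le> \<epsilon>"
    using compactness[of "\<lambda>_. half_space k" u "\<lambda>n. axis k (h n)", OF sol sub] by blast
  show ?thesis
  proof (rule that[OF r z])
    show "(\<lambda>n. u (r n) (axis k (h (r n)))) \<longlonglongrightarrow> z"
    proof (rule tendstoI)
      fix e :: real assume "e > 0"
      then have "e / 2 > 0" by simp
      from ev[OF this, of 0] show "\<forall>\<^sub>F n in sequentially. dist (u (r n) (axis k (h (r n)))) z < e"
        by eventually_elim (use \<open>e > 0\<close> in \<open>simp add: dist_real_def\<close>)
    qed
    fix \<beta> U assume \<beta>: "\<beta> \<in> {0..<1::real}" and U: "C2h_loc_open ?F \<beta> U" "const_fun k z \<in> U"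
    obtain K e where K: "compact K" "K \<subseteq> ?F" "(e::real) > 0"
      "\<And>v. v \<in> C2h_loc ?F \<beta> \<Longrightarrow> C2h_norm ?F \<beta> K (\<lambda>x. v x - const_fun k z x) < ennreal e \<Longrightarrow> v \<in> U"
      using U unfolding C2h_loc_open_def by blast
    obtain C where C: "C > 0"
      "\<And>(S :: (real^'n) set) u a F w z c V B K. sol_on f M S u \<Longrightarrow> axis_thick F \<Longrightarrow> K \<subseteq> F \<Longrightarrow>
        (\<And>x. x \<in> F \<Longrightarrow> x + a \<in> S) \<Longrightarrow> (\<And>x. x \<in> F \<Longrightarrow> w x = u (x + a) - c) \<Longrightarrow>
        (\<And>x. x \<in> K \<Longrightarrow> cball (x + a) 12 \<subseteq> S) \<Longrightarrow> z \<in> {0..M} \<Longrightarrow> f z = 0 \<Longrightarrow> V > 0 \<Longrightarrow>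
        (\<And>x y. x \<in> K \<Longrightarrow> y \<in> cball (x + a) 12 \<Longrightarrow> \<bar>u y - z\<bar> \<le> V) \<Longrightarrow>
        B \<ge> 0 \<Longrightarrow> (\<And>x. x \<in> K \<Longrightarrow> \<bar>w x\<bar> \<le> B) \<Longrightarrow> C2h_norm F \<beta> K w \<le> ennreal (B + C * V)"
      by (rule C2h_norm_sol_le[OF \<beta>]) blast
    obtain R where R: "\<And>x. x \<in> K \<Longrightarrow> norm x \<le> R"
      using compact_imp_bounded[OF K(1)] unfolding bounded_iff by blast
    \<comment> \<open>The norm bound \<open>V + C * V\<close> then equals \<open>e / 2\<close>.
      Uniform closeness is needed on radius \<open>R + 12\<close>, since the estimate at a point of
      \<open>K\<close> looks at a ball of radius 12 around it.\<close>
    define V where "V = (e / 2) / (1 + C)"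
    have V: "V > 0" "V + C * V < e"
    proof -
      show "V > 0" using K(3) C(1) by (simp add: V_def)
      have "V + C * V = V * (1 + C)" by (simp add: algebra_simps)
      also have "\<dots> = e / 2"
        by (rule iffD1[OF nonzero_eq_divide_eq V_def]) (use C(1) in simp)
      finally have "V + C * V = e / 2" .
      then show "V + C * V < e" using K(3) by simp
    qed
    show "\<forall>\<^sub>F n in sequentially. shift k (h (r n)) (u (r n)) \<in> U"
      using ev[OF V(1), of "R + 12"] eventually_ge_at_top[of 12]
    proof eventually_elim
      case (elim n)
      let ?h = "h (r n)" and ?u = "u (r n)"
      have "n \<le> r n" by (rule seq_suble[OF r])
      then have h12: "?h > 12" using h[of "r n"] elim(2) by simp
      have tr: "x + axis k ?h \<in> half_space k" if "x \<in> ?F" for x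
        by (rule closure_half_space_translate[OF that]) (use h12 in simp)
      have w: "shift k ?h ?u x - const_fun k z x = ?u (x + axis k ?h) - z" if "x \<in> ?F" for x
        using that by (simp add: shift_def const_fun_eq)
      have close: "\<bar>?u y - z\<bar> \<le> V" if "x \<in> K" "y \<in> cball (x + axis k ?h) 12" for x y
      proof -
        have "norm (y - axis k ?h) \<le> norm x + norm (y - (x + axis k ?h))"
          using norm_triangle_ineq[of x "y - (x + axis k ?h)"] by (simp add: algebra_simps)
        moreover have "norm (y - (x + axis k ?h)) \<le> 12"
          using that(2) by (simp add: dist_norm norm_minus_commute)
        ultimately have "y - axis k ?h \<in> cball 0 (R + 12)" using R[OF that(1)] by simp
        from bspec[OF elim(1) this] show ?thesis by simp
      qed
      have "C2h_norm ?F \<beta> K (\<lambda>x. shift k ?h ?u x - const_fun k z x) \<le> ennreal (V + C * V)"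
      proof (rule C(2)[OF sol half_space_axis_thick K(2) tr w _ z V(1) close])
        show "cball (x + axis k ?h) 12 \<subseteq> half_space k" if "x \<in> K" for x
          by (rule cball_in_half_space) (use that K h12 in auto)
        show "\<bar>shift k ?h ?u x - const_fun k z x\<bar> \<le> V" if "x \<in> K" for x
          using close[OF that, of "x + axis k ?h"] w[of x] that K(2) by auto
      qed (use V in auto)
      also have "\<dots> < ennreal e" using K(3) V(2) by (rule ennreal_lessI)
      finally show ?case by (rule K(4)[OF shift_in_C2h_loc[OF u h12 \<beta>]])
    qed
  qed
qed

text \<open>Between 0 and \<mu> the function is positive; beyond \<mu>, \<open>f_left\<close> makes
  it negative immediately to the left of each zero.\<close>

lemma zeros_contain_no_interval:
  assumes "0 \<le> a" "a < b"
  shows "\<exists>c. a < c \<and> c < b \<and> f c \<noteq> 0"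
proof (cases "a < \<mu>")
  case True
  define c where "c = (a + min b \<mu>) / 2"
  have "a < c" "c < b" "0 < c" "c < \<mu>" using True assms by (auto simp: c_def min_def)
  then show ?thesis using f_pos[of c] by force
next
  case False
  define c where "c = (a + b) / 2"
  have c: "a < c" "c < b" "\<mu> < c" using False assms by (auto simp: c_def)
  show ?thesis
  proof (cases "f c = 0")
    case True
    then obtain q \<delta> where q: "q > 0" "\<delta> > 0" "\<And>s. c - \<delta> < s \<Longrightarrow> s < c \<Longrightarrow> f s \<le> - q * (c - s)"
      using f_left[OF c(3)] by blast
    obtain s where s: "max a (c - \<delta>) < s" "s < c" using dense[of "max a (c - \<delta>)" c] c q by auto
    then have "f s \<le> - q * (c - s)" by (intro q(3)) auto
    moreover have "0 < q * (c - s)" using q s by (intro mult_pos_pos) auto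
    ultimately show ?thesis using s c by (intro exI[of _ s]) auto
  qed (use c in blast)
qed

text \<open>Failure for every \<open>h0\<close> yields solutions in \<open>B\<close> and arbitrarily
  large shifts outside \<open>U\<close>. A subsequence converges to a constant zero of
  \<open>f\<close>, which lies in the open set \<open>U\<close>.\<close>

lemma uniform_attraction:
  fixes k :: "'n::finite"
  assumes \<beta>: "\<beta> \<in> {0..<1}" and B: "B \<subseteq> KplusM f (half_space k) M"
    and U: "C2h_loc_open (closure (half_space k)) \<beta> U"
    and sub: "\<And>z. z \<in> {0..M} \<Longrightarrow> f z = 0 \<Longrightarrow> const_fun k z \<in> U"
  shows "\<exists>h0>0. \<forall>h\<ge>h0. shift k h ` B \<subseteq> U"
proof (rule ccontr)
  assume no: "\<not> ?thesis"
  have "\<exists>h u. real n + 1 \<le> h \<and> u \<in> B \<and> shift k h u \<notin> U" for n :: nat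
  proof -
    have "real n + 1 > 0" by simp
    then show ?thesis using no by (meson image_subsetI)
  qed
  then obtain h u where hu: "\<And>n::nat. real n + 1 \<le> h n" "\<And>n. u n \<in> B" "\<And>n. shift k (h n) (u n) \<notin> U"
    by metis
  show False
  proof (rule attraction_along_sequence[of u k h, OF subsetD[OF B hu(2)] hu(1)])
    fix r z assume z: "z \<in> {0..M}" "f z = 0"
      and ev: "\<And>\<beta> U. \<beta> \<in> {0..<1} \<Longrightarrow> C2h_loc_open (closure (half_space k)) \<beta> U \<Longrightarrow> const_fun k z \<in> U \<Longrightarrow>
        \<forall>\<^sub>F n in sequentially. shift k (h (r n)) (u (r n)) \<in> U"
    from ev[OF \<beta> U sub[OF z]] hu(3) show False by simp
  qed
qed

text \<open>Two different limits \<open>z\<close> and \<open>z0\<close> would make every value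
  \<open>c\<close> strictly between them recur along the ray at arbitrarily large times. The
  translates at those times subconverge to a zero of \<open>f\<close>, which can only be
  \<open>c\<close>; so \<open>f\<close> would vanish on a whole interval.\<close>

lemma trajectory_converges:
  fixes k :: "'n::finite"
  assumes u: "u \<in> KplusM f (half_space k) M"
  obtains z where "z \<in> {0..M}" "f z = 0"
    "\<And>\<beta> U. \<beta> \<in> {0..<1} \<Longrightarrow> C2h_loc_open (closure (half_space k)) \<beta> U \<Longrightarrow> const_fun k z \<in> U \<Longrightarrow>
        \<forall>\<^sub>F h in at_top. shift k h u \<in> U"
proof -
  \<comment> \<open>All limits are constants, so the values at one moving point identify them and
    the intermediate value theorem on a ray applies.\<close>
  define p where "p = (\<lambda>h. u (axis k h))"
  have cont: "continuous_on {0<..} p"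
  proof -
    have "continuous_on (half_space k) u"
      by (rule sol_on_continuous[OF KplusM_sol_on[OF u open_half_space]])
    moreover have "continuous_on {0<..} (\<lambda>h::real. axis k h)"
    proof (rule continuous_on_eq)
      show "continuous_on {0<..} (\<lambda>h::real. h *\<^sub>R axis k (1::real))" by (intro continuous_intros)
    qed (simp add: vec_eq_iff axis_def)
    ultimately show ?thesis
      unfolding p_def by (rule continuous_on_compose2) (auto simp: half_space_def)
  qed
  have seq: "\<exists>r z. strict_mono r \<and> z \<in> {0..M} \<and> f z = 0 \<and> (\<lambda>n. p (h (r n))) \<longlonglongrightarrow> z \<and>
      (\<forall>\<beta> U. \<beta> \<in> {0..<1} \<longrightarrow> C2h_loc_open (closure (half_space k)) \<beta> U \<longrightarrow> const_fun k z \<in> U \<longrightarrow>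
        (\<forall>\<^sub>F n in sequentially. shift k (h (r n)) u \<in> U))"
    if h: "\<And>n::nat. real n + 1 \<le> h n" for h
    using attraction_along_sequence[of "\<lambda>_. u" k h, OF u h] unfolding p_def by metis
  obtain r0 z0 where r0: "strict_mono r0" "z0 \<in> {0..M}" "f z0 = 0"
    "(\<lambda>n. p (real (r0 n) + 1)) \<longlonglongrightarrow> z0"
    using seq[of "\<lambda>n. real n + 1"] by auto
  show ?thesis
  proof (rule that[OF r0(2,3)], rule ccontr)
    fix \<beta> U assume \<beta>: "\<beta> \<in> {0..<1}" and U: "C2h_loc_open (closure (half_space k)) \<beta> U" "const_fun k z0 \<in> U"
      and no: "\<not> (\<forall>\<^sub>F h in at_top. shift k h u \<in> U)"
    have "\<exists>h. real n + 1 \<le> h \<and> shift k h u \<notin> U" for n :: nat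
      using no unfolding eventually_at_top_linorder by (meson linorder_le_cases)
    then obtain h where h: "\<And>n::nat. real n + 1 \<le> h n" "\<And>n. shift k (h n) u \<notin> U" by metis
    obtain r z where r: "strict_mono r" "z \<in> {0..M}" "f z = 0" "(\<lambda>n. p (h (r n))) \<longlonglongrightarrow> z"
      "\<And>\<beta> U. \<beta> \<in> {0..<1} \<Longrightarrow> C2h_loc_open (closure (half_space k)) \<beta> U \<Longrightarrow> const_fun k z \<in> U \<Longrightarrow>
        \<forall>\<^sub>F n in sequentially. shift k (h (r n)) u \<in> U"
      using seq[OF h(1)] by blast
    have "z \<noteq> z0"
    proof
      assume "z = z0"
      with r(5)[OF \<beta> U(1)] U(2) h(2) show False by simp
    qed
    have between: "f c = 0" if c: "min z z0 < c" "c < max z z0" for c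
    proof -
      have "\<exists>s. real n + 1 \<le> s \<and> p s = c" for n :: nat
      proof -
        have large: "real j + 1 \<le> real (r0 j) + 1" "real j + 1 \<le> h (r j)" for j
          using seq_suble[OF r0(1), of j] seq_suble[OF r(1), of j] h(1)[of "r j"] by auto
        have "\<forall>\<^sub>F j in sequentially. (z < c \<longrightarrow> p (h (r j)) < c) \<and> (c < z \<longrightarrow> c < p (h (r j)))
            \<and> (z0 < c \<longrightarrow> p (real (r0 j) + 1) < c) \<and> (c < z0 \<longrightarrow> c < p (real (r0 j) + 1)) \<and> n \<le> j"
          by (intro eventually_conj eventually_ge_at_top)
             (auto simp: eventually_conj_iff order_tendstoD[OF r(4)] order_tendstoD[OF r0(4)]
               intro: eventually_mono)
        then obtain j where j: "z < c \<Longrightarrow> p (h (r j)) < c" "c < z \<Longrightarrow> c < p (h (r j))"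
          "z0 < c \<Longrightarrow> p (real (r0 j) + 1) < c" "c < z0 \<Longrightarrow> c < p (real (r0 j) + 1)" "n \<le> j"
          using eventually_happens'[OF sequentially_bot] by blast
        define s1 s2 where "s1 = real (r0 j) + 1" and "s2 = h (r j)"
        have s: "real n + 1 \<le> s1" "real n + 1 \<le> s2" using large[of j] j(5) by (auto simp: s1_def s2_def)
        have "connected (p ` {real n + 1..})"
        proof (rule connected_continuous_image)
          show "continuous_on {real n + 1..} p" by (rule continuous_on_subset[OF cont]) auto
        qed auto
        moreover have "p s1 \<in> p ` {real n + 1..}" "p s2 \<in> p ` {real n + 1..}" using s by auto
        moreover have "(p s1 \<le> c \<and> c \<le> p s2) \<or> (p s2 \<le> c \<and> c \<le> p s1)"
          using j(1-4) c \<open>z \<noteq> z0\<close> unfolding s1_def s2_def by (cases "z < z0") (auto simp: min_def max_def)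
        ultimately have "c \<in> p ` {real n + 1..}" using connectedD_interval by blast
        then show ?thesis by auto
      qed
      then obtain s where s: "\<And>n::nat. real n + 1 \<le> s n" "\<And>n. p (s n) = c" by metis
      obtain r' z' where "f z' = 0" "(\<lambda>n. p (s (r' n))) \<longlonglongrightarrow> z'" using seq[OF s(1)] by blast
      then show ?thesis using s(2) by (simp add: LIMSEQ_const_iff)
    qed
    have "0 \<le> min z z0" "min z z0 < max z z0" using r(2) r0(2) \<open>z \<noteq> z0\<close> by auto
    then show False using zeros_contain_no_interval between by blast
  qed
qed

text \<open>A solution on the whole space serves as its own approximant on every ball, with no
  error.\<close>

lemma KplusM_UNIV_const:
  fixes u :: "real^'n \<Rightarrow> real"
  assumes u: "u \<in> KplusM f UNIV M"
  obtains z where "z \<in> {0..M}" "f z = 0" "u = (\<lambda>x. z)"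
proof -
  have "sol_on f M UNIV u" by (rule KplusM_sol_on[OF u open_UNIV])
  then have "limit_sol f M u"
    unfolding limit_sol_def by (metis UNIV_I abs_zero diff_self less_imp_le subsetI)
  from liouville[OF this] obtain z where "z \<in> {0..M}" "f z = 0" "\<And>x. u x = z" by blast
  then show ?thesis by (intro that[of z]) auto
qed

lemma zeros_compact: "compact ({z. 0 \<le> z \<and> f z = 0} \<inter> {0..M})"
proof -
  have "L-lipschitz_on {0..M} f"
    by (rule lipschitz_onI) (use lip L in \<open>auto simp: dist_real_def\<close>)
  then have "continuous_on {0..M} f" by (rule lipschitz_on_continuous_on)
  then have "closed ({0..M} \<inter> f -` {0})"
    by (rule continuous_closed_preimage) auto
  moreover have "bounded ({0..M} \<inter> f -` {0})" by (rule bounded_subset[OF bounded_closed_interval]) auto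
  moreover have "{z. 0 \<le> z \<and> f z = 0} \<inter> {0..M} = {0..M} \<inter> f -` {0}" by auto
  ultimately show ?thesis by (simp add: compact_eq_bounded_closed)
qed

end

section \<open>Translation of the analytic hypotheses on \<open>f\<close>\<close>

lemma locally_lipschitz_imp_lipschitz:
  fixes f :: "real \<Rightarrow> real"
  assumes "\<forall>s\<in>{0..}. \<exists>r>0. \<exists>L. L-lipschitz_on (cball s r \<inter> {0..}) f"
  obtains L where "L-lipschitz_on {0..M} f"
proof -
  \<comment> \<open>The notion carries a time parameter; the one-point time set \<open>{0}\<close>
    reduces it to the autonomous case, where compactness of \<open>{0..M}\<close> yields one
    constant.\<close>
  have "local_lipschitz {0::real} {0..} (\<lambda>_. f)"
    unfolding local_lipschitz_def using assms by blast
  then have "local_lipschitz {0::real} {0..M} (\<lambda>_. f)" by (rule local_lipschitz_subset) auto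
  from local_lipschitz_compact_implies_lipschitz[OF this] show ?thesis
    using that by (metis compact_Icc compact_sing continuous_on_const singletonI)
qed

lemma Liminf_right_zero_lower_bound:
  fixes f :: "real \<Rightarrow> real"
  assumes "Liminf (at_right 0) (\<lambda>s. ereal (f s / s)) > 0"
  shows "\<exists>c>0. \<exists>\<delta>>0. \<forall>s. 0 < s \<and> s < \<delta> \<longrightarrow> c * s \<le> f s"
proof -
  obtain c where c: "0 < ereal c" "ereal c < Liminf (at_right 0) (\<lambda>s. ereal (f s / s))"
    using ereal_dense2[OF assms] by (auto simp: zero_ereal_def)
  have "\<forall>\<^sub>F s in at_right 0. ereal c < ereal (f s / s)" by (rule less_LiminfD[OF c(2)])
  then obtain \<delta> where \<delta>: "\<delta> > 0" "\<And>s. 0 < s \<Longrightarrow> s < \<delta> \<Longrightarrow> c < f s / s"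
    unfolding eventually_at_right_field by auto
  then show ?thesis using c(1)
    by (intro exI[of _ c] exI[of _ \<delta>]) (auto simp: pos_less_divide_eq less_imp_le)
qed

lemma Liminf_left_upper_bound:
  fixes f :: "real \<Rightarrow> real"
  assumes "Liminf (at_left z) (\<lambda>s. ereal (f s / (s - z))) > 0"
  shows "\<exists>c>0. \<exists>\<delta>>0. \<forall>s. z - \<delta> < s \<and> s < z \<longrightarrow> f s \<le> - c * (z - s)"
proof -
  obtain c where c: "0 < ereal c" "ereal c < Liminf (at_left z) (\<lambda>s. ereal (f s / (s - z)))"
    using ereal_dense2[OF assms] by (auto simp: zero_ereal_def)
  have "\<forall>\<^sub>F s in at_left z. ereal c < ereal (f s / (s - z))" by (rule less_LiminfD[OF c(2)])
  then obtain b where b: "b < z" "\<And>s. b < s \<Longrightarrow> s < z \<Longrightarrow> c < f s / (s - z)"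
    unfolding eventually_at_left_field by auto
  \<comment> \<open>Multiplying by \<open>s - z < 0\<close> reverses the inequality, so a positive
    lower bound on the quotient bounds \<open>f\<close> above by a negative linear term.\<close>
  have "f s \<le> - c * (z - s)" if "z - (z - b) < s" "s < z" for s
    using b(2)[of s] that by (simp add: neg_less_divide_eq algebra_simps)
  then show ?thesis using b(1) c(1) by (intro exI[of _ c] conjI exI[of _ "z - b"]) auto
qed

section \<open>Attractor, entire solutions and convergence of trajectories\<close>

theorem theorem4p4:
  fixes f :: "real \<Rightarrow> real" and \<mu> :: real and k :: "'n::finite" and M :: real
    and E :: "real set" and \<Omega> F :: "(real^'n) set"
  defines "E \<equiv> {z. 0 \<le> z \<and> f z = 0}"
    and "\<Omega> \<equiv> half_space k"
    and "F \<equiv> closure \<Omega>"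
  assumes N: "CARD('n) \<ge> 2"
    and lip: "\<forall>s\<in>{0..}. \<exists>r>0. \<exists>L. L-lipschitz_on (cball s r \<inter> {0..}) f"
    and i: "\<mu> > 0" "\<forall>s\<in>{0<..<\<mu>}. f s > 0" "\<forall>s\<in>{\<mu>..}. f s \<le> 0"
    and ii: "\<exists>\<mu>'\<in>{0<..<\<mu>}. antimono_on {\<mu>'..\<mu>} f"
    and iii: "f 0 > 0 \<or> (f 0 = 0 \<and> Liminf (at_right 0) (\<lambda>s. ereal (f s / s)) > 0)"
    and iv: "\<forall>z>\<mu>. f z = 0 \<longrightarrow> Liminf (at_left z) (\<lambda>s. ereal (f s / (s - z))) > 0"
    and M: "M \<ge> \<mu>"
  shows "(\<exists>A. global_attractor k (KplusM f \<Omega> M) A \<and>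
            (\<forall>\<beta>\<in>{0..<1}. bounded_in_C2h_b F \<beta> A \<and> compactin (C2h_loc_topology F \<beta>) A) \<and>
            A = (\<lambda>u. restrict u F) ` KplusM f UNIV M \<and>
            A = const_fun k ` (E \<inter> {0..M})) \<and>
         (\<forall>u\<in>Kplus f \<Omega>. (\<forall>x\<in>F. 0 \<le> u x \<and> u x \<le> M) \<longrightarrow>
            (\<exists>!z. z \<in> E \<inter> {0..M} \<and>
               (\<forall>\<beta>\<in>{0..<1}. limitin (C2h_loc_topology F \<beta>) (\<lambda>h. shift k h u) (const_fun k z) at_top)))"
proof -
  obtain L where L: "L-lipschitz_on {0..M} f"
    using lip by (rule locally_lipschitz_imp_lipschitz)
  interpret nonlinearity f \<mu> M L
  proof
    show "L \<ge> 0" using L by (rule lipschitz_on_nonneg)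
    show "\<bar>f a - f b\<bar> \<le> L * \<bar>a - b\<bar>" if "a \<in> {0..M}" "b \<in> {0..M}" for a b
      using lipschitz_onD[OF L that] by (simp add: dist_real_def)
    show "f 0 > 0 \<or> (f 0 = 0 \<and> (\<exists>c>0. \<exists>\<delta>>0. \<forall>s. 0 < s \<and> s < \<delta> \<longrightarrow> c * s \<le> f s))"
      using iii Liminf_right_zero_lower_bound by blast
    show "\<exists>c>0. \<exists>\<delta>>0. \<forall>s. z - \<delta> < s \<and> s < z \<longrightarrow> f s \<le> - c * (z - s)" if "\<mu> < z" "f z = 0" for z
      using iv that Liminf_left_upper_bound by blast
  qed (use i M in auto)
  \<comment> \<open>Starting from the set of constants makes compactness, boundedness and invariance
    direct; the identification with restricted entire solutions then rests on the Liouville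
    theorem.\<close>
  define A where "A = const_fun k ` (E \<inter> {0..M})"
  have F: "F = closure (half_space k)" by (simp add: F_def \<Omega>_def)
  have A_iff: "const_fun k z \<in> A" if "z \<in> {0..M}" "f z = 0" for z
    using that by (auto simp: A_def E_def)
  have comp: "compactin (C2h_loc_topology F \<beta>) A" for \<beta>
    unfolding A_def F E_def
    by (rule image_compactin[OF _ const_fun_continuous_map]) (simp add: zeros_compact)
  have bounded: "bounded_in_C2h_b F \<beta> A" for \<beta>
    unfolding bounded_in_C2h_b_def
  proof (intro conjI exI[of _ M] ballI)
    show "A \<subseteq> C2h_b F \<beta>" unfolding A_def F using const_fun_in_C2h_b by blast
    fix w assume "w \<in> A"
    then obtain z where "w = const_fun k z" "\<bar>z\<bar> \<le> M" by (auto simp: A_def)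
    then show "C2h_b_norm F \<beta> w \<le> ennreal M"
      using const_fun_C2h_b_norm[of k \<beta> z] unfolding F by (metis ennreal_leI order_trans)
  qed
  have restr: "A = (\<lambda>u. restrict u F) ` KplusM f UNIV M"
  proof (intro subset_antisym subsetI)
    fix w assume "w \<in> A"
    then obtain z where z: "w = restrict (\<lambda>x. z) F" "z \<in> {0..M}" "f z = 0"
      by (auto simp: A_def E_def const_fun_def F)
    then show "w \<in> (\<lambda>u. restrict u F) ` KplusM f UNIV M" using const_in_KplusM_UNIV by blast
  next
    fix w assume "w \<in> (\<lambda>u. restrict u F) ` KplusM f UNIV M"
    then obtain u where u: "u \<in> KplusM f UNIV M" "w = restrict u F" by blast
    from KplusM_UNIV_const[OF u(1)] obtain z where "z \<in> {0..M}" "f z = 0" "u = (\<lambda>x. z)" by blast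
    then show "w \<in> A" using A_iff[of z] u(2) by (simp add: const_fun_def F)
  qed
  have attr: "global_attractor k (KplusM f \<Omega> M) A"
    unfolding global_attractor_def
  proof (intro conjI ballI allI impI)
    show "A \<subseteq> KplusM f \<Omega> M" unfolding A_def \<Omega>_def E_def by (auto intro: const_fun_in_KplusM)
    show "compactin (C2h_loc_topology (closure (half_space k)) \<beta>) A" for \<beta> using comp F by simp
    show "shift k h ` A = A" if "h \<ge> 0" for h
      using shift_const_fun[OF that, of k] by (simp add: A_def image_image)
    fix B \<beta> V
    assume asm: "B \<subseteq> KplusM f \<Omega> M \<and> \<beta> \<in> {0..<1} \<and>
        (\<exists>U. openin (C2h_loc_topology (closure (half_space k)) \<beta>) U \<and> A \<subseteq> U \<and> U \<subseteq> V)"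
    then obtain U where U: "C2h_loc_open (closure (half_space k)) \<beta> U" "A \<subseteq> U" "U \<subseteq> V"
      unfolding openin_C2h_loc_topology by blast
    have "\<exists>h0>0. \<forall>h\<ge>h0. shift k h ` B \<subseteq> U"
      by (rule uniform_attraction[OF _ _ U(1)]) (use asm U(2) A_iff in \<open>auto simp: \<Omega>_def\<close>)
    then show "\<exists>h0>0. \<forall>h\<ge>h0. shift k h ` B \<subseteq> V" using U(3) by (meson order_trans)
  qed
  have conv: "\<exists>!z. z \<in> E \<inter> {0..M} \<and>
      (\<forall>\<beta>\<in>{0..<1}. limitin (C2h_loc_topology F \<beta>) (\<lambda>h. shift k h u) (const_fun k z) at_top)"
    if u: "u \<in> Kplus f \<Omega>" "\<forall>x\<in>F. 0 \<le> u x \<and> u x \<le> M" for u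
  proof -
    have "u \<in> KplusM f (half_space k) M" using u by (simp add: KplusM_def F_def \<Omega>_def)
    then obtain z where z: "z \<in> {0..M}" "f z = 0" and
      ev: "\<And>\<beta> U. \<beta> \<in> {0..<1} \<Longrightarrow> C2h_loc_open F \<beta> U \<Longrightarrow> const_fun k z \<in> U \<Longrightarrow>
        \<forall>\<^sub>F h in at_top. shift k h u \<in> U"
      unfolding F by (rule trajectory_converges) blast
    show ?thesis
    proof (rule ex1I[of _ z])
      show "z \<in> E \<inter> {0..M} \<and>
          (\<forall>\<beta>\<in>{0..<1}. limitin (C2h_loc_topology F \<beta>) (\<lambda>h. shift k h u) (const_fun k z) at_top)"
        unfolding limitin_def topspace_C2h_loc_topology openin_C2h_loc_topology
        using z ev const_fun_in_C2h_loc by (auto simp: E_def F)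
      fix z' assume "z' \<in> E \<inter> {0..M} \<and>
          (\<forall>\<beta>\<in>{0..<1}. limitin (C2h_loc_topology F \<beta>) (\<lambda>h. shift k h u) (const_fun k z') at_top)"
      \<comment> \<open>The single exponent 0 already decides uniqueness: evaluation at the origin
        separates distinct constants by open sets that require values within half their
        distance.\<close>
      then have lim: "limitin (C2h_loc_topology F 0) (\<lambda>h. shift k h u) (const_fun k z') at_top" by auto
      have in0: "0 \<in> F" unfolding F by (rule zero_in_closure_half_space)
      show "z' = z"
      proof (rule ccontr)
        assume ne: "z' \<noteq> z"
        define U where "U = (\<lambda>c. {w \<in> C2h_loc F 0. \<bar>w 0 - c\<bar> < \<bar>z' - z\<bar> / 2})"
        have U: "C2h_loc_open F 0 (U c)" "const_fun k c \<in> U c" for c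
        proof -
          show "C2h_loc_open F 0 (U c)" unfolding U_def by (rule evaluation_open[OF in0])
          show "const_fun k c \<in> U c"
            using const_fun_in_C2h_loc[of k c 0] in0 ne by (simp add: U_def F const_fun_eq)
        qed
        have "\<forall>\<^sub>F h in at_top. shift k h u \<in> U z" by (rule ev[OF _ U]) simp
        moreover have "\<forall>\<^sub>F h in at_top. shift k h u \<in> U z'"
          using lim U unfolding limitin_def openin_C2h_loc_topology by blast
        ultimately have "\<forall>\<^sub>F h::real in at_top. False"
        proof eventually_elim
          case (elim h)
          then show False
            using abs_triangle_ineq4[of "shift k h u 0 - z" "shift k h u 0 - z'"] by (simp add: U_def)
        qed
        then show False by simp
      qed
    qed
  qed
  show ?thesis
    by (intro conjI exI[of _ A] ballI impI attr bounded comp restr A_def conv) auto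
qed

end
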